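(* Let $\Gamma$ be the dual group of the compact group $G=(\mathbb{Z}/2\mathbb{Z})^{\mathbb{N}}$, and let $w$ be a real-valued nondecreasing function of $x\ge 1$ such that $w(x)\ge 1$ for all $x\ge 1$ and $\lim_{x\to\infty}w(x)=\infty$. Then there exists a subset $\Lambda$ of $\Gamma$ which is a set of analyticity and such that, for every integer $k\ge1$ and every $k$-mesh $M\subset\Gamma$, $$|\Lambda\cap M|\le k\,w(k).$$
   Context: $|S|$ denotes the cardinality of a set $S$. The dual group $\Gamma$ of a compact abelian group $G$ is the discrete abelian group of continuous characters of $G$, written additively as an abstract group. For an integer $k\ge1$, a $k$-mesh in $\Gamma$ is a set of the form $$M=\Big\{\sum_{j=1}^k n_j\gamma_j : (n_1,\dots,n_k)\in E\Big\},$$ where $\gamma_1,\dots,\gamma_k\in\Gamma$ and $E$ is a subset of $\mathbb{Z}^k$. $A(\Gamma)$ denotes the set of Fourier transforms $\gamma\mapsto\int_G f(g)\overline{\gamma(g)}\,dg$ of complex-valued functions $f\in L^1(G)$ ($dg$ being normalized Haar measure). For $\Lambda\subset\Gamma$, $A(\Lambda)$ denotes the space of restrictions to $\Lambda$ of the functions in $A(\Gamma)$. A (complex-valued) function $F$ defined on an open real interval $I$ containing $0$ is said to operate in $A(\Lambda)$ if, for every $f\in A(\Lambda)$ with values in $I$, one has $F\circ f\in A(\Lambda)$. The set $\Lambda$ is a set of analyticity if the only functions that operate in $A(\Lambda)$ are the analytic functions vanishing at $0$; that is, every function $F$ (on any open interval $I\ni 0$) that operates in $A(\Lambda)$ satisfies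 $F(0)=0$ and is real-analytic in a neighbourhood of $0$. *)

theory Defs
  imports "HOL-Probability.Probability" "HOL-Library.Function_Algebras" "HOL-Library.Z2"
begin

section \<open>The compact group $(\mathbb{Z}/2\mathbb{Z})^{\mathbb{N}}$\<close>

text \<open>\<^typ>\<open>bit\<close> is \<open>\<int>/2\<int>\<close> with addition modulo 2; it gets the discrete topology.  On function types,
  the topology is the product topology and addition is pointwise.\<close>

instantiation bit :: discrete_topology
begin

definition open_bit :: "bit set \<Rightarrow> bool"
  where "open_bit S \<longleftrightarrow> True"

instance
  by standard (simp_all add: open_bit_def)

end

instance bit :: finite
proof
  have "UNIV = {0, 1 :: bit}"
    by (metis (mono_tags) UNIV_eq_I bit_not_zero_iff insertCI)
  then show "finite (UNIV :: bit set)"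
    by (metis finite.emptyI finite.insertI)
qed

instance bit :: second_countable_topology
proof
  have "open = generate_topology (UNIV :: bit set set)"
    by (auto simp: fun_eq_iff open_bit_def intro: generate_topology.Basis)
  then show "\<exists>B :: bit set set. countable B \<and> open = generate_topology B"
    by (metis countable_finite finite)
qed

instance bit :: topological_ab_group_add
proof
  fix a b :: bit
  show "LIM x (nhds a \<times>\<^sub>F nhds b). fst x + snd x :> nhds (a + b)"
    unfolding nhds_discrete filterlim_principal eventually_prod_filter eventually_principal
    by (rule exI[of _ "\<lambda>x. x = a"], rule exI[of _ "\<lambda>x. x = b"]) simp
  show "(uminus \<longlongrightarrow> - a) (nhds a)"
    by (simp add: nhds_discrete filterlim_principal eventually_principal)
qed

instance "fun" :: (type, topological_ab_group_add) topological_ab_group_add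
proof
  fix a b :: "'a \<Rightarrow> 'b"
  have "continuous_on UNIV (\<lambda>p :: ('a \<Rightarrow> 'b) \<times> ('a \<Rightarrow> 'b). fst p + snd p)"
    unfolding plus_fun_def
    by (rule continuous_on_coordinatewise_then_product,
        rule continuous_on_add[OF
          continuous_on_product_then_coordinatewise[OF continuous_on_fst[OF continuous_on_id]]
          continuous_on_product_then_coordinatewise[OF continuous_on_snd[OF continuous_on_id]]])
  then have "((\<lambda>p :: ('a \<Rightarrow> 'b) \<times> ('a \<Rightarrow> 'b). fst p + snd p) \<longlongrightarrow> fst (a, b) + snd (a, b)) (at (a, b))"
    unfolding continuous_on_def by blast
  then show "LIM x (nhds a \<times>\<^sub>F nhds b). fst x + snd x :> nhds (a + b)"
    using tendsto_at_iff_tendsto_nhds[of "\<lambda>p. fst p + snd p" "(a, b)"] by (simp add: nhds_prod)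
next
  fix a :: "'a \<Rightarrow> 'b"
  have "continuous_on UNIV (uminus :: ('a \<Rightarrow> 'b) \<Rightarrow> _)"
    unfolding fun_Compl_def
    by (rule continuous_on_coordinatewise_then_product,
        rule continuous_on_minus[OF continuous_on_product_then_coordinatewise[OF continuous_on_id]])
  then have "((uminus :: ('a \<Rightarrow> 'b) \<Rightarrow> _) \<longlongrightarrow> - a) (at a)"
    unfolding continuous_on_def by blast
  then show "(uminus \<longlongrightarrow> - a) (nhds a)"
    unfolding tendsto_at_iff_tendsto_nhds .
qed

type_synonym cantor_group = "nat \<Rightarrow> bit"


section \<open>Normalized Haar measure\<close>

text \<open>No regularity condition is needed here: on a compact metrizable group, every finite Borel measure is
  regular.  For \<open>(\<int>/2\<int>)\<^sup>\<nat>\<close>, existence and uniqueness are shown below; the measure is the law of a sequence of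
  independent fair coin tosses.\<close>

definition is_haar_prob :: "'g :: topological_ab_group_add measure \<Rightarrow> bool" where
  "is_haar_prob M \<longleftrightarrow> sets M = sets borel \<and> prob_space M \<and> (\<forall>x. distr M borel ((+) x) = M)"

definition haar :: "'g :: topological_ab_group_add measure" where
  "haar = (THE M. is_haar_prob M)"

lemma is_haar_prob_unique:
  fixes M N :: "'g :: {topological_ab_group_add, second_countable_topology} measure"
  assumes M: "is_haar_prob M" and N: "is_haar_prob N"
  shows "M = N"
proof (rule measure_eqI)
  show "sets M = sets N"
    using M N by (simp add: is_haar_prob_def)
next
  fix A assume "A \<in> sets M"
  then have A: "A \<in> sets borel"
    using M by (simp add: is_haar_prob_def)
  interpret M: prob_space M using M by (simp add: is_haar_prob_def)
  interpret N: prob_space N using N by (simp add: is_haar_prob_def)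
  interpret pair_sigma_finite M N
    by (rule pair_sigma_finite.intro) (rule M.sigma_finite_measure_axioms N.sigma_finite_measure_axioms)+
  have sM: "sets M = sets borel" and sN: "sets N = sets borel"
    using M N by (simp_all add: is_haar_prob_def)
  have spM: "space M = UNIV" and spN: "space N = UNIV"
    using sets_eq_imp_space_eq[OF sM] sets_eq_imp_space_eq[OF sN] by simp_all
  have inv: "emeasure K {y. x + y \<in> A} = emeasure K A" if "is_haar_prob K" for K :: "'g measure" and x
  proof -
    have K: "distr K borel ((+) x) = K" and sK: "sets K = sets borel"
      using that by (auto simp: is_haar_prob_def)
    have "(+) x \<in> measurable K borel"
      unfolding measurable_cong_sets[OF sK refl]
      by (rule borel_measurable_continuous_onI[OF continuous_on_add[OF continuous_on_const continuous_on_id]])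
    then have "emeasure (distr K borel ((+) x)) A = emeasure K ((+) x -` A \<inter> space K)"
      using A by (rule emeasure_distr)
    also have "(+) x -` A \<inter> space K = {y. x + y \<in> A}"
      using sets_eq_imp_space_eq[OF sK] by auto
    finally show ?thesis using K by simp
  qed
  define X where "X = {p :: 'g \<times> 'g. fst p + snd p \<in> A}"
  have "(\<lambda>p :: 'g \<times> 'g. fst p + snd p) \<in> borel_measurable borel"
    by (rule borel_measurable_continuous_onI[OF continuous_on_add[OF
          continuous_on_fst[OF continuous_on_id] continuous_on_snd[OF continuous_on_id]]])
  then have "(\<lambda>p :: 'g \<times> 'g. fst p + snd p) -` A \<inter> space borel \<in> sets borel"
    using A by (rule measurable_sets)
  then have "X \<in> sets (borel \<Otimes>\<^sub>M borel)"
    unfolding X_def borel_prod by (simp add: vimage_def)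
  then have X: "X \<in> sets (M \<Otimes>\<^sub>M N)"
    by (simp only: sets_pair_measure_cong[OF sM sN])
  have "emeasure (M \<Otimes>\<^sub>M N) X = (\<integral>\<^sup>+x. emeasure N (Pair x -` X) \<partial>M)"
    by (rule N.emeasure_pair_measure_alt[OF X])
  also have "\<dots> = (\<integral>\<^sup>+x. emeasure N A \<partial>M)"
    using inv[OF N] by (simp add: X_def vimage_def)
  also have "\<dots> = emeasure N A"
    by (simp add: M.emeasure_space_1)
  finally have 1: "emeasure (M \<Otimes>\<^sub>M N) X = emeasure N A" .
  have "emeasure (M \<Otimes>\<^sub>M N) X = (\<integral>\<^sup>+y. emeasure M ((\<lambda>x. (x, y)) -` X) \<partial>N)"
    by (rule emeasure_pair_measure_alt2[OF X])
  also have "\<dots> = (\<integral>\<^sup>+y. emeasure M A \<partial>N)"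
    using inv[OF M] by (simp add: X_def vimage_def add.commute)
  also have "\<dots> = emeasure M A"
    by (simp add: N.emeasure_space_1)
  finally show "emeasure M A = emeasure N A"
    using 1 by simp
qed

definition coin :: "cantor_group measure" where
  "coin = (\<Pi>\<^sub>M i\<in>UNIV. uniform_count_measure UNIV)"

lemma is_haar_prob_coin: "is_haar_prob coin"
proof -
  let ?U = "uniform_count_measure (UNIV :: bit set)"
  interpret U: prob_space ?U
    by (rule prob_space_uniform_count_measure) auto
  interpret P: product_prob_space "\<lambda>_ :: nat. ?U" UNIV ..
  have sb: "sets (borel :: bit measure) = UNIV"
    by (intro equalityI subset_UNIV subsetI) (rule borel_open[OF Topological_Spaces.open_discrete])
  have "sets coin = sets (\<Pi>\<^sub>M i\<in>(UNIV :: nat set). (borel :: bit measure))"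
    unfolding coin_def by (rule sets_PiM_cong) (simp_all add: sb sets_uniform_count_measure)
  then have sets: "sets coin = sets borel"
    by (simp add: sets_PiM_equal_borel)
  have "distr coin borel ((+) x) = coin" for x
    unfolding coin_def
  proof (rule P.PiM_eq)
    show "sets (distr (Pi\<^sub>M UNIV (\<lambda>i :: nat. ?U)) borel ((+) x)) = sets (\<Pi>\<^sub>M i\<in>UNIV. ?U)"
      by (simp only: sets_distr sets[unfolded coin_def])
  next
    fix J :: "nat set" and F :: "nat \<Rightarrow> bit set"
    assume J: "finite J"
    let ?E = "prod_emb UNIV (\<lambda>i. ?U) J (Pi\<^sub>E J F)"
    have E: "prod_emb UNIV (\<lambda>i. ?U) J (Pi\<^sub>E J G) = {y. \<forall>i\<in>J. y i \<in> G i}" for G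
      by (auto simp: prod_emb_def space_uniform_count_measure)
    have m: "?E \<in> sets borel"
      unfolding sets[symmetric] coin_def
      by (rule sets_PiM_I[OF J subset_UNIV]) (simp add: sets_uniform_count_measure)
    have "(+) x \<in> measurable coin borel"
      unfolding measurable_cong_sets[OF sets refl]
      by (rule borel_measurable_continuous_onI[OF continuous_on_add[OF continuous_on_const continuous_on_id]])
    then have "emeasure (distr coin borel ((+) x)) ?E = emeasure coin ((+) x -` ?E \<inter> space coin)"
      using m by (rule emeasure_distr)
    also have "(+) x -` ?E \<inter> space coin = prod_emb UNIV (\<lambda>i. ?U) J (\<Pi>\<^sub>E i\<in>J. (+) (x i) -` F i)"
      unfolding E using sets_eq_imp_space_eq[OF sets] by simp
    also have "emeasure coin \<dots> = (\<Prod>i\<in>J. emeasure ?U ((+) (x i) -` F i))"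
      unfolding coin_def
      by (rule P.emeasure_PiM_emb[OF subset_UNIV J]) (simp add: sets_uniform_count_measure)
    also have "\<dots> = (\<Prod>i\<in>J. emeasure ?U (F i))"
    proof (rule prod.cong[OF refl])
      fix i assume "i \<in> J"
      have "card ((+) (x i) -` F i) = card (F i)"
        by (rule card_vimage_inj) (rule injI, simp only: add_left_cancel, simp only: surj_plus subset_UNIV)
      then show "emeasure ?U ((+) (x i) -` F i) = emeasure ?U (F i)"
        by (simp only: emeasure_uniform_count_measure[OF finite subset_UNIV])
    qed
    finally show "emeasure (distr (Pi\<^sub>M UNIV (\<lambda>i. ?U)) borel ((+) x)) ?E = (\<Prod>j\<in>J. emeasure ?U (F j))"
      unfolding coin_def .
  qed
  moreover have "prob_space coin"
    unfolding coin_def by (rule P.prob_space_axioms)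
  ultimately show ?thesis
    using sets by (simp add: is_haar_prob_def)
qed

lemma haar_eq_coin: "haar = coin"
  unfolding haar_def using is_haar_prob_coin is_haar_prob_unique by blast

lemma is_haar_prob_haar: "is_haar_prob (haar :: cantor_group measure)"
  by (simp add: haar_eq_coin is_haar_prob_coin)


section \<open>The dual group and meshes\<close>

text \<open>Characters are kept as functions \<open>G \<Rightarrow> \<complex>\<close>, so the group law of the dual, which is written
  additively on paper, is pointwise multiplication here: \<open>\<Sum>\<^sub>j n\<^sub>j \<gamma>\<^sub>j\<close> is \<open>g \<mapsto> \<Prod>\<^sub>j \<gamma>\<^sub>j(g) powi n\<^sub>j\<close>.\<close>

definition dual_group :: "('g :: topological_ab_group_add \<Rightarrow> complex) set" where
  "dual_group = {\<gamma>. continuous_on UNIV \<gamma> \<and> (\<forall>x. cmod (\<gamma> x) = 1) \<and> (\<forall>x y. \<gamma> (x + y) = \<gamma> x * \<gamma> y)}"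

definition is_mesh :: "nat \<Rightarrow> ('g :: topological_ab_group_add \<Rightarrow> complex) set \<Rightarrow> bool" where
  "is_mesh k M \<longleftrightarrow>
     (\<exists>\<gamma> E. (\<forall>j\<in>{1..k}. \<gamma> j \<in> dual_group) \<and> E \<subseteq> ({1..k} \<rightarrow>\<^sub>E (UNIV :: int set)) \<and>
        M = {(\<lambda>g. \<Prod>j=1..k. \<gamma> j g powi n j) | n. n \<in> E})"


section \<open>The spaces $A(\Lambda)$ and sets of analyticity\<close>

text \<open>A function on \<open>\<Lambda>\<close> is represented by its extension with value \<^const>\<open>undefined\<close> outside \<open>\<Lambda>\<close>.\<close>

definition fourier :: "('g :: topological_ab_group_add \<Rightarrow> complex) \<Rightarrow> ('g \<Rightarrow> complex) \<Rightarrow> complex" where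
  "fourier f = (\<lambda>\<gamma>\<in>dual_group. \<integral>g. f g * cnj (\<gamma> g) \<partial>haar)"

definition A_dual :: "(('g :: topological_ab_group_add \<Rightarrow> complex) \<Rightarrow> complex) set" where
  "A_dual = {fourier f | f. integrable haar f}"

definition A_on :: "('g :: topological_ab_group_add \<Rightarrow> complex) set
    \<Rightarrow> (('g \<Rightarrow> complex) \<Rightarrow> complex) set" where
  "A_on \<Lambda> = {restrict \<phi> \<Lambda> | \<phi>. \<phi> \<in> A_dual}"

definition operates :: "(real \<Rightarrow> complex) \<Rightarrow> real set
    \<Rightarrow> ('g :: topological_ab_group_add \<Rightarrow> complex) set \<Rightarrow> bool" where
  "operates F I \<Lambda> \<longleftrightarrow>
     (\<forall>\<phi>\<in>A_on \<Lambda>. (\<forall>\<gamma>\<in>\<Lambda>. \<phi> \<gamma> \<in> complex_of_real ` I) \<longrightarrow> (\<lambda>\<gamma>\<in>\<Lambda>. F (Re (\<phi> \<gamma>))) \<in> A_on \<Lambda>)"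

definition real_analytic_at :: "(real \<Rightarrow> complex) \<Rightarrow> real \<Rightarrow> bool" where
  "real_analytic_at F x \<longleftrightarrow>
     (\<exists>a r. r > 0 \<and> (\<forall>t. \<bar>t - x\<bar> < r \<longrightarrow> (\<lambda>n. a n * complex_of_real (t - x) ^ n) sums F t))"

definition set_of_analyticity :: "('g :: topological_ab_group_add \<Rightarrow> complex) set \<Rightarrow> bool" where
  "set_of_analyticity \<Lambda> \<longleftrightarrow>
     (\<forall>I F. open I \<and> is_interval I \<and> 0 \<in> I \<and> operates F I \<Lambda> \<longrightarrow>
        F 0 = 0 \<and> (\<exists>U. open U \<and> 0 \<in> U \<and> U \<subseteq> I \<and> (\<forall>x\<in>U. real_analytic_at F x)))"

end

(* Lambda is a union of random subsets Lambda_n of independent blocks V_n = {walsh A. A \<subseteq> D_n}, each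
   of size 2pL in a space of dimension 2p.  With high probability the part of Lambda_n in the span of b of
   its elements has at most b elements while b \<le> q, and fewer than 2b while b \<le> p; beyond that
   |Lambda_n| = 2pL suffices, and q is taken so large that w \<ge> 2L there.  A k-mesh lies in a group of at
   most 2^k elements, so independent generators of its parts in the blocks number at most k altogether.

   Analyticity: by gluing, F operates with uniform norms on the late blocks.  Let f_n be the mean of n Rademacher
   coordinates of a character.  The functional with weights exp(-i n f_n) on Lambda_n has dual norm at most
   6 (sin 1)^n |Lambda_n|, as the transform of exp(-i n f_n) on all of V_n is a product of n factors bounded by
   sin 1 and random sampling preserves this up to a constant.  Pairing it with F(sigma cos(s + f_n)), whose
   argument has bounded norm, and averaging over s shows that the n-th cosine coefficient of F(sigma cos s)
   is O((sin 1)^n), so F is analytic near 0. *)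

theory Submission
  imports Defs "HOL-Complex_Analysis.Complex_Analysis" "HOL-Real_Asymp.Real_Asymp"
begin

section \<open>Walsh functions\<close>

text \<open>The two requirements pull against each other. Sampling keeps the oscillating functional
  small only when the sample has L points per dimension, with L of order (sin 1)^(-2n), so the
  blocks get denser as n grows and only the divergence of \<open>w\<close> makes room for them. The
  parameters are therefore chosen in the order n, L, q, p: L comes from n, q marks where
  \<open>w\<close> has passed 2L, and p comes last, so large that 2^p beats the number of
  (q+1)-tuples of sample points; up to dimension q a span of sample points then contains no further
  one. The number sin 1 arises because n times the mean of n signs gives each coordinate an angle of
  exactly 1 or -1, and half the sum and half the difference of cis 1 and cis (-1) have moduli cos 1
  and sin 1, both below 1. The argument cos (s + f_n) involves the angles 1/n instead, so its norm
  stays below (cos (1/n) + sin (1/n))^n \<le> e for every n: bounded norm against exponential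
  cancellation. The given F is an arbitrary function; averaging over s needs its continuity near 0,
  which takes a separate argument.\<close>

definition walsh :: "nat set \<Rightarrow> cantor_group \<Rightarrow> complex" where
  "walsh A = (\<lambda>x. \<Prod>i\<in>A. if x i = 0 then 1 else - 1)"

definition ind :: "nat set \<Rightarrow> cantor_group" where
  "ind X = (\<lambda>i. if i \<in> X then 1 else 0)"

lemma walsh_empty [simp]: "walsh {} = (\<lambda>x. 1)"
  by (simp add: walsh_def)

lemma bit_double [simp]: "(b :: bit) + b = 0"
  by (cases "b = 0") auto

lemma walsh_add: "walsh A (x + y) = walsh A x * walsh A y"
  unfolding walsh_def prod.distrib[symmetric]
proof (rule prod.cong[OF refl])
  fix i
  have "x i = 0 \<or> x i = 1" "y i = 0 \<or> y i = 1" by (metis bit_not_zero_iff)+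
  then show "(if (x + y) i = 0 then 1 else - 1) =
      (if x i = 0 then 1 else - 1) * (if y i = 0 then 1 else (- 1 :: complex))"
    by auto
qed

lemma walsh_zero [simp]: "walsh A 0 = 1"
  by (simp add: walsh_def)

lemma cmod_walsh [simp]: "cmod (walsh A x) = 1"
  unfolding walsh_def prod_norm[symmetric] by (rule prod.neutral) auto

lemma walsh_square [simp]: "walsh A x * walsh A x = 1"
  unfolding walsh_def prod.distrib[symmetric] by (rule prod.neutral) auto

lemma walsh_cases: "walsh A x = 1 \<or> walsh A x = - 1"
  using walsh_square[of A x] by (metis square_eq_1_iff)

lemma cnj_walsh [simp]: "cnj (walsh A x) = walsh A x"
  using walsh_cases[of A x] by auto

lemma Im_walsh [simp]: "Im (walsh A x) = 0"
  using walsh_cases[of A x] by auto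

lemma of_real_Re_walsh [simp]: "of_real (Re (walsh A x)) = walsh A x"
  by (simp add: complex_eq_iff)

lemma continuous_on_walsh: "continuous_on S (walsh A)"
  unfolding walsh_def
proof (rule continuous_on_prod)
  fix i
  have "continuous_on S (\<lambda>x :: cantor_group. x i)"
    by (rule continuous_on_product_then_coordinatewise[OF continuous_on_id])
  moreover have "continuous_on UNIV (\<lambda>b :: bit. if b = 0 then 1 else (- 1 :: complex))"
    unfolding continuous_on_open_vimage[OF open_UNIV] by (simp add: Topological_Spaces.open_discrete)
  ultimately show "continuous_on S (\<lambda>x :: cantor_group. if x i = 0 then 1 else (- 1 :: complex))"
    using continuous_on_compose2[of UNIV "\<lambda>b :: bit. if b = 0 then 1 else (- 1 :: complex)" S "\<lambda>x. x i"]
    by auto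
qed

lemma walsh_in_dual_group: "walsh A \<in> dual_group"
  by (simp add: dual_group_def continuous_on_walsh walsh_add)

lemma walsh_ind_singleton: "finite A \<Longrightarrow> walsh A (ind {j}) = (if j \<in> A then - 1 else 1)"
proof -
  assume "finite A"
  then have "(\<Prod>i\<in>A. if i = j then - 1 else 1) = (if j \<in> A then - 1 else (1 :: complex))"
    by (rule prod.delta)
  moreover have "walsh A (ind {j}) = (\<Prod>i\<in>A. if i = j then - 1 else 1)"
    unfolding walsh_def ind_def by (rule prod.cong) auto
  ultimately show ?thesis by simp
qed

text \<open>The points \<open>ind {j}\<close> read off membership of \<open>j\<close>. Finiteness
  matters: a product over an infinite set is 1 by convention, so every infinite index set yields the
  trivial character.\<close>

lemma walsh_inj: "finite A \<Longrightarrow> finite B \<Longrightarrow> walsh A = walsh B \<Longrightarrow> A = B"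
  by (auto simp: set_eq_iff) (metis walsh_ind_singleton one_neq_neg_one)+

text \<open>Characters of a block see only the coordinates in \<open>D\<close>. A supremum over the
  whole group is thus a maximum over the points \<open>ind X\<close> with
  \<open>X \<subseteq> D\<close>, which a union bound can handle.\<close>

lemma walsh_eq_ind_Int:
  assumes "finite D" "A \<subseteq> D"
  shows "walsh A x = walsh A (ind {i \<in> D. x i = 1})"
  unfolding walsh_def
  by (rule prod.cong[OF refl]) (use assms in \<open>auto simp: ind_def\<close>)

text \<open>The pairing is \<open>(-1) ^ card (A \<inter> X)\<close>, so it is multiplicative in
  \<open>X\<close> too: the values at singletons determine those at all
  \<open>ind X\<close>.\<close>

lemma walsh_ind:
  assumes "finite A" "finite X"
  shows "walsh A (ind X) = (\<Prod>j\<in>X. walsh A (ind {j}))"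
proof -
  have "walsh A (ind X) = (\<Prod>i\<in>A. if i \<in> X then - 1 else 1)"
    unfolding walsh_def ind_def by (rule prod.cong) auto
  also have "\<dots> = (\<Prod>i\<in>A \<inter> X. - 1)"
    by (rule prod.inter_restrict[OF assms(1), symmetric])
  also have "\<dots> = (\<Prod>j\<in>X. if j \<in> A then - 1 else 1)"
    by (subst Int_commute, rule prod.inter_restrict[OF assms(2)])
  finally show ?thesis
    by (simp add: walsh_ind_singleton assms)
qed

section \<open>Haar measure and Fourier transforms\<close>

abbreviation \<mu> :: "cantor_group measure" where "\<mu> \<equiv> haar"

interpretation \<mu>: prob_space \<mu>
  using is_haar_prob_haar by (simp add: is_haar_prob_def)

lemma sets_haar [measurable_cong]: "sets \<mu> = sets borel"
  using is_haar_prob_haar by (simp add: is_haar_prob_def)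

lemma space_haar [simp]: "space \<mu> = UNIV"
  using sets_eq_imp_space_eq[OF sets_haar] by simp

lemma haar_measurable_walsh [measurable]: "walsh A \<in> borel_measurable \<mu>"
  unfolding measurable_cong_sets[OF sets_haar refl]
  by (rule borel_measurable_continuous_onI[OF continuous_on_walsh])

lemma integral_haar_translate:
  fixes f :: "cantor_group \<Rightarrow> complex"
  assumes [measurable]: "f \<in> borel_measurable borel"
  shows "(\<integral>x. f (y + x) \<partial>\<mu>) = (\<integral>x. f x \<partial>\<mu>)"
proof -
  have m: "(+) y \<in> measurable \<mu> borel"
    unfolding measurable_cong_sets[OF sets_haar refl]
    by (rule borel_measurable_continuous_onI[OF continuous_on_add[OF continuous_on_const continuous_on_id]])
  have "(\<integral>x. f x \<partial>distr \<mu> borel ((+) y)) = (\<integral>x. f (y + x) \<partial>\<mu>)"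
    by (rule integral_distr[OF m]) simp
  moreover have "distr \<mu> borel ((+) y) = \<mu>"
    using is_haar_prob_haar by (simp add: is_haar_prob_def)
  ultimately show ?thesis by simp
qed

lemma integrable_walsh [simp]: "integrable \<mu> (walsh A)"
  by (rule \<mu>.integrable_const_bound[where B = 1]) auto

lemma integrable_mult_walsh:
  "integrable \<mu> f \<Longrightarrow> integrable \<mu> (\<lambda>x. f x * walsh A x)"
  by (rule Bochner_Integration.integrable_bound[of \<mu> f]) (auto simp: norm_mult)

text \<open>Translation by \<open>ind {j}\<close>, with \<open>j\<close> in just one of two
  different index sets, flips the sign of the integrand, so the invariant integral equals its own
  negative.\<close>

lemma walsh_orthogonal:
  assumes "finite A" "finite B"
  shows "(\<integral>x. walsh A x * walsh B x \<partial>\<mu>) = (if A = B then 1 else 0)"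
proof (cases "A = B")
  case True
  then show ?thesis using \<mu>.prob_space by simp
next
  case False
  then obtain j where j: "j \<in> A \<and> j \<notin> B \<or> j \<in> B \<and> j \<notin> A" by blast
  let ?f = "\<lambda>x. walsh A x * walsh B x"
  have m: "walsh C \<in> borel_measurable borel" for C
    by (rule borel_measurable_continuous_onI[OF continuous_on_walsh])
  have "?f (ind {j}) = - 1"
    using j by (auto simp: walsh_ind_singleton assms)
  then have "?f (ind {j} + x) = - ?f x" for x
    by (metis (no_types, lifting) walsh_add mult.assoc mult.left_commute mult_minus1)
  then have "(\<integral>x. - ?f x \<partial>\<mu>) = (\<integral>x. ?f x \<partial>\<mu>)"
    using integral_haar_translate[of ?f "ind {j}"] m by simp
  then show ?thesis using False by simp
qed

section \<open>Estimates and constructions for transforms of integrable functions\<close>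

lemma fourier_walsh:
  "fourier G (walsh A) = (\<integral>x. G x * walsh A x \<partial>\<mu>)"
  by (simp add: fourier_def walsh_in_dual_group)

text \<open>The sum is the integral of \<open>G\<close> times the trigonometric polynomial with
  coefficients \<open>c\<close>, so a sup bound on that polynomial bounds the dual norm of the
  functional.\<close>

lemma fourier_sum_bound:
  assumes G: "integrable \<mu> G" and S: "finite S" "S \<subseteq> range walsh"
    and B: "\<And>x. cmod (\<Sum>\<gamma>\<in>S. c \<gamma> * \<gamma> x) \<le> B"
  shows "cmod (\<Sum>\<gamma>\<in>S. c \<gamma> * fourier G \<gamma>) \<le> B * (\<integral>x. cmod (G x) \<partial>\<mu>)"
proof -
  have i: "integrable \<mu> (\<lambda>x. c \<gamma> * (G x * \<gamma> x))" if "\<gamma> \<in> S" for \<gamma>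
    using that S integrable_mult_walsh[OF G] by (intro integrable_mult_right) auto
  have "(\<Sum>\<gamma>\<in>S. c \<gamma> * fourier G \<gamma>) = (\<Sum>\<gamma>\<in>S. \<integral>x. c \<gamma> * (G x * \<gamma> x) \<partial>\<mu>)"
    by (rule sum.cong) (use S in \<open>auto simp: fourier_walsh\<close>)
  also have "\<dots> = (\<integral>x. (\<Sum>\<gamma>\<in>S. c \<gamma> * (G x * \<gamma> x)) \<partial>\<mu>)"
    by (rule Bochner_Integration.integral_sum[symmetric]) (rule i)
  also have "cmod \<dots> \<le> (\<integral>x. cmod (\<Sum>\<gamma>\<in>S. c \<gamma> * (G x * \<gamma> x)) \<partial>\<mu>)"
    by (rule Bochner_Integration.integral_norm_bound)
  also have "\<dots> \<le> (\<integral>x. B * cmod (G x) \<partial>\<mu>)"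
  proof (rule integral_mono)
    show "integrable \<mu> (\<lambda>x. cmod (\<Sum>\<gamma>\<in>S. c \<gamma> * (G x * \<gamma> x)))"
      by (intro integrable_norm Bochner_Integration.integrable_sum i)
    show "integrable \<mu> (\<lambda>x. B * cmod (G x))"
      using G by auto
    fix x
    have "(\<Sum>\<gamma>\<in>S. c \<gamma> * (G x * \<gamma> x)) = G x * (\<Sum>\<gamma>\<in>S. c \<gamma> * \<gamma> x)"
      by (simp add: sum_distrib_left mult_ac)
    then show "cmod (\<Sum>\<gamma>\<in>S. c \<gamma> * (G x * \<gamma> x)) \<le> B * cmod (G x)"
      using mult_right_mono[OF B[of x] norm_ge_zero[of "G x"]] by (simp add: norm_mult mult_ac)
  qed
  finally show ?thesis by simp
qed

text \<open>The polynomial is a combination of Riesz products: \<open>2\<^sup>|\<^sup>D\<^sup>|\<close> times the indicator of the cylinder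
  \<open>{x. \<forall>i\<in>D. x i = 1 \<longleftrightarrow> i \<in> X}\<close>, which has mass one.\<close>

lemma fourier_interpolation:
  assumes D: "finite D"
  obtains G where "integrable \<mu> G" "(\<integral>x. cmod (G x) \<partial>\<mu>) \<le> (\<Sum>X\<in>Pow D. cmod (a X))"
    "\<And>A. finite A \<Longrightarrow> fourier G (walsh A) = (if A \<subseteq> D then \<Sum>X\<in>Pow D. a X * walsh A (ind X) else 0)"
proof -
  define R where "R X x = (\<Sum>B\<in>Pow D. walsh B (ind X) * walsh B x)" for X x
  have Rint: "integrable \<mu> (R X)" for X
    unfolding R_def by (intro Bochner_Integration.integrable_sum integrable_mult_right integrable_walsh)
  have Rprod: "R X x = of_real (\<Prod>j\<in>D. Re (walsh {j} (ind X) * walsh {j} x) + 1)" for X x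
  proof -
    have "(\<Prod>j\<in>D. walsh {j} (ind X) * walsh {j} x + 1) = 
        (\<Sum>B\<in>Pow D. (\<Prod>j\<in>B. walsh {j} (ind X) * walsh {j} x) * (\<Prod>j\<in>D - B. 1))"
      by (rule prod_add[OF D])
    also have "\<dots> = R X x"
      unfolding R_def by (rule sum.cong[OF refl]) (simp add: prod.distrib walsh_def)
    finally have "R X x = (\<Prod>j\<in>D. walsh {j} (ind X) * walsh {j} x + 1)" ..
    also have "\<dots> = (\<Prod>j\<in>D. of_real (Re (walsh {j} (ind X) * walsh {j} x) + 1))"
      by (rule prod.cong[OF refl]) (simp add: complex_eq_iff)
    finally show ?thesis by simp
  qed
  have nonneg: "0 \<le> Re (walsh {j} (ind X) * walsh {j} x) + 1" for j X x
    using walsh_cases[of "{j}" "ind X"] walsh_cases[of "{j}" x] by auto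
  have R1: "(\<integral>x. R X x * walsh A x \<partial>\<mu>) = (if A \<subseteq> D then walsh A (ind X) else 0)" if "finite A" for X A
  proof -
    have "(\<integral>x. R X x * walsh A x \<partial>\<mu>) = (\<integral>x. (\<Sum>B\<in>Pow D. walsh B (ind X) * (walsh B x * walsh A x)) \<partial>\<mu>)"
      by (simp add: R_def sum_distrib_right mult.assoc)
    also have "\<dots> = (\<Sum>B\<in>Pow D. walsh B (ind X) * (\<integral>x. walsh B x * walsh A x \<partial>\<mu>))"
      by (subst Bochner_Integration.integral_sum) (auto intro!: integrable_mult_right integrable_mult_walsh)
    also have "\<dots> = (\<Sum>B\<in>Pow D. if A = B then walsh B (ind X) else 0)"
      by (rule sum.cong[OF refl])
        (use D that in \<open>auto simp: walsh_orthogonal finite_subset\<close>)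
    also have "\<dots> = (if A \<subseteq> D then walsh A (ind X) else 0)"
      using D by simp
    finally show ?thesis .
  qed
  \<comment> \<open>By \<open>nonneg\<close> the kernel equals its modulus, so its L1 norm is its
    coefficient at the trivial character.\<close>
  have Rnorm: "(\<integral>x. cmod (R X x) \<partial>\<mu>) = 1" for X
  proof -
    have c: "of_real (cmod (R X x)) = R X x" for x
      unfolding Rprod norm_of_real by (subst abs_of_nonneg) (rule prod_nonneg, rule nonneg, rule refl)
    have "complex_of_real (\<integral>x. cmod (R X x) \<partial>\<mu>) = (\<integral>x. R X x \<partial>\<mu>)"
      using c by (simp flip: integral_complex_of_real)
    also have "\<dots> = 1" using R1[of "{}" X] by simp
    finally show ?thesis by simp
  qed
  define G where "G x = (\<Sum>X\<in>Pow D. a X * R X x)" for x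
  show ?thesis
  proof
    show Gi: "integrable \<mu> G"
      unfolding G_def by (intro Bochner_Integration.integrable_sum integrable_mult_right Rint)
    have "(\<integral>x. cmod (G x) \<partial>\<mu>) \<le> (\<integral>x. (\<Sum>X\<in>Pow D. cmod (a X) * cmod (R X x)) \<partial>\<mu>)"
    proof (rule integral_mono)
      show "integrable \<mu> (\<lambda>x. cmod (G x))" using Gi by auto
      show "integrable \<mu> (\<lambda>x. \<Sum>X\<in>Pow D. cmod (a X) * cmod (R X x))"
        using Rint by (intro Bochner_Integration.integrable_sum integrable_mult_right) auto
      show "cmod (G x) \<le> (\<Sum>X\<in>Pow D. cmod (a X) * cmod (R X x))" for x
        unfolding G_def norm_mult[symmetric] by (rule norm_sum)
    qed
    also have "\<dots> = (\<Sum>X\<in>Pow D. cmod (a X) * (\<integral>x. cmod (R X x) \<partial>\<mu>))"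
      using Rint by (subst Bochner_Integration.integral_sum) (auto intro!: integrable_mult_right)
    finally show "(\<integral>x. cmod (G x) \<partial>\<mu>) \<le> (\<Sum>X\<in>Pow D. cmod (a X))"
      by (simp add: Rnorm)
    fix A :: "nat set" assume A: "finite A"
    have "fourier G (walsh A) = (\<integral>x. (\<Sum>X\<in>Pow D. a X * (R X x * walsh A x)) \<partial>\<mu>)"
      by (simp add: fourier_walsh G_def sum_distrib_right mult.assoc)
    also have "\<dots> = (\<Sum>X\<in>Pow D. a X * (\<integral>x. R X x * walsh A x \<partial>\<mu>))"
      by (subst Bochner_Integration.integral_sum) (auto intro!: integrable_mult_right integrable_mult_walsh Rint)
    finally show "fourier G (walsh A) = (if A \<subseteq> D then \<Sum>X\<in>Pow D. a X * walsh A (ind X) else 0)"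
      by (simp add: R1[OF A])
  qed
qed

text \<open>Finite total norm makes the series of moduli converge almost everywhere, so that the
  pointwise sum is integrable and each coefficient may be computed termwise.\<close>

lemma fourier_suminf:
  assumes G: "\<And>j. integrable \<mu> (G j)" and s: "summable (\<lambda>j. \<integral>x. cmod (G j x) \<partial>\<mu>)"
  obtains H where "integrable \<mu> H" "\<And>A. (\<lambda>j. fourier (G j) (walsh A)) sums fourier H (walsh A)"
proof -
  have [measurable]: "G j \<in> borel_measurable \<mu>" for j using G by auto
  have "(\<integral>\<^sup>+x. (\<Sum>j. ennreal (cmod (G j x))) \<partial>\<mu>) = (\<Sum>j. \<integral>\<^sup>+x. ennreal (cmod (G j x)) \<partial>\<mu>)"
    by (rule nn_integral_suminf) auto
  also have "\<dots> = (\<Sum>j. ennreal (\<integral>x. cmod (G j x) \<partial>\<mu>))"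
    by (subst nn_integral_eq_integral) (use G in auto)
  also have "\<dots> = ennreal (\<Sum>j. \<integral>x. cmod (G j x) \<partial>\<mu>)"
    by (rule suminf_ennreal2[OF _ s]) simp
  finally have "(\<integral>\<^sup>+x. (\<Sum>j. ennreal (cmod (G j x))) \<partial>\<mu>) \<noteq> \<infinity>" by simp
  then have "AE x in \<mu>. (\<Sum>j. ennreal (cmod (G j x))) \<noteq> \<infinity>"
    by (intro nn_integral_PInf_AE) auto
  then have ae: "AE x in \<mu>. summable (\<lambda>j. cmod (G j x))"
    by eventually_elim (rule summable_suminf_not_top, auto)
  define H where "H x = (\<Sum>j. G j x)" for x
  show ?thesis
  proof
    show "integrable \<mu> H"
      unfolding H_def by (rule integrable_suminf[OF G ae s])
    fix A
    have ae': "AE x in \<mu>. summable (\<lambda>j. cmod (G j x * walsh A x))"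
      using ae by (simp add: norm_mult)
    have s': "summable (\<lambda>j. \<integral>x. cmod (G j x * walsh A x) \<partial>\<mu>)"
      using s by (simp add: norm_mult)
    have "(\<lambda>j. \<integral>x. G j x * walsh A x \<partial>\<mu>) sums (\<integral>x. (\<Sum>j. G j x * walsh A x) \<partial>\<mu>)"
      by (rule sums_integral[OF integrable_mult_walsh[OF G] ae' s'])
    moreover have "AE x in \<mu>. (\<Sum>j. G j x * walsh A x) = H x * walsh A x"
      using ae by eventually_elim (simp add: H_def suminf_mult2 summable_norm_cancel)
    then have "(\<integral>x. (\<Sum>j. G j x * walsh A x) \<partial>\<mu>) = (\<integral>x. H x * walsh A x \<partial>\<mu>)"
      by (rule integral_cong_AE[rotated 2]) (auto simp: H_def)
    ultimately show "(\<lambda>j. fourier (G j) (walsh A)) sums fourier H (walsh A)"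
      by (simp add: fourier_walsh)
  qed
qed

text \<open>Averaging the transform over \<open>S\<close> and truncating \<open>G\<close> reduces this to \<open>\<integral>|\<Sum>\<^sub>S \<gamma>|\<^sup>2 = |S|\<close>, so no
  Riemann--Lebesgue lemma is needed.\<close>

lemma fourier_const_eq_0:
  assumes G: "integrable \<mu> G" and S: "\<And>n :: nat. \<exists>S. finite S \<and> S \<subseteq> walsh ` {A. finite A} \<and> n \<le> card S \<and>
     (\<forall>\<gamma>\<in>S. fourier G \<gamma> = c)"
  shows "c = 0"
proof (rule ccontr)
  assume "c \<noteq> 0"
  have [measurable]: "G \<in> borel_measurable \<mu>" using G by auto
  define T where "T n x = (if real n < cmod (G x) then cmod (G x) else 0)" for n x
  have Tm [measurable]: "T n \<in> borel_measurable \<mu>" for n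
    unfolding T_def by measurable
  have "(\<lambda>n. \<integral>x. T n x \<partial>\<mu>) \<longlonglongrightarrow> (\<integral>x. 0 \<partial>\<mu>)"
  proof (rule integral_dominated_convergence[where w = "\<lambda>x. cmod (G x)"])
    show "AE x in \<mu>. (\<lambda>n. T n x) \<longlonglongrightarrow> 0"
    proof (rule AE_I2)
      fix x
      have "eventually (\<lambda>n. T n x = 0) sequentially"
        using eventually_ge_at_top[of "nat \<lceil>cmod (G x)\<rceil>"]
        by eventually_elim (auto simp: T_def; linarith)
      then show "(\<lambda>n. T n x) \<longlonglongrightarrow> 0"
        by (rule tendsto_eventually)
    qed
  qed (use G in \<open>auto simp: T_def\<close>)
  then have "eventually (\<lambda>n. (\<integral>x. T n x \<partial>\<mu>) < cmod c / 4) sequentially"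
    using \<open>c \<noteq> 0\<close> by (intro order_tendstoD(2)[where y = 0]) auto
  then obtain R where R: "(\<integral>x. T R x \<partial>\<mu>) < cmod c / 4"
    unfolding eventually_sequentially by blast
  \<comment> \<open>With M the square root of \<open>card S\<close>, the estimate below will read M
    |c| \<le> R + M |c| / 4; \<open>n\<close> is chosen so that M |c| > 4 (R + 1) contradicts
    it.\<close>
  obtain n :: nat where n: "real n > (4 * (real R + 1) / cmod c)\<^sup>2" using reals_Archimedean2 by blast
  obtain S where S: "finite S" "S \<subseteq> walsh ` {A. finite A}" "n \<le> card S" "\<And>\<gamma>. \<gamma> \<in> S \<Longrightarrow> fourier G \<gamma> = c"
    using S[of n] by blast
  define M where "M = sqrt (real (card S))"
  have M2: "M * M = card S" by (simp add: M_def)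
  have "(4 * (real R + 1) / cmod c)\<^sup>2 < real (card S)" using n S(3) by linarith
  then have "4 * (real R + 1) / cmod c < M"
    unfolding M_def by (rule real_less_rsqrt)
  then have M: "4 * (real R + 1) < M * cmod c"
    using \<open>c \<noteq> 0\<close> by (simp add: field_simps)
  have "0 < 4 * (real R + 1)" by (simp add: add_nonneg_pos)
  then have "0 < M * cmod c" using M by (rule less_trans)
  then have M0: "0 < M" by (simp add: zero_less_mult_iff M_def)
  have Si: "integrable \<mu> \<gamma>" if "\<gamma> \<in> S" for \<gamma> using that S(2) by auto
  define P where "P x = (\<Sum>\<gamma>\<in>S. \<gamma> x)" for x
  have Pi: "integrable \<mu> P" unfolding P_def by (intro Bochner_Integration.integrable_sum Si)
  then have [measurable]: "P \<in> borel_measurable \<mu>" by auto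
  have Pb: "cmod (P x) \<le> card S" for x
    unfolding P_def using S(2) by (intro order_trans[OF norm_sum] order_trans[OF sum_bounded_above[where K = 1]]) auto
  have P2i: "integrable \<mu> (\<lambda>x. P x * P x)"
    by (rule \<mu>.integrable_const_bound[where B = "real (card S) * real (card S)"])
      (auto simp: norm_mult intro!: mult_mono Pb)
  have Pr: "of_real (cmod (P x) ^ 2) = P x * P x" for x
  proof -
    have "cnj (P x) = P x" unfolding P_def cnj_sum by (rule sum.cong) (use S(2) in auto)
    then show ?thesis by (metis complex_norm_square)
  qed
  have "(\<integral>x. P x * P x \<partial>\<mu>) = (\<Sum>\<gamma>\<in>S. \<Sum>\<delta>\<in>S. (\<integral>x. \<gamma> x * \<delta> x \<partial>\<mu>))"
  proof -
    have ii: "integrable \<mu> (\<lambda>x. \<gamma> x * \<delta> x)" if *: "\<gamma> \<in> S" "\<delta> \<in> S" for \<gamma> \<delta>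
    proof -
      obtain A where "\<gamma> = walsh A" using *(1) S(2) by blast
      moreover obtain B where "\<delta> = walsh B" using *(2) S(2) by blast
      ultimately show ?thesis using integrable_mult_walsh[OF integrable_walsh] by blast
    qed
    have "(\<integral>x. P x * P x \<partial>\<mu>) = (\<integral>x. (\<Sum>\<gamma>\<in>S. \<Sum>\<delta>\<in>S. \<gamma> x * \<delta> x) \<partial>\<mu>)"
      by (simp add: P_def sum_product)
    also have "\<dots> = (\<Sum>\<gamma>\<in>S. \<integral>x. (\<Sum>\<delta>\<in>S. \<gamma> x * \<delta> x) \<partial>\<mu>)"
      by (rule Bochner_Integration.integral_sum) (intro Bochner_Integration.integrable_sum ii)
    also have "\<dots> = (\<Sum>\<gamma>\<in>S. \<Sum>\<delta>\<in>S. (\<integral>x. \<gamma> x * \<delta> x \<partial>\<mu>))"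
      by (intro sum.cong refl Bochner_Integration.integral_sum ii)
    finally show ?thesis .
  qed
  also have "\<dots> = (\<Sum>\<gamma>\<in>S. \<Sum>\<delta>\<in>S. if \<gamma> = \<delta> then 1 else 0)"
  proof (intro sum.cong refl)
    fix \<gamma> \<delta> assume *: "\<gamma> \<in> S" "\<delta> \<in> S"
    obtain A where "finite A" "\<gamma> = walsh A" using *(1) S(2) by blast
    moreover obtain B where "finite B" "\<delta> = walsh B" using *(2) S(2) by blast
    ultimately show "(\<integral>x. \<gamma> x * \<delta> x \<partial>\<mu>) = (if \<gamma> = \<delta> then 1 else 0)"
      using walsh_orthogonal[of A B] walsh_inj[of A B] by auto
  qed
  also have "\<dots> = of_nat (card S)" using S(1) by (simp add: sum.delta)
  finally have P2: "(\<integral>x. cmod (P x) ^ 2 \<partial>\<mu>) = card S"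
    unfolding Pr[symmetric] by (metis integral_complex_of_real of_real_eq_iff of_real_of_nat_eq)
  have P2i': "integrable \<mu> (\<lambda>x. (cmod (P x))\<^sup>2)"
    by (rule \<mu>.integrable_const_bound[where B = "(real (card S))\<^sup>2"]) (auto intro!: power_mono Pb)
  have P1: "(\<integral>x. cmod (P x) \<partial>\<mu>) \<le> M"
  proof -
    \<comment> \<open>AM-GM with weight \<open>M\<close> plays the role of Cauchy-Schwarz; since the
      integral of |P|^2 is M^2, nothing is lost.\<close>
    have "(\<integral>x. cmod (P x) \<partial>\<mu>) \<le> (\<integral>x. (cmod (P x) ^ 2 / M + M) / 2 \<partial>\<mu>)"
    proof (rule integral_mono)
      show "integrable \<mu> (\<lambda>x. cmod (P x))" using Pi by auto
      show "integrable \<mu> (\<lambda>x. (cmod (P x) ^ 2 / M + M) / 2)" using P2i' by auto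
      fix x
      have "0 \<le> (cmod (P x) - M)\<^sup>2" by simp
      then show "cmod (P x) \<le> (cmod (P x) ^ 2 / M + M) / 2"
        using M0 by (simp add: field_simps power2_eq_square)
    qed
    also have "\<dots> = (card S / M + M) / 2"
      using P2i' P2 \<mu>.prob_space by simp
    also have "\<dots> = M" using M0 M2 by (simp add: field_simps)
    finally show ?thesis .
  qed
  have "card S * c = (\<Sum>\<gamma>\<in>S. fourier G \<gamma>)" using S(4) by simp
  also have "\<dots> = (\<Sum>\<gamma>\<in>S. \<integral>x. G x * \<gamma> x \<partial>\<mu>)"
    by (rule sum.cong) (use S(2) in \<open>auto simp: fourier_walsh\<close>)
  also have "\<dots> = (\<integral>x. (\<Sum>\<gamma>\<in>S. G x * \<gamma> x) \<partial>\<mu>)"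
    using S(2) by (intro Bochner_Integration.integral_sum[symmetric]) (auto intro!: integrable_mult_walsh G)
  finally have "card S * cmod c = cmod (\<integral>x. (\<Sum>\<gamma>\<in>S. G x * \<gamma> x) \<partial>\<mu>)"
    by (metis norm_mult norm_of_nat)
  also have "\<dots> \<le> (\<integral>x. cmod (\<Sum>\<gamma>\<in>S. G x * \<gamma> x) \<partial>\<mu>)"
    by (rule Bochner_Integration.integral_norm_bound)
  also have "\<dots> \<le> (\<integral>x. R * cmod (P x) + card S * T R x \<partial>\<mu>)"
  proof (rule integral_mono)
    show "integrable \<mu> (\<lambda>x. cmod (\<Sum>\<gamma>\<in>S. G x * \<gamma> x))"
      using S(2) by (intro integrable_norm Bochner_Integration.integrable_sum) (auto intro!: integrable_mult_walsh G)
    have "integrable \<mu> (T R)"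
      by (rule Bochner_Integration.integrable_bound[OF G]) (auto simp: T_def)
    then show "integrable \<mu> (\<lambda>x. R * cmod (P x) + card S * T R x)" using Pi by auto
    fix x
    have "cmod (\<Sum>\<gamma>\<in>S. G x * \<gamma> x) = cmod (G x) * cmod (P x)"
      by (simp add: P_def norm_mult flip: sum_distrib_left)
    \<comment> \<open>Where |G| \<le> R the factor \<open>P\<close> is kept for the L1 bound
      \<open>P1\<close>; where |G| > R it is replaced by its trivial bound
      \<open>card S\<close>.\<close>
    also have "\<dots> \<le> R * cmod (P x) + card S * T R x"
    proof (cases "real R < cmod (G x)")
      case True
      then have "cmod (G x) * cmod (P x) \<le> cmod (G x) * card S" by (intro mult_left_mono Pb) auto
      then show ?thesis using True by (simp add: T_def mult.commute add_increasing)
    next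
      case False
      then show ?thesis by (simp add: T_def mult_right_mono)
    qed
    finally show "cmod (\<Sum>\<gamma>\<in>S. G x * \<gamma> x) \<le> R * cmod (P x) + card S * T R x" .
  qed
  also have "\<dots> = R * (\<integral>x. cmod (P x) \<partial>\<mu>) + card S * (\<integral>x. T R x \<partial>\<mu>)"
  proof -
    have "integrable \<mu> (T R)"
      by (rule Bochner_Integration.integrable_bound[OF G]) (auto simp: T_def)
    then show ?thesis using Pi by simp
  qed
  also have "\<dots> \<le> R * M + card S * (cmod c / 4)"
    using R P1 by (intro add_mono mult_left_mono) auto
  finally have "M * (M * cmod c) \<le> M * (R + M * (cmod c / 4))"
    unfolding M2[symmetric] by (simp add: algebra_simps)
  then have "M * cmod c \<le> R + M * (cmod c / 4)" using M0 by simp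
  moreover define y where "y = M * cmod c"
  ultimately have "y \<le> R + y / 4" by simp
  moreover have "4 * (real R + 1) < y" using M by (simp add: y_def)
  ultimately show False by (simp add: field_simps)
qed

section \<open>Random subsets\<close>

lemma exp_le_quadratic:
  fixes x :: real
  assumes "\<bar>x\<bar> \<le> 1"
  shows "exp x \<le> 1 + x + x\<^sup>2"
proof (cases "0 \<le> x")
  case True
  then show ?thesis using assms exp_bound[of x] by simp
next
  case False
  define y where "y = - x"
  have y: "0 \<le> y" "y \<le> 1" using False assms by (auto simp: y_def)
  have e: "1 + y + y\<^sup>2 / 2 \<le> exp y"
    by (rule exp_lower_Taylor_quadratic[OF y(1)])
  have pos: "0 \<le> 1 - y + y\<^sup>2"
    using y by (simp add: add_nonneg_nonneg)
  \<comment> \<open>The lower Taylor bound for exp y, multiplied by the bound claimed for exp (-y),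
    gives a polynomial with constant term 1 and no negative coefficient.\<close>
  have "1 \<le> 1 + y\<^sup>2 / 2 + y ^ 3 / 2 + y ^ 4 / 2" using y by simp
  also have "\<dots> = (1 + y + y\<^sup>2 / 2) * (1 - y + y\<^sup>2)"
    by (simp add: power2_eq_square power3_eq_cube power4_eq_xxxx field_simps)
  also have "\<dots> \<le> exp y * (1 - y + y\<^sup>2)"
    by (rule mult_right_mono[OF e pos])
  finally have "exp (- y) \<le> 1 - y + y\<^sup>2"
    by (simp add: exp_minus field_simps)
  then show ?thesis by (simp add: y_def)
qed

text \<open>Chernoff's bound in counting form, with exponent parameter \<open>\<epsilon>\<close>
  itself. The exponential moment costs \<open>exp (2 * \<epsilon>^2)\<close> per coordinate, half of
  the exponent from the mean and half from the variance; the threshold \<open>3 * \<epsilon>\<close>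
  gains \<open>exp (3 * \<epsilon>^2)\<close>.\<close>

lemma card_tuples_large_sum:
  fixes u :: "'a \<Rightarrow> real" and \<epsilon> :: real
  assumes V: "finite V" and u: "\<And>v. v \<in> V \<Longrightarrow> \<bar>u v\<bar> \<le> 1" and mean: "sum u V \<le> \<epsilon> * card V"
    and \<epsilon>: "0 \<le> \<epsilon>" "\<epsilon> \<le> 1"
  shows "real (card {l \<in> {..<N} \<rightarrow>\<^sub>E V. 3 * \<epsilon> * N \<le> (\<Sum>i<N. u (l i))}) \<le> real (card V) ^ N * exp (- (\<epsilon>\<^sup>2 * N))"
    (is "real (card ?B) \<le> _")
proof -
  have fin: "finite ({..<N} \<rightarrow>\<^sub>E V)" using V by (simp add: finite_PiE)
  have "real (card ?B) * exp (\<epsilon> * (3 * \<epsilon> * N)) = (\<Sum>l\<in>?B. exp (\<epsilon> * (3 * \<epsilon> * N)))" by simp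
  also have "\<dots> \<le> (\<Sum>l\<in>?B. exp (\<epsilon> * (\<Sum>i<N. u (l i))))"
    using \<epsilon> by (intro sum_mono) (auto intro: mult_left_mono)
  also have "\<dots> \<le> (\<Sum>l\<in>{..<N} \<rightarrow>\<^sub>E V. exp (\<epsilon> * (\<Sum>i<N. u (l i))))"
    by (rule sum_mono2[OF fin]) auto
  also have "\<dots> = (\<Sum>l\<in>{..<N} \<rightarrow>\<^sub>E V. \<Prod>i<N. exp (\<epsilon> * u (l i)))"
    by (simp add: sum_distrib_left exp_sum)
  also have "\<dots> = (\<Prod>i<N. \<Sum>v\<in>V. exp (\<epsilon> * u v))"
    using V by (subst prod_sum_PiE) auto
  also have "\<dots> = (\<Sum>v\<in>V. exp (\<epsilon> * u v)) ^ N" by simp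
  also have "\<dots> \<le> (card V * exp (2 * \<epsilon>\<^sup>2)) ^ N"
  proof (rule power_mono)
    have "(\<Sum>v\<in>V. exp (\<epsilon> * u v)) \<le> (\<Sum>v\<in>V. 1 + \<epsilon> * u v + \<epsilon>\<^sup>2)"
    proof (rule sum_mono)
      fix v assume "v \<in> V"
      then have "\<bar>u v\<bar> \<le> 1" by (rule u)
      then have 1: "(u v)\<^sup>2 \<le> 1" by (simp add: abs_square_le_1)
      have "\<bar>\<epsilon> * u v\<bar> \<le> 1"
        using \<epsilon> \<open>\<bar>u v\<bar> \<le> 1\<close> by (simp add: abs_mult mult_le_one)
      then have "exp (\<epsilon> * u v) \<le> 1 + \<epsilon> * u v + (\<epsilon> * u v)\<^sup>2"
        by (rule exp_le_quadratic)
      also have "\<dots> = 1 + \<epsilon> * u v + \<epsilon>\<^sup>2 * (u v)\<^sup>2"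
        by (simp add: power_mult_distrib)
      also have "\<dots> \<le> 1 + \<epsilon> * u v + \<epsilon>\<^sup>2"
        using mult_left_mono[OF 1, of "\<epsilon>\<^sup>2"] by simp
      finally show "exp (\<epsilon> * u v) \<le> 1 + \<epsilon> * u v + \<epsilon>\<^sup>2" .
    qed
    also have "\<dots> = card V + \<epsilon> * sum u V + card V * \<epsilon>\<^sup>2"
      by (simp add: sum.distrib sum_distrib_left)
    also have "\<dots> \<le> card V + \<epsilon> * (\<epsilon> * card V) + card V * \<epsilon>\<^sup>2"
      using mult_left_mono[OF mean \<epsilon>(1)] by simp
    also have "\<dots> = card V * (1 + 2 * \<epsilon>\<^sup>2)" by (simp add: power2_eq_square algebra_simps)
    also have "\<dots> \<le> card V * exp (2 * \<epsilon>\<^sup>2)"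
      by (intro mult_left_mono exp_ge_add_one_self) auto
    finally show "(\<Sum>v\<in>V. exp (\<epsilon> * u v)) \<le> card V * exp (2 * \<epsilon>\<^sup>2)" .
  qed (simp add: sum_nonneg)
  also have "\<dots> = card V ^ N * exp (2 * \<epsilon>\<^sup>2 * N)"
    by (simp add: power_mult_distrib exp_of_nat_mult[symmetric] mult.commute)
  finally have "real (card ?B) * exp (\<epsilon> * (3 * \<epsilon> * N)) \<le> card V ^ N * exp (2 * \<epsilon>\<^sup>2 * N)" .
  then have "real (card ?B) \<le> card V ^ N * exp (2 * \<epsilon>\<^sup>2 * N) / exp (\<epsilon> * (3 * \<epsilon> * N))"
    by (simp add: field_simps)
  also have "\<dots> = card V ^ N * exp (2 * \<epsilon>\<^sup>2 * N - \<epsilon> * (3 * \<epsilon> * N))" by (simp add: exp_diff)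
  also have "2 * \<epsilon>\<^sup>2 * N - \<epsilon> * (3 * \<epsilon> * N) = - (\<epsilon>\<^sup>2 * N)" by (simp add: power2_eq_square)
  finally show ?thesis by simp
qed

text \<open>As \<open>J\<close> misses \<open>I\<close>, the values outside \<open>J\<close> already
  fix the span of the points indexed by \<open>I\<close>, and each position in \<open>J\<close> is
  left with at most \<open>2 ^ card I\<close> values.\<close>

lemma card_tuples_in_span:
  fixes sp :: "'a set \<Rightarrow> 'a set"
  assumes V: "finite V" and IJ: "I \<subseteq> {..<N}" "J \<subseteq> {..<N}" "I \<inter> J = {}"
    and sp: "\<And>B. finite B \<Longrightarrow> finite (sp B) \<and> card (sp B) \<le> 2 ^ card B"
  shows "card {l \<in> {..<N} \<rightarrow>\<^sub>E V. \<forall>j\<in>J. l j \<in> sp (l ` I)} \<le> card V ^ (N - card J) * (2 ^ card I) ^ card J"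
    (is "card ?A \<le> _")
proof -
  let ?S = "SIGMA u:({..<N} - J) \<rightarrow>\<^sub>E V. J \<rightarrow>\<^sub>E sp (u ` I)"
  let ?f = "\<lambda>l :: nat \<Rightarrow> 'a. (restrict l ({..<N} - J), restrict l J)"
  have finI: "finite I" and finJ: "finite J" using IJ finite_subset by blast+
  have finS: "finite ?S"
    using V sp finI finJ by (intro finite_SigmaI finite_PiE) auto
  have "inj_on ?f ?A"
  proof (rule inj_onI)
    fix l l' assume l: "l \<in> ?A" "l' \<in> ?A" and e: "?f l = ?f l'"
    show "l = l'"
    proof (rule PiE_ext)
      show "l \<in> {..<N} \<rightarrow>\<^sub>E V" "l' \<in> {..<N} \<rightarrow>\<^sub>E V" using l by auto
      fix i assume "i \<in> {..<N}"
      then show "l i = l' i" using e by (cases "i \<in> J") (auto simp: restrict_def fun_eq_iff split: if_splits)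
    qed
  qed
  moreover have "?f ` ?A \<subseteq> ?S"
  proof (rule image_subsetI)
    fix l assume l: "l \<in> ?A"
    have "restrict l ({..<N} - J) ` I = l ` I" using IJ by (intro image_cong) auto
    then show "?f l \<in> ?S" using l IJ by (auto simp: PiE_iff)
  qed
  ultimately have "card ?A \<le> card ?S"
    using finS by (rule card_inj_on_le)
  also have "\<dots> = (\<Sum>u\<in>({..<N} - J) \<rightarrow>\<^sub>E V. card (J \<rightarrow>\<^sub>E sp (u ` I)))"
    using V sp finI finJ by (intro card_SigmaI finite_PiE ballI) auto
  also have "\<dots> \<le> (\<Sum>u\<in>({..<N} - J) \<rightarrow>\<^sub>E V. (2 ^ card I) ^ card J)"
  proof (rule sum_mono)
    fix u :: "nat \<Rightarrow> 'a"
    have "card (sp (u ` I)) \<le> 2 ^ card (u ` I)" using sp finI by blast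
    also have "\<dots> \<le> 2 ^ card I" using card_image_le[OF finI] by (intro power_increasing) auto
    finally show "card (J \<rightarrow>\<^sub>E sp (u ` I)) \<le> (2 ^ card I) ^ card J"
      by (simp add: card_PiE finJ power_mono)
  qed
  also have "\<dots> = card V ^ (N - card J) * (2 ^ card I) ^ card J"
    using IJ finJ by (simp add: card_PiE card_Diff_subset)
  finally show ?thesis .
qed

text \<open>First moment method by counting \<open>N\<close>-tuples in \<open>V\<close>: those that
  violate a functional bound make up at most half of all, those with too many points in a small span
  less than half. Tuples with possible repetitions are used because their coordinates are
  independent.\<close>

lemma random_subset:
  fixes V :: "'a set" and sp :: "'a set \<Rightarrow> 'a set" and U :: "('a \<Rightarrow> real) set" and \<epsilon> :: real
  assumes V: "finite V" "card V = 2 ^ (2 * p)"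
    and sp: "\<And>B. finite B \<Longrightarrow> finite (sp B) \<and> card (sp B) \<le> 2 ^ card B" "\<And>B. finite B \<Longrightarrow> B \<subseteq> sp B"
    and U: "finite U" "card U \<le> 4 * card V" "\<And>u v. u \<in> U \<Longrightarrow> v \<in> V \<Longrightarrow> \<bar>u v\<bar> \<le> 1"
      "\<And>u. u \<in> U \<Longrightarrow> sum u V \<le> \<epsilon> * card V"
    and \<epsilon>: "0 \<le> \<epsilon>" "\<epsilon> \<le> 1" and large: "8 * real (card V) \<le> exp (\<epsilon>\<^sup>2 * N)"
    and N: "p \<le> N" "2 * (p + 1) * N ^ (q + 1) < 2 ^ p" and pq: "1 \<le> p" "1 \<le> q"
  obtains S where "S \<subseteq> V" "card S = N" "\<And>u. u \<in> U \<Longrightarrow> sum u S < 3 * \<epsilon> * N"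
    "\<And>B. B \<subseteq> S \<Longrightarrow> card B \<le> p \<Longrightarrow> card (S \<inter> sp B) < card B + (if card B \<le> q then 1 else card B)"
proof -
  let ?P = "{..<N} \<rightarrow>\<^sub>E V"
  \<comment> \<open>\<open>d k\<close> is the excess to be excluded in the span of \<open>k\<close>
    points. The union bound pays a factor \<open>N\<close> for each of the \<open>k + d k\<close>
    indices and gains at least \<open>2 ^ p\<close> for each excess point; in both cases
    \<open>k + d k \<le> (q + 1) * d k\<close>, so the one inequality
    \<open>2 * (p + 1) * N ^ (q + 1) < 2 ^ p\<close> serves all \<open>k \<le> p\<close>.\<close>
  define d where "d k = (if k \<le> q then 1 else k)" for k
  have finP: "finite ?P" using V(1) by (simp add: finite_PiE)
  have cardP: "card ?P = card V ^ N" by (simp add: card_PiE)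
  have Vpos: "0 < real (card V) ^ N" using V(2) by simp
  define BU where "BU u = {l \<in> ?P. 3 * \<epsilon> * N \<le> (\<Sum>i<N. u (l i))}" for u :: "'a \<Rightarrow> real"
  define Q where "Q k = {I. I \<subseteq> {..<N} \<and> card I = k}" for k
  define BS where "BS I J = (if I \<inter> J = {} then {l \<in> ?P. \<forall>j\<in>J. l j \<in> sp (l ` I)} else {})" for I J
  define BK where "BK k = (\<Union>(I, J)\<in>Q k \<times> Q (d k). BS I J)" for k
  have finQ: "finite (Q k)" for k unfolding Q_def by simp
  have cardQ: "card (Q k) \<le> N ^ k" if "k \<le> N" for k
    unfolding Q_def using n_subsets[of "{..<N}" k] binomial_le_pow[OF that] by simp
  have finBU: "finite (BU u)" for u unfolding BU_def using finP by simp
  have finBK: "finite (BK k)" for k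
    unfolding BK_def BS_def using finP finQ by (intro finite_UN_I) auto
  have sumU: "real (card (\<Union>u\<in>U. BU u)) \<le> real (card V) ^ N / 2"
  proof -
    have "real (card (\<Union>u\<in>U. BU u)) \<le> (\<Sum>u\<in>U. real (card (BU u)))"
      using card_UN_le[OF U(1), of BU] by (simp flip: of_nat_sum)
    also have "\<dots> \<le> (\<Sum>u\<in>U. real (card V) ^ N * exp (- (\<epsilon>\<^sup>2 * N)))"
      unfolding BU_def by (intro sum_mono card_tuples_large_sum V U(3,4) \<epsilon>)
    also have "\<dots> = card U * (real (card V) ^ N * exp (- (\<epsilon>\<^sup>2 * N)))" by simp
    also have "\<dots> \<le> (4 * card V) * (real (card V) ^ N * exp (- (\<epsilon>\<^sup>2 * N)))"
      by (rule mult_right_mono) (use U(2) in \<open>simp flip: of_nat_le_iff\<close>, simp)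
    also have "\<dots> \<le> (exp (\<epsilon>\<^sup>2 * N) / 2) * (real (card V) ^ N * exp (- (\<epsilon>\<^sup>2 * N)))"
      by (rule mult_right_mono) (use large in auto)
    also have "\<dots> = real (card V) ^ N / 2" by (simp add: exp_minus)
    finally show ?thesis .
  qed
  have cardBK: "2 * (p + 1) * card (BK k) < card V ^ N" if "k \<le> p" for k
  proof -
    have d: "1 \<le> d k" "d k \<le> p" "k + d k \<le> (q + 1) * d k"
      using that pq by (auto simp: d_def)
    have "card (BK k) \<le> (\<Sum>(I, J)\<in>Q k \<times> Q (d k). card (BS I J))"
      unfolding BK_def using card_UN_le[of "Q k \<times> Q (d k)" "\<lambda>(I, J). BS I J"] finQ
      by (simp add: case_prod_unfold)
    also have "\<dots> \<le> (\<Sum>(I, J)\<in>Q k \<times> Q (d k). card V ^ (N - d k) * 2 ^ (k * d k))"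
    proof (rule sum_mono, clarsimp)
      fix I J assume IJ: "I \<in> Q k" "J \<in> Q (d k)"
      show "card (BS I J) \<le> card V ^ (N - d k) * 2 ^ (k * d k)"
      proof (cases "I \<inter> J = {}")
        case True
        then have "BS I J = {l \<in> ?P. \<forall>j\<in>J. l j \<in> sp (l ` I)}" by (simp add: BS_def)
        then have "card (BS I J) \<le> card V ^ (N - card J) * (2 ^ card I) ^ card J"
          using card_tuples_in_span[OF V(1) _ _ True sp(1)] IJ by (simp add: Q_def)
        then show ?thesis using IJ by (simp add: Q_def power_mult)
      qed (simp add: BS_def)
    qed
    also have "\<dots> = card (Q k) * card (Q (d k)) * (card V ^ (N - d k) * 2 ^ (k * d k))"
      by (simp add: card_cartesian_product)
    also have "\<dots> \<le> N ^ k * N ^ d k * (card V ^ (N - d k) * 2 ^ (p * d k))"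
      using that d N V(2) by (intro mult_mono cardQ power_increasing) auto
    finally have 1: "card (BK k) \<le> N ^ (k + d k) * (card V ^ (N - d k) * 2 ^ (p * d k))"
      by (simp add: power_add)
    \<comment> \<open>Together with the factor on the right, \<open>2 ^ (p * d k)\<close> completes
      \<open>card V ^ (N - d k)\<close> to \<open>card V ^ N\<close>, since
      \<open>card V = 2 ^ (2 * p)\<close>.\<close>
    have "2 ^ (p * d k) * card (BK k) \<le> 2 ^ (p * d k) * (N ^ (k + d k) * (card V ^ (N - d k) * 2 ^ (p * d k)))"
      using 1 by (rule mult_left_mono) simp
    also have "\<dots> = N ^ (k + d k) * (card V ^ (N - d k) * (2 ^ (2 * p)) ^ d k)"
      by (simp add: power_add[symmetric] power_mult[symmetric] algebra_simps)
    also have "\<dots> = N ^ (k + d k) * card V ^ N"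
      unfolding V(2)[symmetric] power_add[symmetric] using d N by simp
    also have "\<dots> \<le> (N ^ (q + 1)) ^ d k * card V ^ N"
      unfolding power_mult[symmetric] using d N pq by (intro mult_right_mono power_increasing) auto
    finally have 2: "2 ^ (p * d k) * card (BK k) \<le> (N ^ (q + 1)) ^ d k * card V ^ N" .
    have "2 * (p + 1) * (N ^ (q + 1)) ^ d k < 2 ^ (p * d k)"
    proof -
      have "2 * (p + 1) * (N ^ (q + 1)) ^ d k \<le> (2 * (p + 1)) ^ d k * (N ^ (q + 1)) ^ d k"
        using d by (intro mult_right_mono self_le_power) auto
      also have "\<dots> = (2 * (p + 1) * N ^ (q + 1)) ^ d k" by (rule power_mult_distrib[symmetric])
      also have "\<dots> < (2 ^ p) ^ d k" using N(2) d by (intro power_strict_mono) auto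
      finally show ?thesis by (simp add: power_mult)
    qed
    then have "2 * (p + 1) * (N ^ (q + 1)) ^ d k * card V ^ N < 2 ^ (p * d k) * card V ^ N"
      using V(2) by (intro mult_strict_right_mono) auto
    moreover have "2 * (p + 1) * (2 ^ (p * d k) * card (BK k)) \<le> 2 * (p + 1) * ((N ^ (q + 1)) ^ d k * card V ^ N)"
      using 2 by (rule mult_left_mono) simp
    ultimately have "2 * (p + 1) * (2 ^ (p * d k) * card (BK k)) < 2 ^ (p * d k) * card V ^ N"
      unfolding mult.assoc by (rule le_less_trans[rotated])
    then have "2 ^ (p * d k) * (2 * (p + 1) * card (BK k)) < 2 ^ (p * d k) * card V ^ N"
      by (simp only: mult.left_commute)
    then show ?thesis by (rule mult_less_cancel1[THEN iffD1, THEN conjunct2])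
  qed
  have sumK: "real (card (\<Union>k\<le>p. BK k)) < real (card V) ^ N / 2"
  proof -
    have "real (card (\<Union>k\<le>p. BK k)) \<le> (\<Sum>k\<le>p. real (card (BK k)))"
      using card_UN_le[of "{..p}" BK] by (simp flip: of_nat_sum)
    also have "\<dots> < (\<Sum>k\<le>p. real (card V) ^ N / (2 * (p + 1)))"
    proof (rule sum_strict_mono)
      fix k assume "k \<in> {..p}"
      then have "real (2 * (p + 1) * card (BK k)) < real (card V ^ N)"
        using cardBK by (subst of_nat_less_iff) auto
      then show "real (card (BK k)) < real (card V) ^ N / (2 * (p + 1))"
        by (simp add: field_simps)
    qed auto
    also have "\<dots> = real (card V) ^ N / 2" by (simp add: field_simps)
    finally show ?thesis .
  qed
  have "card ((\<Union>u\<in>U. BU u) \<union> (\<Union>k\<le>p. BK k)) < card ?P"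
  proof -
    have "real (card ((\<Union>u\<in>U. BU u) \<union> (\<Union>k\<le>p. BK k))) \<le> real (card (\<Union>u\<in>U. BU u)) + real (card (\<Union>k\<le>p. BK k))"
      using card_Un_le[of "\<Union>u\<in>U. BU u" "\<Union>k\<le>p. BK k"] by linarith
    also have "\<dots> < real (card V) ^ N" using sumU sumK by linarith
    also have "\<dots> = real (card ?P)" unfolding cardP by simp
    finally show ?thesis by simp
  qed
  note less = this
  have fin: "finite ((\<Union>u\<in>U. BU u) \<union> (\<Union>k\<le>p. BK k))"
    by (intro finite_UnI finite_UN_I U(1) finBU finBK finite_atMost)
  have "\<not> ?P \<subseteq> (\<Union>u\<in>U. BU u) \<union> (\<Union>k\<le>p. BK k)"
    using card_mono[OF fin, of ?P] less by linarith
  then obtain l where l: "l \<in> ?P" "l \<notin> (\<Union>u\<in>U. BU u)" "l \<notin> (\<Union>k\<le>p. BK k)"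
    by blast
  have good: "\<exists>j\<in>J. l j \<notin> sp (l ` I)"
    if IJ: "I \<subseteq> {..<N}" "J \<subseteq> {..<N}" "I \<inter> J = {}" "card I \<le> p" "card J = d (card I)" for I J
  proof (rule ccontr)
    assume "\<not> ?thesis"
    then have "l \<in> BS I J" using l(1) IJ(3) by (simp add: BS_def)
    moreover have "(I, J) \<in> Q (card I) \<times> Q (d (card I))" using IJ by (simp add: Q_def)
    ultimately have "l \<in> BK (card I)" unfolding BK_def by blast
    then show False using l(3) IJ(4) by blast
  qed
  \<comment> \<open>A repeated value would be an excess point in the span of a single point, which
    is excluded because \<open>d 1 = 1\<close> when \<open>1 \<le> q\<close>.\<close>
  have inj: "inj_on l {..<N}"
  proof (rule inj_onI, rule ccontr)
    fix i j assume ij: "i \<in> {..<N}" "j \<in> {..<N}" "l i = l j" "i \<noteq> j"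
    then have "l j \<notin> sp {l i}" using good[of "{i}" "{j}"] pq by (auto simp: d_def)
    then show False using sp(2)[of "{l i}"] ij by auto
  qed
  show ?thesis
  proof
    show "l ` {..<N} \<subseteq> V" using l(1) by auto
    show "card (l ` {..<N}) = N" using card_image[OF inj] by simp
    show "sum u (l ` {..<N}) < 3 * \<epsilon> * N" if "u \<in> U" for u
      using l(1,2) that by (auto simp: BU_def sum.reindex[OF inj])
    fix B assume B: "B \<subseteq> l ` {..<N}" "card B \<le> p"
    have finB: "finite B" using B finite_subset by blast
    have "card (l ` {..<N} \<inter> sp B) < card B + d (card B)"
    proof (rule ccontr)
      assume "\<not> ?thesis"
      moreover have "card (l ` {..<N} \<inter> sp B - B) = card (l ` {..<N} \<inter> sp B) - card B"
        using B sp(2)[OF finB] by (intro card_Diff_subset finB) auto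
      ultimately have "d (card B) \<le> card (l ` {..<N} \<inter> sp B - B)" by linarith
      then obtain J' where J': "J' \<subseteq> l ` {..<N} \<inter> sp B - B" "card J' = d (card B)"
        by (rule obtain_subset_with_card_n)
      have pre: "\<exists>I \<subseteq> {..<N}. l ` I = X \<and> card I = card X" if "X \<subseteq> l ` {..<N}" for X
      proof -
        obtain I where "I \<subseteq> {..<N}" "X = l ` I" using \<open>X \<subseteq> l ` {..<N}\<close> by (auto simp: subset_image_iff)
        then show ?thesis using card_image inj_on_subset[OF inj] by metis
      qed
      obtain I where I: "I \<subseteq> {..<N}" "l ` I = B" "card I = card B" using pre[OF B(1)] by blast
      obtain J where J: "J \<subseteq> {..<N}" "l ` J = J'" "card J = card J'" using pre[of J'] J'(1) by blast
      have "I \<inter> J = {}" using I(2) J(2) J'(1) by blast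
      then show False using good[of I J] I J J' B by auto
    qed
    then show "card (l ` {..<N} \<inter> sp B) < card B + (if card B \<le> q then 1 else card B)"
      by (simp add: d_def)
  qed
qed

section \<open>Functions with exponentially small cosine coefficients\<close>

lemma real_analytic_at_scale:
  assumes "real_analytic_at (\<lambda>x. F (\<sigma> * x)) (x / \<sigma>)" "0 < \<sigma>"
  shows "real_analytic_at F x"
proof -
  obtain a r where r: "r > 0" and a: "\<And>t. \<bar>t - x / \<sigma>\<bar> < r \<Longrightarrow>
      (\<lambda>n. a n * complex_of_real (t - x / \<sigma>) ^ n) sums F (\<sigma> * t)"
    using assms(1) unfolding real_analytic_at_def by blast
  have "(\<lambda>n. a n / of_real \<sigma> ^ n * complex_of_real (t - x) ^ n) sums F t" if "\<bar>t - x\<bar> < r * \<sigma>" for t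
  proof -
    have e: "t / \<sigma> - x / \<sigma> = (t - x) / \<sigma>" by (simp add: diff_divide_distrib)
    have "\<bar>t / \<sigma> - x / \<sigma>\<bar> < r"
      unfolding e using that assms(2) by (simp add: abs_divide pos_divide_less_eq)
    from a[OF this] show ?thesis
      unfolding e using assms(2) by (simp add: power_divide)
  qed
  then show ?thesis
    unfolding real_analytic_at_def using r assms(2) by (intro exI[of _ "\<lambda>n. a n / of_real \<sigma> ^ n"] exI[of _ "r * \<sigma>"]) auto
qed

lemma holomorphic_imp_real_analytic_at:
  assumes "H holomorphic_on ball (of_real x) r" "r > 0"
    and "\<And>t. \<bar>t - x\<bar> < r \<Longrightarrow> F t = H (of_real t)"
  shows "real_analytic_at F x"
  unfolding real_analytic_at_def
proof (intro exI conjI allI impI)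
  fix t :: real assume t: "\<bar>t - x\<bar> < r"
  then have "complex_of_real t \<in> ball (of_real x) r"
    by (simp add: dist_norm abs_minus_commute flip: of_real_diff)
  from holomorphic_power_series[OF assms(1) this] assms(3)[OF t]
  show "(\<lambda>n. (deriv ^^ n) H (of_real x) / fact n * complex_of_real (t - x) ^ n) sums F t"
    by simp
qed fact

section \<open>Periodic integrals and orthogonality of cosines\<close>

lemma integral_periodic_shift:
  fixes h :: "real \<Rightarrow> complex"
  assumes c: "continuous_on UNIV h" and per: "\<And>s. h (s + 2 * pi) = h s" and a: "\<bar>a\<bar> \<le> 2 * pi"
  shows "integral {0..2 * pi} (\<lambda>s. h (s + a)) = integral {0..2 * pi} h"
proof -
  have int: "h integrable_on {u..v}" for u v
    by (rule integrable_continuous_interval[OF continuous_on_subset[OF c]]) simp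
  have shift: "integral {u..v} (\<lambda>s. h (s + d)) = integral {u + d..v + d} h" for u v d
    using integral_shift[of u d v h] continuous_on_subset[OF c] by (simp add: o_def)
  have pos: "integral {0..2 * pi} (\<lambda>s. h (s + b)) = integral {0..2 * pi} h" if b: "0 \<le> b" "b \<le> 2 * pi" for b
  proof -
    have "integral {0..2 * pi} (\<lambda>s. h (s + b)) = integral {b..2 * pi + b} h"
      using shift[of 0 "2 * pi" b] by simp
    also have "\<dots> = integral {b..2 * pi} h + integral {2 * pi..2 * pi + b} h"
      using Henstock_Kurzweil_Integration.integral_combine[of b "2 * pi" "2 * pi + b" h] b int by simp
    also have "integral {2 * pi..2 * pi + b} h = integral {0..b} h"
      using shift[of 0 b "2 * pi"] per by (simp add: add.commute)
    also have "integral {b..2 * pi} h + integral {0..b} h = integral {0..2 * pi} h"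
      using Henstock_Kurzweil_Integration.integral_combine[of 0 b "2 * pi" h] b int by (simp add: add.commute)
    finally show ?thesis .
  qed
  show ?thesis
  proof (cases "0 \<le> a")
    case True
    then show ?thesis using pos a by simp
  next
    case False
    have "h (s + a) = h (s + (a + 2 * pi))" for s
      using per[of "s + a"] by (simp add: add.assoc)
    then show ?thesis using pos[of "a + 2 * pi"] a False by simp
  qed
qed

lemma has_integral_cos_int:
  assumes "n \<noteq> 0"
  shows "((\<lambda>s. cos (real n * s)) has_integral 0) {0..2 * pi}"
proof -
  have "((\<lambda>s. cos (real n * s)) has_integral (sin (real n * (2 * pi)) / n - sin (real n * 0) / n)) {0..2 * pi}"
    using assms by (intro fundamental_theorem_of_calculus)
      (auto intro!: derivative_eq_intros simp flip: has_real_derivative_iff_has_vector_derivative)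
  moreover have "sin (real n * (2 * pi)) = 0"
    using sin_npi[of "2 * n"] by (simp add: mult_ac)
  ultimately show ?thesis by simp
qed

lemma cos_times_cos_nat:
  fixes s :: real
  assumes "k \<le> n"
  shows "cos (real n * s) * cos (real k * s) = (cos (real (n - k) * s) + cos (real (n + k) * s)) / 2"
  using assms by (simp add: cos_times_cos of_nat_diff left_diff_distrib distrib_right)

lemma has_integral_cos_cos:
  "((\<lambda>s. cos (real n * s) * cos (real k * s)) has_integral
     (if n = k then if n = 0 then 2 * pi else pi else 0)) {0..2 * pi}"
proof -
  have main: "((\<lambda>s. cos (real n * s) * cos (real k * s)) has_integral
     (if n = k then if n = 0 then 2 * pi else pi else 0)) {0..2 * pi}" if "k \<le> n" for n k
  proof -
    have I: "((\<lambda>s. cos (real m * s)) has_integral (if m = 0 then 2 * pi else 0)) {0..2 * pi}" for m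
      using has_integral_cos_int[of m] has_integral_const_real[of "1 :: real" 0 "2 * pi"] by auto
    have "((\<lambda>s. (cos (real (n - k) * s) + cos (real (n + k) * s)) / 2) has_integral
       ((if n - k = 0 then 2 * pi else 0) + (if n + k = 0 then 2 * pi else 0)) / 2) {0..2 * pi}"
      by (intro has_integral_divide has_integral_add I)
    moreover have "((if n - k = 0 then 2 * pi else 0) + (if n + k = 0 then 2 * pi else 0)) / 2 =
        (if n = k then if n = 0 then 2 * pi else pi else 0)"
      using that by auto
    ultimately show ?thesis
      unfolding cos_times_cos_nat[OF that] by (rule has_integral_eq_rhs[OF _ sym])
  qed
  show ?thesis
  proof (cases "k \<le> n")
    case True
    then show ?thesis by (rule main)
  next
    case False
    then show ?thesis using main[of n k] by (auto simp: mult.commute)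
  qed
qed

text \<open>A function of \<open>cos s\<close> orthogonal to all \<open>cos (k s)\<close> is orthogonal to the polynomials in \<open>cos s\<close>,
  hence, by Weierstrass, to its own conjugate.\<close>

lemma cos_orthogonal_imp_zero:
  fixes r :: "real \<Rightarrow> complex"
  assumes r: "continuous_on {-1..1} r"
    and orth: "\<And>k. integral {0..2 * pi} (\<lambda>s. r (cos s) * of_real (cos (real k * s))) = 0"
    and x: "\<bar>x\<bar> \<le> 1"
  shows "r x = 0"
proof -
  have rc: "continuous_on {0..2 * pi} (\<lambda>s. r (cos s))"
    by (rule continuous_on_compose2[OF r]) (auto intro: continuous_intros)
  have rf: "(\<lambda>s. r (cos s) * of_real (f s)) integrable_on {0..2 * pi}" if "continuous_on {0..2 * pi} f" for f
    by (rule integrable_continuous_interval) (intro continuous_intros rc that)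
  define u where "u m k s = r (cos s) * of_real (cos s ^ m * cos (real k * s))" for m k s
  \<comment> \<open>Generalizing over \<open>k\<close> lets the product formula for
    \<open>cos s * cos (k * s)\<close> strip one power of \<open>cos s\<close> at each step of the
    induction.\<close>
  have mono: "(u m k has_integral 0) {0..2 * pi}" for m k
  proof (induction m arbitrary: k)
    case 0
    have e: "u 0 k = (\<lambda>s. r (cos s) * of_real (cos (real k * s)))"
      by (simp add: u_def fun_eq_iff)
    have "u 0 k integrable_on {0..2 * pi}"
      unfolding e by (intro rf continuous_intros)
    then have "(u 0 k has_integral integral {0..2 * pi} (u 0 k)) {0..2 * pi}"
      by (rule integrable_integral)
    moreover have "integral {0..2 * pi} (u 0 k) = 0"
      unfolding e by (rule orth)
    ultimately show ?case by simp
  next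
    case (Suc m)
    show ?case
    proof (cases k)
      case 0
      then have "u (Suc m) k = u m 1"
        by (simp add: u_def fun_eq_iff)
      then show ?thesis using Suc.IH[of 1] by simp
    next
      case (Suc j)
      have e: "u (Suc m) k s = (u m j s + u m (k + 1) s) / 2" for s
      proof -
        have "cos s ^ Suc m * cos (real k * s) = cos s ^ m * (cos (real k * s) * cos (real 1 * s))" by simp
        also have "cos (real k * s) * cos (real 1 * s) = (cos (real (k - 1) * s) + cos (real (k + 1) * s)) / 2"
          by (rule cos_times_cos_nat) (simp add: Suc)
        finally have E: "cos s ^ Suc m * cos (real k * s) =
          cos s ^ m * ((cos (real (k - 1) * s) + cos (real (k + 1) * s)) / 2)" .
        have "u (Suc m) k s = r (cos s) * of_real (cos s ^ m * ((cos (real (k - 1) * s) + cos (real (k + 1) * s)) / 2))"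
          unfolding u_def E by (rule refl)
        then show ?thesis by (simp add: u_def Suc distrib_left)
      qed
      have "((\<lambda>s. (u m j s + u m (k + 1) s) / 2) has_integral (0 + 0) / 2) {0..2 * pi}"
        by (intro has_integral_divide has_integral_add Suc.IH)
      then show ?thesis unfolding e[abs_def] by simp
    qed
  qed
  have poly: "((\<lambda>s. r (cos s) * of_real (p (cos s))) has_integral 0) {0..2 * pi}"
    if p: "polynomial_function p" for p :: "real \<Rightarrow> real"
  proof -
    obtain a n where a: "p = (\<lambda>x. \<Sum>i\<le>n. a i * x ^ i)"
      using p unfolding real_polynomial_function_eq[symmetric] real_polynomial_function_iff_sum by blast
    have "((\<lambda>s. \<Sum>i\<le>n. of_real (a i) * u i 0 s) has_integral (\<Sum>i\<le>n. of_real (a i) * 0)) {0..2 * pi}"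
      by (intro has_integral_sum has_integral_mult_right mono) simp
    moreover have "(\<Sum>i\<le>n. of_real (a i) * u i 0 s) = r (cos s) * of_real (p (cos s))" for s
      unfolding a u_def of_real_sum sum_distrib_left by (rule sum.cong) (simp_all add: mult.left_commute)
    ultimately show ?thesis by simp
  qed
  have cont: "integral {0..2 * pi} (\<lambda>s. r (cos s) * of_real (h (cos s))) = 0" if h: "continuous_on {-1..1} h" for h :: "real \<Rightarrow> real"
  proof -
    let ?J = "integral {0..2 * pi} (\<lambda>s. r (cos s) * of_real (h (cos s)))"
    have hc: "continuous_on {0..2 * pi} (\<lambda>s. h (cos s))"
      by (rule continuous_on_compose2[OF h]) (auto intro: continuous_intros)
    have hi: "((\<lambda>s. r (cos s) * of_real (h (cos s))) has_integral ?J) {0..2 * pi}"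
      by (rule integrable_integral[OF rf[OF hc]])
    define B where "B = integral {0..2 * pi} (\<lambda>s. cmod (r (cos s)))"
    have Bi: "(\<lambda>s. cmod (r (cos s))) integrable_on {0..2 * pi}"
      by (rule integrable_continuous_interval) (rule continuous_on_norm[OF rc])
    then have Bh: "((\<lambda>s. cmod (r (cos s))) has_integral B) {0..2 * pi}"
      unfolding B_def by (rule integrable_integral)
    have B0: "0 \<le> B"
      by (rule has_integral_nonneg[OF Bh]) simp
    have small: "cmod ?J \<le> e * B" if e: "e > 0" for e
    proof -
      obtain p where p: "polynomial_function p" "\<And>x. x \<in> {-1..1} \<Longrightarrow> norm (h x - p x) < e"
        using Stone_Weierstrass_polynomial_function[OF compact_Icc h e] by blast
      have fi: "((\<lambda>s. r (cos s) * of_real (h (cos s)) - r (cos s) * of_real (p (cos s))) has_integral ?J - 0) {0..2 * pi}"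
        by (rule has_integral_diff[OF hi poly[OF p(1)]])
      have gi: "((\<lambda>s. e * cmod (r (cos s))) has_integral e * B) {0..2 * pi}"
        by (rule has_integral_mult_right[OF Bh])
      have le: "cmod (r (cos s) * of_real (h (cos s)) - r (cos s) * of_real (p (cos s))) \<le> e * cmod (r (cos s))" for s
      proof -
        have "norm (h (cos s) - p (cos s)) < e" using p(2)[of "cos s"] by simp
        then have "cmod (r (cos s)) * \<bar>h (cos s) - p (cos s)\<bar> \<le> cmod (r (cos s)) * e"
          by (intro mult_left_mono) auto
        moreover have "cmod (r (cos s) * of_real (h (cos s)) - r (cos s) * of_real (p (cos s))) =
            cmod (r (cos s)) * \<bar>h (cos s) - p (cos s)\<bar>"
          unfolding right_diff_distrib[symmetric] of_real_diff[symmetric] norm_mult norm_of_real by (rule refl)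
        ultimately show ?thesis by (simp add: mult.commute)
      qed
      show ?thesis
        using Henstock_Kurzweil_Integration.integral_norm_bound_integral[OF
            has_integral_integrable[OF fi] has_integral_integrable[OF gi] le]
        unfolding integral_unique[OF fi] integral_unique[OF gi] by simp
    qed
    show ?thesis
    proof (rule ccontr)
      assume ne: "?J \<noteq> 0"
      define L where "L = cmod ?J"
      have L: "L > 0" unfolding L_def using ne by simp
      have "L \<le> L / (2 * (B + 1)) * B"
        using small[of "L / (2 * (B + 1))"] L B0 unfolding L_def[symmetric] by simp
      then have "L * (2 * (B + 1)) \<le> L * B" using B0 by (simp add: field_simps)
      then show False using L B0 by simp
    qed
  qed
  have reim: "continuous_on {-1..1} (\<lambda>x. Re (r x))" "continuous_on {-1..1} (\<lambda>x. Im (r x))"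
    by (intro continuous_intros r)+
  have reimc: "continuous_on {0..2 * pi} (\<lambda>s. Re (r (cos s)))" "continuous_on {0..2 * pi} (\<lambda>s. Im (r (cos s)))"
    by (intro continuous_intros rc)+
  have "((\<lambda>s. r (cos s) * of_real (Re (r (cos s)))) has_integral 0) {0..2 * pi}"
    using integrable_integral[OF rf[OF reimc(1)]] unfolding cont[OF reim(1)] .
  moreover have "((\<lambda>s. r (cos s) * of_real (Im (r (cos s)))) has_integral 0) {0..2 * pi}"
    using integrable_integral[OF rf[OF reimc(2)]] unfolding cont[OF reim(2)] .
  ultimately have "((\<lambda>s. r (cos s) * of_real (Re (r (cos s))) - \<i> * (r (cos s) * of_real (Im (r (cos s))))) has_integral (0 - \<i> * 0)) {0..2 * pi}"
    by (intro has_integral_diff has_integral_mult_right)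
  then have "((\<lambda>s. Re (r (cos s) * of_real (Re (r (cos s))) - \<i> * (r (cos s) * of_real (Im (r (cos s)))))) has_integral Re (0 - \<i> * 0)) {0..2 * pi}"
    by (rule has_integral_Re)
  moreover have "Re (r (cos s) * of_real (Re (r (cos s))) - \<i> * (r (cos s) * of_real (Im (r (cos s))))) =
      (cmod (r (cos s)))\<^sup>2" for s
    unfolding cmod_power2 by (simp add: power2_eq_square)
  ultimately have z: "((\<lambda>s. (cmod (r (cos s)))\<^sup>2) has_integral 0) {0..2 * pi}" by simp
  have c2: "continuous_on {0..2 * pi} (\<lambda>s. (cmod (r (cos s)))\<^sup>2)"
    by (intro continuous_on_power continuous_on_norm rc)
  have "box 0 (2 * pi) \<noteq> {}" using pi_gt_zero by (simp add: box_real del: pi_gt_zero)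
  then have "(cmod (r (cos s)))\<^sup>2 = 0" if "s \<in> {0..2 * pi}" for s
    using has_integral_0_cbox_imp_0[of 0 "2 * pi" "\<lambda>s. (cmod (r (cos s)))\<^sup>2" s] z c2 that
    by (simp add: box_real cbox_interval)
  moreover have "arccos x \<in> {0..2 * pi}" "cos (arccos x) = x"
    using arccos_lbound[of x] arccos_ubound[of x] x pi_ge_zero by (auto simp: abs_le_iff)
  ultimately show ?thesis by force
qed

section \<open>Geometric decay of Chebyshev coefficients and holomorphic extension\<close>

lemma cmod_cos_le: "cmod (cos w) \<le> exp \<bar>Im w\<bar>"
proof -
  have "cmod (cos w) = cmod (exp (\<i> * w) + exp (- (\<i> * w))) / 2"
    by (simp add: cos_exp_eq norm_divide)
  also have "\<dots> \<le> (cmod (exp (\<i> * w)) + cmod (exp (- (\<i> * w)))) / 2"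
    by (intro divide_right_mono norm_triangle_ineq) simp
  also have "\<dots> = (exp (- Im w) + exp (Im w)) / 2" by simp
  also have "\<dots> \<le> (exp \<bar>Im w\<bar> + exp \<bar>Im w\<bar>) / 2"
    by (intro divide_right_mono add_mono) auto
  finally show ?thesis by simp
qed

text \<open>Bernstein's theorem: the integrals are, up to normalization, the Chebyshev coefficients
  of \<open>g\<close>. Their geometric decay lets the series of
  \<open>b n * cos (n * Arccos z)\<close> converge uniformly near the real point \<open>x\<close>,
  and its sum extends \<open>g\<close> holomorphically.\<close>

lemma real_analytic_at_if_cos_coeffs:
  fixes g :: "real \<Rightarrow> complex"
  assumes g: "continuous_on {-1..1} g" and \<rho>: "0 < \<rho>" "\<rho> < 1"
    and coeff: "\<And>n. n0 \<le> n \<Longrightarrow> cmod (integral {0..2 * pi} (\<lambda>s. g (cos s) * of_real (cos (real n * s)))) \<le> C * \<rho> ^ n"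
    and x: "\<bar>x\<bar> < 1"
  shows "real_analytic_at g x"
proof -
  define c where "c n = integral {0..2 * pi} (\<lambda>s. g (cos s) * of_real (cos (real n * s)))" for n
  \<comment> \<open>Normalization by the squared norms of the cosines: \<open>2 * pi\<close> at
    frequency 0 and \<open>pi\<close> otherwise.\<close>
  define b where "b n = (if n = 0 then c n / (2 * pi) else c n / pi)" for n
  \<comment> \<open>The sum absorbs the finitely many indices below \<open>n0\<close>, on which
    \<open>coeff\<close> says nothing.\<close>
  define K where "K = \<bar>C\<bar> + (\<Sum>n<n0. cmod (c n) / \<rho> ^ n)"
  have cK: "cmod (c n) \<le> K * \<rho> ^ n" for n
  proof (cases "n0 \<le> n")
    case True
    have "cmod (c n) \<le> C * \<rho> ^ n" using coeff[OF True] by (simp add: c_def)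
    also have "\<dots> \<le> K * \<rho> ^ n"
      unfolding K_def using \<rho> by (intro mult_right_mono) (auto intro!: add_increasing2 sum_nonneg)
    finally show ?thesis .
  next
    case False
    have "cmod (c n) / \<rho> ^ n \<le> (\<Sum>n<n0. cmod (c n) / \<rho> ^ n)"
      using False \<rho> by (intro member_le_sum) auto
    then have "cmod (c n) / \<rho> ^ n \<le> K" unfolding K_def by linarith
    then show ?thesis using \<rho> by (simp add: field_simps)
  qed
  have bK: "cmod (b n) \<le> K * \<rho> ^ n" for n
  proof -
    have "cmod (c n) / y \<le> cmod (c n) / 1" if "1 \<le> y" for y
      by (rule divide_left_mono) (use that in auto)
    from this[of pi] this[of "2 * pi"] have "cmod (b n) \<le> cmod (c n)"
      unfolding b_def using pi_ge_two by (auto simp: norm_divide norm_mult)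
    then show ?thesis using cK[of n] by simp
  qed
  have K0: "0 \<le> K" using order_trans[OF norm_ge_zero bK[of 0]] by simp
  have sum\<rho>: "summable (\<lambda>n. K * \<rho> ^ n)" using \<rho> by (intro summable_mult summable_geometric) auto
  define h where "h s = (\<Sum>n. b n * of_real (cos (real n * s)))" for s
  have bb: "cmod (b n * of_real (cos (real n * s))) \<le> K * \<rho> ^ n" for n s
    using mult_mono[OF bK[of n] abs_cos_le_one[of "real n * s"]] K0 \<rho>(1) by (simp add: norm_mult)
  have ul: "uniform_limit UNIV (\<lambda>N s. \<Sum>n<N. b n * of_real (cos (real n * s))) h sequentially"
    unfolding h_def by (rule Weierstrass_m_test[OF bb sum\<rho>])
  have hc: "continuous_on S h" for S
  proof -
    have "continuous_on UNIV h"
      by (rule uniform_limit_theorem[OF _ ul]) (auto intro!: always_eventually continuous_intros)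
    then show ?thesis by (rule continuous_on_subset) simp
  qed
  \<comment> \<open>\<open>arccos (cos s)\<close> is \<open>s\<close> or \<open>2 * pi - s\<close>,
    and the series \<open>h\<close> is even and periodic.\<close>
  have hcos: "h (arccos (cos s)) = h s" if "s \<in> {0..2 * pi}" for s
  proof (cases "s \<le> pi")
    case True
    then show ?thesis using that by (simp add: arccos_cos)
  next
    case False
    have "arccos (cos s) = arccos (cos (2 * pi - s))" by (simp add: cos_diff)
    also have "\<dots> = 2 * pi - s" using that False by (intro arccos_cos) auto
    finally have e: "arccos (cos s) = 2 * pi - s" .
    have "cos (real n * (2 * pi - s)) = cos (real n * s)" for n
    proof -
      have "cos (real n * (2 * pi - s)) = cos (real (2 * n) * pi - real n * s)" by (simp add: algebra_simps)
      also have "\<dots> = cos (real n * s)"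
        unfolding cos_diff cos_npi sin_npi by simp
      finally show ?thesis .
    qed
    then show ?thesis by (simp add: e h_def)
  qed
  \<comment> \<open>The remainder is a function of \<open>cos s\<close> all of whose cosine
    coefficients vanish; that it is zero identifies \<open>g\<close> with the sum of its own
    series.\<close>
  define r where "r x = g x - h (arccos x)" for x
  have r: "continuous_on {-1..1} r"
    unfolding r_def
    by (intro continuous_intros g continuous_on_compose2[OF hc[of UNIV]]) auto
  have gc: "continuous_on {0..2 * pi} (\<lambda>s. g (cos s))"
    by (rule continuous_on_compose2[OF g]) (auto intro: continuous_intros)
  \<comment> \<open>Uniform convergence allows termwise integration, and only the term
    \<open>n = k\<close> survives: from \<open>N > k\<close> on, the integrals of the partial sums
    already equal \<open>c k\<close>.\<close>
  have orth: "integral {0..2 * pi} (\<lambda>s. r (cos s) * of_real (cos (real k * s))) = 0" for k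
  proof -
    define t where "t N s = (\<Sum>n<N. b n * of_real (cos (real n * s)) * of_real (cos (real k * s)))" for N s
    have "uniform_limit {0..2 * pi} t (\<lambda>s. \<Sum>n. b n * of_real (cos (real n * s)) * of_real (cos (real k * s))) sequentially"
      unfolding t_def
    proof (rule Weierstrass_m_test[OF _ sum\<rho>])
      fix n s
      show "cmod (b n * of_real (cos (real n * s)) * of_real (cos (real k * s))) \<le> K * \<rho> ^ n"
        using mult_mono[OF bb[of n s] abs_cos_le_one[of "real k * s"]] K0 \<rho>(1) by (simp add: norm_mult)
    qed
    moreover have "(\<Sum>n. b n * of_real (cos (real n * s)) * of_real (cos (real k * s))) = h s * of_real (cos (real k * s))" for s
      unfolding h_def by (rule suminf_mult2[symmetric], rule summable_comparison_test'[OF sum\<rho>, of 0]) (rule bb)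
    ultimately have ut: "uniform_limit {0..2 * pi} t (\<lambda>s. h s * of_real (cos (real k * s))) sequentially" by simp
    have tc: "continuous_on {0..2 * pi} (t N)" for N unfolding t_def by (intro continuous_intros)
    obtain I J where I: "\<And>N. (t N has_integral I N) {0..2 * pi}"
      and J: "((\<lambda>s. h s * of_real (cos (real k * s))) has_integral J) {0..2 * pi}" and lim: "I \<longlonglongrightarrow> J"
      by (rule uniform_limit_integral[OF ut tc]) auto
    have "I N = c k" if N: "N > k" for N
    proof -
      have e: "t N = (\<lambda>s. \<Sum>n<N. b n * of_real (cos (real n * s) * cos (real k * s)))"
        by (simp add: t_def fun_eq_iff mult.assoc)
      have "(t N has_integral (\<Sum>n<N. b n * of_real (if n = k then if n = 0 then 2 * pi else pi else 0))) {0..2 * pi}"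
        unfolding e by (intro has_integral_sum has_integral_mult_right has_integral_of_real has_integral_cos_cos) auto
      then have "I N = (\<Sum>n<N. b n * of_real (if n = k then if n = 0 then 2 * pi else pi else 0))"
        using I has_integral_unique by blast
      also have "\<dots> = (\<Sum>n<N. if n = k then c k else 0)"
        by (rule sum.cong) (auto simp: b_def)
      also have "\<dots> = c k" using N by simp
      finally show ?thesis .
    qed
    then have "I \<longlonglongrightarrow> c k"
      by (intro tendsto_eventually eventually_sequentiallyI[of "Suc k"]) auto
    then have Jc: "J = c k" using lim LIMSEQ_unique by blast
    have "integral {0..2 * pi} (\<lambda>s. r (cos s) * of_real (cos (real k * s))) =
        integral {0..2 * pi} (\<lambda>s. g (cos s) * of_real (cos (real k * s)) - h s * of_real (cos (real k * s)))"
      by (rule integral_cong) (simp add: r_def hcos left_diff_distrib)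
    also have "\<dots> = c k - J"
      using integral_unique[OF J] unfolding c_def
      by (subst Henstock_Kurzweil_Integration.integral_diff)
        (auto intro!: integrable_continuous_interval continuous_intros gc hc)
    finally show ?thesis by (simp add: Jc)
  qed
  have gh: "g t = h (arccos t)" if "\<bar>t\<bar> \<le> 1" for t
    using cos_orthogonal_imp_zero[OF r orth that] by (simp add: r_def)
  \<comment> \<open>Half of the available width of the strip, so that
    \<open>\<rho> * exp \<eta>\<close> is the square root of \<open>\<rho>\<close> and the bounds
    \<open>bd\<close> are still summable.\<close>
  define \<eta> where "\<eta> = - ln \<rho> / 2"
  have \<eta>: "\<eta> > 0" using \<rho> by (simp add: \<eta>_def)
  \<comment> \<open>The complement of the branch cuts of \<open>Arccos\<close>. On
    \<open>{-1<..<1}\<close> the values of \<open>Arccos\<close> are real, so a whole disc around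
    \<open>x\<close> is mapped into the strip of width \<open>\<eta>\<close>.\<close>
  define \<Omega> where "\<Omega> = {z :: complex. Im z \<noteq> 0 \<or> \<bar>Re z\<bar> < 1}"
  have open\<Omega>: "open \<Omega>"
    unfolding \<Omega>_def by (intro open_Collect_disj open_Collect_neq open_Collect_less continuous_intros)
  have holA: "Arccos holomorphic_on \<Omega>" by (rule holomorphic_on_Arccos) (auto simp: \<Omega>_def)
  have contI: "continuous_on \<Omega> (\<lambda>z. \<bar>Im (Arccos z)\<bar>)"
    by (intro continuous_intros holomorphic_on_imp_continuous_on[OF holA])
  have "open (\<Omega> \<inter> (\<lambda>z. \<bar>Im (Arccos z)\<bar>) -` {..<\<eta>})"
    by (rule continuous_open_preimage[OF contI open\<Omega>]) simp
  moreover have "complex_of_real x \<in> \<Omega> \<inter> (\<lambda>z. \<bar>Im (Arccos z)\<bar>) -` {..<\<eta>}"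
    using x \<eta> by (simp add: \<Omega>_def Im_Arccos_of_real)
  ultimately obtain \<delta> where \<delta>: "\<delta> > 0" "ball (complex_of_real x) \<delta> \<subseteq> \<Omega> \<inter> (\<lambda>z. \<bar>Im (Arccos z)\<bar>) -` {..<\<eta>}"
    unfolding open_contains_ball by blast
  define H where "H z = (\<Sum>n. b n * cos (of_nat n * Arccos z))" for z
  let ?D = "ball (complex_of_real x) \<delta>"
  have sqrt\<rho>: "\<rho> * exp \<eta> < 1"
  proof -
    have "\<rho> * exp \<eta> = exp (ln \<rho> + \<eta>)" using \<rho> by (simp add: exp_add)
    also have "\<dots> < 1" using \<eta> \<rho> by (simp add: \<eta>_def)
    finally show ?thesis .
  qed
  have bd: "cmod (b n * cos (of_nat n * Arccos z)) \<le> K * (\<rho> * exp \<eta>) ^ n" if "z \<in> ?D" for n z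
  proof -
    have "\<bar>Im (Arccos z)\<bar> \<le> \<eta>" using that \<delta> by auto
    then have "n * \<bar>Im (Arccos z)\<bar> \<le> n * \<eta>" by (rule mult_left_mono) simp
    then have "cmod (cos (of_nat n * Arccos z)) \<le> exp (n * \<eta>)"
      using cmod_cos_le[of "of_nat n * Arccos z"] by (simp add: abs_mult) (meson exp_le_cancel_iff order_trans)
    then have "cmod (b n) * cmod (cos (of_nat n * Arccos z)) \<le> (K * \<rho> ^ n) * exp (n * \<eta>)"
      using bK[of n] K0 \<rho> by (intro mult_mono) auto
    then show ?thesis by (simp add: norm_mult power_mult_distrib exp_of_nat_mult mult.assoc)
  qed
  have ulH: "uniform_limit ?D (\<lambda>N z. \<Sum>n<N. b n * cos (of_nat n * Arccos z)) H sequentially"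
    unfolding H_def using \<rho> sqrt\<rho>
    by (intro Weierstrass_m_test[OF bd] summable_mult summable_geometric) auto
  have "H holomorphic_on ?D"
  proof (rule holomorphic_uniform_sequence)
    show "(\<lambda>z. \<Sum>n<N. b n * cos (of_nat n * Arccos z)) holomorphic_on ?D" for N
    proof -
      have "Arccos holomorphic_on ?D" by (rule holomorphic_on_subset[OF holA]) (use \<delta>(2) in auto)
      then show ?thesis by (intro holomorphic_intros) auto
    qed
    fix z assume "z \<in> ?D"
    then obtain d where "d > 0" "cball z d \<subseteq> ?D" using open_contains_cball[of ?D] open_ball by blast
    then show "\<exists>d>0. cball z d \<subseteq> ?D \<and> uniform_limit (cball z d) (\<lambda>N z. \<Sum>n<N. b n * cos (of_nat n * Arccos z)) H sequentially"
      using uniform_limit_on_subset[OF ulH] by blast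
  qed simp
  then show ?thesis
  proof (rule holomorphic_imp_real_analytic_at[OF _ \<delta>(1)])
    fix t assume "\<bar>t - x\<bar> < \<delta>"
    then have "complex_of_real t \<in> ?D"
      by (simp add: dist_norm abs_minus_commute flip: of_real_diff)
    then have "complex_of_real t \<in> \<Omega>" using \<delta>(2) by blast
    then have t: "\<bar>t\<bar> \<le> 1" by (simp add: \<Omega>_def)
    then show "g t = H (of_real t)"
      by (simp add: gh h_def H_def of_real_arccos[symmetric] cos_of_real[symmetric])
  qed
qed

section \<open>Meshes\<close>

text \<open>Sums in the dual group are pointwise products here. The family \<open>c\<close> is
  indexed so that generators of a mesh may coincide.\<close>

definition char_prod :: "('a \<Rightarrow> 'b \<Rightarrow> complex) \<Rightarrow> 'a set \<Rightarrow> 'b \<Rightarrow> complex" where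
  "char_prod c T = (\<lambda>x. \<Prod>j\<in>T. c j x)"

text \<open>Subset products suffice because elements of \<open>signs\<close> are their own inverses:
  for a finite subset of \<open>signs\<close> this is the linear span over the field with two
  elements, and \<open>char_indep\<close> is linear independence there.\<close>

definition char_span :: "('b \<Rightarrow> complex) set \<Rightarrow> ('b \<Rightarrow> complex) set" where
  "char_span B = char_prod (\<lambda>\<gamma>. \<gamma>) ` Pow B"

definition char_indep :: "('b \<Rightarrow> complex) set \<Rightarrow> bool" where
  "char_indep B \<longleftrightarrow> (\<forall>T\<subseteq>B. char_prod (\<lambda>\<gamma>. \<gamma>) T = (\<lambda>x. 1) \<longrightarrow> T = {})"

definition signs :: "('b \<Rightarrow> complex) set" where
  "signs = {\<gamma>. \<forall>x. \<gamma> x * \<gamma> x = 1}"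

lemma walsh_signs [simp]: "walsh A \<in> signs"
  by (simp add: signs_def)

text \<open>Common factors square to 1, so the group law becomes the symmetric difference of index
  sets.\<close>

lemma char_prod_mult:
  assumes "finite S" "finite T" "\<And>j. j \<in> S \<union> T \<Longrightarrow> c j \<in> signs"
  shows "char_prod c S x * char_prod c T x = char_prod c ((S - T) \<union> (T - S)) x"
proof -
  have "char_prod c S x = char_prod c (S - T) x * char_prod c (S \<inter> T) x"
    unfolding char_prod_def using prod.Int_Diff[OF assms(1), of "\<lambda>j. c j x" T] by (simp add: mult.commute)
  moreover have "char_prod c T x = char_prod c (T - S) x * char_prod c (S \<inter> T) x"
    unfolding char_prod_def using prod.Int_Diff[OF assms(2), of "\<lambda>j. c j x" S] by (simp add: mult.commute Int_commute)
  moreover have "char_prod c (S \<inter> T) x * char_prod c (S \<inter> T) x = 1"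
    unfolding char_prod_def prod.distrib[symmetric]
    by (rule prod.neutral) (use assms(3) in \<open>auto simp: signs_def\<close>)
  moreover have "char_prod c ((S - T) \<union> (T - S)) x = char_prod c (S - T) x * char_prod c (T - S) x"
    unfolding char_prod_def using assms by (intro prod.union_disjoint) auto
  ultimately show ?thesis by (simp add: mult_ac)
qed

lemma char_span_base: "B \<subseteq> char_span B"
proof
  fix \<gamma> assume "\<gamma> \<in> B"
  moreover have "\<gamma> = char_prod (\<lambda>\<gamma>. \<gamma>) {\<gamma>}" by (simp add: char_prod_def)
  ultimately show "\<gamma> \<in> char_span B" unfolding char_span_def by blast
qed

lemma finite_char_span: "finite B \<Longrightarrow> finite (char_span B)"
  and card_char_span_le: "finite B \<Longrightarrow> card (char_span B) \<le> 2 ^ card B"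
  using card_image_le[of "Pow B" "char_prod (\<lambda>\<gamma>. \<gamma>)"] by (simp_all add: char_span_def card_Pow)

lemma inj_on_char_prod:
  assumes "char_indep B" "finite B" "B \<subseteq> signs"
  shows "inj_on (char_prod (\<lambda>\<gamma>. \<gamma>)) (Pow B)"
proof (rule inj_onI)
  fix S T assume S: "S \<in> Pow B" and T: "T \<in> Pow B" and e: "char_prod (\<lambda>\<gamma>. \<gamma>) S = char_prod (\<lambda>\<gamma>. \<gamma>) T"
  have fin: "finite S" "finite T" using S T assms finite_subset by auto
  have sg: "j \<in> signs" if "j \<in> S \<union> T" for j using that S T assms(3) by auto
  have "char_prod (\<lambda>\<gamma>. \<gamma>) ((S - T) \<union> (T - S)) x = 1" for x
  proof -
    have "char_prod (\<lambda>\<gamma>. \<gamma>) S x * char_prod (\<lambda>\<gamma>. \<gamma>) T x = char_prod (\<lambda>\<gamma>. \<gamma>) S x * char_prod (\<lambda>\<gamma>. \<gamma>) S x" by (simp add: e)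
    also have "\<dots> = char_prod (\<lambda>\<gamma>. \<gamma>) ((S - S) \<union> (S - S)) x"
      using fin sg by (intro char_prod_mult) auto
    also have "\<dots> = 1" by (simp add: char_prod_def)
    finally show ?thesis using char_prod_mult[OF fin sg, where x = x] by simp
  qed
  then have "char_prod (\<lambda>\<gamma>. \<gamma>) ((S - T) \<union> (T - S)) = (\<lambda>x. 1)" by blast
  moreover have "(S - T) \<union> (T - S) \<subseteq> B" using S T by blast
  ultimately have "(S - T) \<union> (T - S) = {}" using assms(1) unfolding char_indep_def by blast
  then show "S = T" by blast
qed

text \<open>Independence makes the \<open>2 ^ card B\<close> subset products distinct, and all of
  them lie in \<open>H\<close>.\<close>

lemma char_indep_card_le:
  assumes B: "char_indep B" "finite B" "B \<subseteq> signs" "B \<subseteq> H"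
    and H: "finite H" "card H \<le> 2 ^ k" "(\<lambda>x. 1) \<in> H" "\<forall>\<gamma>\<in>H. \<forall>\<delta>\<in>H. (\<lambda>x. \<gamma> x * \<delta> x) \<in> H"
  shows "card B \<le> k"
proof -
  have "char_prod (\<lambda>\<gamma>. \<gamma>) T \<in> H" if "T \<subseteq> H" for T
  proof -
    have "finite T" using that H(1) finite_subset by blast
    then show ?thesis using that
    proof (induction T rule: finite_induct)
      case empty
      then show ?case using H(3) by (simp add: char_prod_def)
    next
      case (insert \<gamma> T)
      then have "char_prod (\<lambda>\<gamma>. \<gamma>) (insert \<gamma> T) = (\<lambda>x. \<gamma> x * char_prod (\<lambda>\<gamma>. \<gamma>) T x)"
        by (simp add: char_prod_def)
      then show ?case using insert H(4) by simp
    qed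
  qed
  then have "char_prod (\<lambda>\<gamma>. \<gamma>) ` Pow B \<subseteq> H" using B(4) by blast
  then have "card (Pow B) \<le> card H"
    using inj_on_char_prod[OF B(1-3)] H(1) card_inj_on_le by blast
  then have "(2 :: nat) ^ card B \<le> 2 ^ k" using H(2) unfolding card_Pow[OF B(2)] by (rule order_trans)
  then show ?thesis by (rule power_le_imp_le_exp[rotated]) simp
qed

text \<open>A maximal independent subset spans: a nontrivial relation in \<open>insert s B\<close>
  must contain \<open>s\<close>, and since \<open>s\<close> is its own inverse, the relation
  expresses \<open>s\<close> through \<open>B\<close>.\<close>

lemma char_indep_maximal:
  assumes "finite S" "S \<subseteq> signs"
  obtains B where "B \<subseteq> S" "char_indep B" "S \<subseteq> char_span B"
proof -
  have "char_indep {}" by (simp add: char_indep_def)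
  then have "{B. B \<subseteq> S \<and> char_indep B} \<noteq> {}" by blast
  moreover have "finite {B. B \<subseteq> S \<and> char_indep B}" using assms(1) by simp
  ultimately obtain B where B: "B \<subseteq> S" "char_indep B"
    and max: "\<And>C. C \<subseteq> S \<Longrightarrow> char_indep C \<Longrightarrow> B \<subseteq> C \<Longrightarrow> C = B"
    using finite_has_maximal[of "{B. B \<subseteq> S \<and> char_indep B}"] by (metis (mono_tags, lifting) mem_Collect_eq)
  have finB: "finite B" using B(1) assms(1) finite_subset by blast
  have "s \<in> char_span B" if s: "s \<in> S" for s
  proof (cases "s \<in> B")
    case True
    then show ?thesis using char_span_base by blast
  next
    case False
    then have "\<not> char_indep (insert s B)" using max[of "insert s B"] B(1) s by blast
    then obtain T where T: "T \<subseteq> insert s B" "char_prod (\<lambda>\<gamma>. \<gamma>) T = (\<lambda>x. 1)" "T \<noteq> {}"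
      unfolding char_indep_def by blast
    have "s \<in> T"
    proof (rule ccontr)
      assume "s \<notin> T"
      then have "T \<subseteq> B" using T(1) by blast
      then show False using T(2,3) B(2) by (auto simp: char_indep_def)
    qed
    define T' where "T' = T - {s}"
    have T': "T' \<subseteq> B" "finite T'" "T = insert s T'" "s \<notin> T'"
      using T(1) \<open>s \<in> T\<close> finB finite_subset[of T' B] by (auto simp: T'_def)
    have "s x = char_prod (\<lambda>\<gamma>. \<gamma>) T' x" for x
    proof -
      have "s x * char_prod (\<lambda>\<gamma>. \<gamma>) T' x = 1"
        using fun_cong[OF T(2), of x] T' by (simp add: char_prod_def)
      moreover have "s x * s x = 1" using s assms(2) by (auto simp: signs_def)
      ultimately show ?thesis by (metis mult.assoc mult.left_neutral)
    qed
    then have "s = char_prod (\<lambda>\<gamma>. \<gamma>) T'" by blast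
    then show ?thesis using T'(1) unfolding char_span_def by blast
  qed
  then show ?thesis using that B by blast
qed

lemma powi_sign:
  fixes y :: complex
  assumes "y * y = 1"
  shows "y powi n = (if even n then 1 else y)"
proof -
  have "y = 1 \<or> y = - 1" using assms by (metis square_eq_1_iff)
  then show ?thesis by (auto simp: power_int_minus_left)
qed

text \<open>Every group element is its own inverse, so characters take only the values 1 and -1 and
  only the parities of the exponents count. The subset products of the generators therefore contain
  the mesh, whatever its set of exponents.\<close>

lemma mesh_subset_subgroup:
  fixes M :: "(cantor_group \<Rightarrow> complex) set"
  assumes "is_mesh k M"
  obtains H where "M \<subseteq> H" "finite H" "card H \<le> 2 ^ k" "(\<lambda>x. 1) \<in> H"
    "\<forall>\<gamma>\<in>H. \<forall>\<delta>\<in>H. (\<lambda>x. \<gamma> x * \<delta> x) \<in> H"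
proof -
  obtain c E where c: "\<And>j. j \<in> {1..k} \<Longrightarrow> c j \<in> (dual_group :: (cantor_group \<Rightarrow> complex) set)"
    and M: "M = {(\<lambda>g. \<Prod>j=1..k. c j g powi n j) | n :: nat \<Rightarrow> int. n \<in> E}"
    using assms unfolding is_mesh_def by blast
  have sg: "c j \<in> signs" if "j \<in> {1..k}" for j
  proof -
    have hom: "c j (x + y) = c j x * c j y" and n1: "cmod (c j x) = 1" for x y
      using c[OF that] by (auto simp: dual_group_def)
    have "x + x = 0" for x :: cantor_group by (simp add: fun_eq_iff)
    moreover have "c j 0 = 1" using hom[of 0 0] n1[of 0] by auto
    ultimately have "c j x * c j x = 1" for x using hom[of x x] by simp
    then show ?thesis by (simp add: signs_def)
  qed
  let ?H = "char_prod c ` Pow {1..k}"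
  show ?thesis
  proof
    show "M \<subseteq> ?H"
    proof
      fix \<gamma> assume "\<gamma> \<in> M"
      then obtain n where n: "\<gamma> = (\<lambda>g. \<Prod>j=1..k. c j g powi n j)" unfolding M by blast
      have "\<gamma> = char_prod c {j \<in> {1..k}. odd (n j)}"
      proof
        fix g
        have "\<gamma> g = (\<Prod>j=1..k. if odd (n j) then c j g else 1)"
          unfolding n by (rule prod.cong[OF refl]) (use sg in \<open>auto simp: powi_sign signs_def\<close>)
        then show "\<gamma> g = char_prod c {j \<in> {1..k}. odd (n j)} g"
          by (simp only: char_prod_def prod.inter_filter[OF finite_atLeastAtMost])
      qed
      then show "\<gamma> \<in> ?H" by blast
    qed
    show "finite ?H" by simp
    show "card ?H \<le> 2 ^ k" using card_image_le[of "Pow {1..k}" "char_prod c"] by (simp add: card_Pow)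
    have "(\<lambda>x. 1) = char_prod c {}" by (simp add: char_prod_def)
    then show "(\<lambda>x. 1) \<in> ?H" by blast
    show "\<forall>\<gamma>\<in>?H. \<forall>\<delta>\<in>?H. (\<lambda>x. \<gamma> x * \<delta> x) \<in> ?H"
    proof (intro ballI)
      fix \<gamma> \<delta> assume "\<gamma> \<in> ?H" "\<delta> \<in> ?H"
      then obtain S T where ST: "S \<subseteq> {1..k}" "T \<subseteq> {1..k}" "\<gamma> = char_prod c S" "\<delta> = char_prod c T" by blast
      have "(\<lambda>x. \<gamma> x * \<delta> x) = char_prod c ((S - T) \<union> (T - S))"
        unfolding ST fun_eq_iff using ST(1,2) sg
        by (intro allI char_prod_mult finite_subset[OF ST(1)] finite_subset[OF ST(2)]) auto
      moreover have "(S - T) \<union> (T - S) \<in> Pow {1..k}" using ST(1,2) by blast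
      ultimately show "(\<lambda>x. \<gamma> x * \<delta> x) \<in> ?H" by (rule image_eqI)
    qed
  qed
qed

section \<open>Independence across blocks with disjoint coordinates\<close>

lemma walsh_mask:
  assumes "A \<subseteq> D"
  shows "walsh A (\<lambda>i. if i \<in> D then x i else 0) = walsh A x"
  unfolding walsh_def by (rule prod.cong[OF refl]) (use assms in auto)

lemma walsh_mask_disjoint:
  assumes "A \<inter> D = {}"
  shows "walsh A (\<lambda>i. if i \<in> D then x i else 0) = 1"
  unfolding walsh_def by (rule prod.neutral) (use assms in auto)

text \<open>Evaluating a relation at points whose coordinates outside \<open>D n\<close> are zero
  turns the factors from the other blocks into 1, so the part of the relation inside each block is
  itself a relation.\<close>

lemma char_indep_UN:
  assumes D: "disjoint_family D" and B: "\<And>n. B n \<subseteq> walsh ` Pow (D n)" "\<And>n. char_indep (B n)" "\<And>n. finite (B n)"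
    and N: "finite N"
  shows "char_indep (\<Union>n\<in>N. B n)"
  unfolding char_indep_def
proof (intro allI impI)
  fix T assume T: "T \<subseteq> (\<Union>n\<in>N. B n)" and T1: "char_prod (\<lambda>\<gamma>. \<gamma>) T = (\<lambda>x. 1)"
  have finT: "finite T" using T N B(3) finite_subset by blast
  have "T \<inter> B n = {}" for n
  proof -
    have "char_prod (\<lambda>\<gamma>. \<gamma>) (T \<inter> B n) x = 1" for x
    proof -
      let ?x = "\<lambda>i. if i \<in> D n then x i else 0"
      have "char_prod (\<lambda>\<gamma>. \<gamma>) T ?x = (\<Prod>\<gamma>\<in>T. if \<gamma> \<in> B n then \<gamma> x else 1)"
        unfolding char_prod_def
      proof (rule prod.cong[OF refl])
        fix \<gamma> assume "\<gamma> \<in> T"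
        then obtain m where m: "\<gamma> \<in> B m" using T by blast
        show "\<gamma> ?x = (if \<gamma> \<in> B n then \<gamma> x else 1)"
        proof (cases "\<gamma> \<in> B n")
          case True
          then show ?thesis using B(1)[of n] walsh_mask[of _ "D n" x] by auto
        next
          case False
          then have "m \<noteq> n" using m by blast
          then have "D m \<inter> D n = {}" using D by (simp add: disjoint_family_on_def)
          moreover obtain A where "A \<subseteq> D m" "\<gamma> = walsh A" using m B(1) by blast
          ultimately have "\<gamma> ?x = 1" using walsh_mask_disjoint[of A "D n" x] by blast
          then show ?thesis using False by simp
        qed
      qed
      also have "\<dots> = char_prod (\<lambda>\<gamma>. \<gamma>) (T \<inter> B n) x"
        unfolding char_prod_def by (rule prod.inter_restrict[OF finT, symmetric])
      finally show ?thesis using T1 by simp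
    qed
    then have "char_prod (\<lambda>\<gamma>. \<gamma>) (T \<inter> B n) = (\<lambda>x. 1)" by blast
    then show ?thesis
      by (rule B(2)[unfolded char_indep_def, rule_format, OF Int_lower2])
  qed
  then show "T = {}" using T by blast
qed

text \<open>A common character would be insensitive to every coordinate, hence trivial, and a
  trivial character is a relation of length one.\<close>

lemma char_indep_blocks_disjoint:
  assumes D: "disjoint_family D" and B: "\<And>n. B n \<subseteq> walsh ` Pow (D n)" "\<And>n. char_indep (B n)" and "m \<noteq> n"
  shows "B m \<inter> B n = {}"
proof (rule ccontr)
  assume "B m \<inter> B n \<noteq> {}"
  then obtain \<gamma> where \<gamma>: "\<gamma> \<in> B m" "\<gamma> \<in> B n" by blast
  have "\<gamma> \<in> walsh ` Pow (D m)" "\<gamma> \<in> walsh ` Pow (D n)" using \<gamma> B(1) by blast+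
  then obtain A A' where A: "A \<subseteq> D m" "\<gamma> = walsh A" "A' \<subseteq> D n" "\<gamma> = walsh A'" by auto
  have dis: "D m \<inter> D n = {}" using D \<open>m \<noteq> n\<close> by (simp add: disjoint_family_on_def)
  have "walsh A x = 1" for x
  proof -
    have "walsh A x = walsh A (\<lambda>i. if i \<in> D m then x i else 0)" using walsh_mask[OF A(1)] by simp
    also have "\<dots> = walsh A' (\<lambda>i. if i \<in> D m then x i else 0)" using A by simp
    also have "\<dots> = 1" using dis A(3) by (intro walsh_mask_disjoint) blast
    finally show ?thesis .
  qed
  then have "char_prod (\<lambda>\<gamma>. \<gamma>) {\<gamma>} = (\<lambda>x. 1)" using A(2) by (simp add: char_prod_def fun_eq_iff)
  then show False
    using B(2)[unfolded char_indep_def, rule_format, of "{\<gamma>}" m] \<gamma>(1) by simp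
qed

text \<open>With b_n independent generators in block n, the span hypothesis bounds the contribution
  by b_n w(b_n) \<le> b_n w(k), and the b_n add up to at most k. Apart from the monotone factor the
  bound is linear in b_n, which is why the contributions can be added.\<close>

lemma mesh_card_le:
  fixes w :: "real \<Rightarrow> real"
  assumes w: "mono_on {1..} w" "\<And>x. x \<ge> 1 \<Longrightarrow> w x \<ge> 1"
    and D: "disjoint_family D" "\<And>n. finite (D n)" and Lam: "\<And>n. Lam n \<subseteq> walsh ` Pow (D n)"
    and span: "\<And>n B. B \<subseteq> Lam n \<Longrightarrow> real (card (Lam n \<inter> char_span B)) \<le> card B * w (card B)"
    and k: "k \<ge> 1" and M: "is_mesh k M"
  shows "finite ((\<Union>n. Lam n) \<inter> M) \<and> real (card ((\<Union>n. Lam n) \<inter> M)) \<le> k * w k"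
proof -
  obtain H where H: "M \<subseteq> H" "finite H" "card H \<le> 2 ^ k" "(\<lambda>x. 1) \<in> H"
    "\<forall>\<gamma>\<in>H. \<forall>\<delta>\<in>H. (\<lambda>x. \<gamma> x * \<delta> x) \<in> H"
    by (rule mesh_subset_subgroup[OF M])
  have finL: "finite (Lam n)" for n using Lam[of n] D(2)[of n] finite_subset by blast
  have sgn: "Lam n \<subseteq> signs" for n using Lam[of n] by auto
  have "\<exists>B. B \<subseteq> Lam n \<inter> M \<and> char_indep B \<and> Lam n \<inter> M \<subseteq> char_span B" for n
  proof -
    have "finite (Lam n \<inter> M)" "Lam n \<inter> M \<subseteq> signs" using finL[of n] sgn[of n] by auto
    then obtain B where "B \<subseteq> Lam n \<inter> M" "char_indep B" "Lam n \<inter> M \<subseteq> char_span B"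
      by (rule char_indep_maximal)
    then show ?thesis by blast
  qed
  then obtain B where B: "\<And>n. B n \<subseteq> Lam n \<inter> M" "\<And>n. char_indep (B n)" "\<And>n. Lam n \<inter> M \<subseteq> char_span (B n)"
    by metis
  have finB: "finite (B n)" for n using B(1)[of n] finL[of n] finite_subset by blast
  have BV: "B n \<subseteq> walsh ` Pow (D n)" for n using B(1)[of n] Lam[of n] by blast
  have sumB: "(\<Sum>n\<in>N. card (B n)) \<le> k" if N: "finite N" for N
  proof -
    have "card (\<Union>n\<in>N. B n) = (\<Sum>n\<in>N. card (B n))"
      using N finB char_indep_blocks_disjoint[OF D(1) BV B(2)] by (intro card_UN_disjoint) auto
    moreover have "card (\<Union>n\<in>N. B n) \<le> k"
    proof (rule char_indep_card_le[OF char_indep_UN[OF D(1) BV B(2) finB N] _ _ _ H(2-)])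
      show "finite (\<Union>n\<in>N. B n)" using N finB by blast
      show "(\<Union>n\<in>N. B n) \<subseteq> signs" using B(1) sgn by blast
      show "(\<Union>n\<in>N. B n) \<subseteq> H" using B(1) H(1) by blast
    qed
    ultimately show ?thesis by simp
  qed
  define N where "N = {n. B n \<noteq> {}}"
  have finN: "finite N"
  proof (rule ccontr)
    assume "infinite N"
    then obtain N' where N': "N' \<subseteq> N" "finite N'" "card N' = k + 1" using infinite_arbitrarily_large by blast
    have "card N' = (\<Sum>n\<in>N'. 1)" by simp
    also have "\<dots> \<le> (\<Sum>n\<in>N'. card (B n))"
      using N'(1) finB by (intro sum_mono) (auto simp: N_def Suc_le_eq card_gt_0_iff)
    finally show False using sumB[OF N'(2)] N'(3) by simp
  qed
  have e: "(\<Union>n. Lam n) \<inter> M = (\<Union>n\<in>N. Lam n \<inter> M)"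
  proof -
    have "Lam n \<inter> M = {}" if "n \<notin> N" for n
    proof -
      have "B n = {}" using that by (simp add: N_def)
      then have "Lam n \<inter> M \<subseteq> Lam n \<inter> char_span {}" using B(3)[of n] by auto
      \<comment> \<open>For the empty set the right-hand side of \<open>span\<close> is 0, so a
        block without generators contributes nothing.\<close>
      moreover have "Lam n \<inter> char_span {} = {}" using span[of "{}" n] finL[of n] by simp
      ultimately show ?thesis by blast
    qed
    then show ?thesis by blast
  qed
  have "real (card (\<Union>n\<in>N. Lam n \<inter> M)) \<le> (\<Sum>n\<in>N. real (card (Lam n \<inter> M)))"
    using card_UN_le[OF finN, of "\<lambda>n. Lam n \<inter> M"] by (simp flip: of_nat_sum)
  also have "\<dots> \<le> (\<Sum>n\<in>N. card (B n) * w k)"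
  proof (rule sum_mono)
    fix n assume "n \<in> N"
    then have 1: "1 \<le> card (B n)" using finB by (simp add: N_def Suc_le_eq card_gt_0_iff)
    have 2: "card (B n) \<le> k" using sumB[of "{n}"] by simp
    have "card (Lam n \<inter> M) \<le> card (Lam n \<inter> char_span (B n))"
      using B(3)[of n] finL by (intro card_mono) auto
    also have "real (card (Lam n \<inter> char_span (B n))) \<le> card (B n) * w (card (B n))"
      using B(1)[of n] by (intro span) blast
    also have "\<dots> \<le> card (B n) * w k"
      using 1 2 w(1) by (intro mult_left_mono) (auto simp: mono_on_def)
    finally show "real (card (Lam n \<inter> M)) \<le> card (B n) * w k" by simp
  qed
  also have "\<dots> = (\<Sum>n\<in>N. card (B n)) * w k" by (simp add: sum_distrib_right)
  also have "\<dots> \<le> k * w k"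
    using sumB[OF finN] w(2)[of k] k by (intro mult_right_mono) (auto simp flip: of_nat_sum)
  finally show ?thesis using e finN finL by simp
qed

section \<open>The blocks\<close>

text \<open>For \<open>card J = n\<close> and f_n the mean over \<open>J\<close> this is exp (-i n
  f_n). The numbers \<open>Re (\<gamma> (ind {j}))\<close> are the Rademacher coordinates of the
  character: -1 if \<open>j\<close> belongs to its (finite) index set and 1 otherwise.\<close>

definition osc :: "nat set \<Rightarrow> (cantor_group \<Rightarrow> complex) \<Rightarrow> complex" where
  "osc J \<gamma> = cis (- (\<Sum>j\<in>J. Re (\<gamma> (ind {j}))))"

text \<open>Since pi/2 - 1 < 1, the sine is the larger of the two, so sin 1 dominates both possible
  moduli of a normalized factor.\<close>

lemma sin_one_bounds: "cos 1 \<le> sin (1 :: real)" "0 < sin (1 :: real)" "sin (1 :: real) < 1" "0 \<le> cos (1 :: real)"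
proof -
  have pi: "3 < pi" "pi < 4" using pi_approx by auto
  have "cos 1 = sin (pi / 2 - 1)" by (simp add: sin_diff)
  also have "\<dots> \<le> sin (1 :: real)" using pi by (intro sin_monotone_2pi_le) auto
  finally show "cos 1 \<le> sin (1 :: real)" .
  show "0 < sin (1 :: real)" using pi by (intro sin_gt_zero) auto
  show "0 \<le> cos (1 :: real)" using pi by (intro cos_ge_zero) auto
  have "sin 1 < sin (pi / 2)" using pi by (intro sin_monotone_2pi) auto
  then show "sin (1 :: real) < 1" by simp
qed

lemma cis_sum: "finite T \<Longrightarrow> cis (sum f T) = (\<Prod>j\<in>T. cis (f j))"
  by (induction T rule: finite_induct) (simp_all add: cis_mult[symmetric])

lemma osc_walsh:
  assumes "finite A" "finite J"
  shows "osc J (walsh A) = (\<Prod>j\<in>J. if j \<in> A then cis 1 else cis (- 1))"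
proof -
  have "osc J (walsh A) = cis (\<Sum>j\<in>J. - Re (walsh A (ind {j})))" by (simp add: osc_def sum_negf)
  also have "\<dots> = (\<Prod>j\<in>J. cis (- Re (walsh A (ind {j}))))"
    by (rule cis_sum[OF assms(2)])
  also have "\<dots> = (\<Prod>j\<in>J. if j \<in> A then cis 1 else cis (- 1))"
    by (rule prod.cong) (auto simp: walsh_ind_singleton assms(1))
  finally show ?thesis .
qed

text \<open>Summed over all \<open>A\<close>, the products over coordinates combine to a single
  product. The coordinate of \<open>x\<close> decides whether a factor in \<open>J\<close> has
  modulus 2 cos 1 or 2 sin 1; a factor outside \<open>J\<close> is at most 2.\<close>

lemma osc_sum_bound:
  assumes D: "finite D" "J \<subseteq> D"
  shows "cmod (\<Sum>A\<in>Pow D. osc J (walsh A) * walsh A x) \<le> 2 ^ card D * sin 1 ^ card J"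
proof -
  define s where "s i = (if x i = 0 then 1 else - 1 :: complex)" for i
  define a where "a i = (if i \<in> J then cis 1 else 1) * s i" for i
  define b where "b i = (if i \<in> J then cis (- 1) else 1)" for i
  have finJ: "finite J" using D finite_subset by blast
  have "osc J (walsh A) * walsh A x = (\<Prod>i\<in>A. a i) * (\<Prod>i\<in>D - A. b i)" if A: "A \<in> Pow D" for A
  proof -
    have finA: "finite A" using A D finite_subset by auto
    have "osc J (walsh A) = (\<Prod>j\<in>D. if j \<in> J then (if j \<in> A then cis 1 else cis (- 1)) else 1)"
      unfolding osc_walsh[OF finA finJ] prod.inter_restrict[OF D(1), symmetric]
      using D(2) by (simp add: Int_absorb1)
    also have "\<dots> = (\<Prod>i\<in>A. if i \<in> J then cis 1 else 1) * (\<Prod>i\<in>D - A. b i)"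
      using A by (subst prod.subset_diff[OF _ D(1), of A]) (auto simp: b_def mult.commute intro!: arg_cong2[of _ _ _ _ "(*)"] prod.cong)
    finally show ?thesis by (simp add: a_def walsh_def s_def prod.distrib mult_ac)
  qed
  then have "(\<Sum>A\<in>Pow D. osc J (walsh A) * walsh A x) = (\<Prod>i\<in>D. a i + b i)"
    by (simp add: prod_add[OF D(1)])
  also have "cmod \<dots> \<le> (\<Prod>i\<in>D. 2 * (if i \<in> J then sin 1 else 1))"
    unfolding prod_norm[symmetric]
  proof (rule prod_mono, intro conjI norm_ge_zero)
    fix i
    have 1: "cis 1 + cis (- 1) = of_real (2 * cos 1)" "cis (- 1) - cis 1 = - \<i> * of_real (2 * sin 1)"
      by (simp_all add: complex_eq_iff)
    show "cmod (a i + b i) \<le> 2 * (if i \<in> J then sin 1 else 1)"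
    proof (cases "i \<in> J")
      case True
      have "a i + b i = cis 1 + cis (- 1) \<or> a i + b i = cis (- 1) - cis 1"
        using True by (simp add: a_def b_def s_def)
      then show ?thesis
        unfolding 1 using True sin_one_bounds by (auto simp: norm_mult)
    next
      case False
      have "cmod (a i + b i) \<le> cmod (a i) + cmod (b i)" by (rule norm_triangle_ineq)
      also have "\<dots> = 2" using False by (simp add: a_def b_def s_def)
      finally show ?thesis using False by simp
    qed
  qed
  also have "\<dots> = 2 ^ card D * sin 1 ^ card J"
    unfolding prod.distrib prod.inter_restrict[OF D(1), symmetric]
    using D(2) by (simp add: Int_absorb1)
  finally show ?thesis .
qed

lemma pow_dominates_polynomial:
  fixes L q :: nat
  shows "eventually (\<lambda>p. 2 * (p + 1) * (2 * p * L) ^ (q + 1) < 2 ^ p) sequentially"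
proof -
  have "(\<lambda>p. (4 * real (L + 1)) ^ (q + 2) * (of_nat p ^ (q + 2) * (1 / 2 :: real) ^ p)) \<longlonglongrightarrow> (4 * real (L + 1)) ^ (q + 2) * 0"
    by (intro tendsto_mult_left) real_asymp
  then have "eventually (\<lambda>p. (4 * real (L + 1)) ^ (q + 2) * (of_nat p ^ (q + 2) * (1 / 2) ^ p) < 1) sequentially"
    by (rule order_tendstoD(2)) simp
  then show ?thesis using eventually_ge_at_top[of 1]
  proof eventually_elim
    case (elim p)
    have "2 * (p + 1) \<le> 4 * (L + 1) * p" using elim(2) by (simp add: algebra_simps)
    moreover have "(2 * p * L) ^ (q + 1) \<le> (4 * (L + 1) * p) ^ (q + 1)" by (rule power_mono) (auto simp: algebra_simps)
    ultimately have "2 * (p + 1) * (2 * p * L) ^ (q + 1) \<le> (4 * (L + 1) * p) * (4 * (L + 1) * p) ^ (q + 1)"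
      by (rule mult_mono) auto
    also have "\<dots> = (4 * (L + 1) * p) ^ (q + 2)" by simp
    finally have 1: "2 * (p + 1) * (2 * p * L) ^ (q + 1) \<le> (4 * (L + 1) * p) ^ (q + 2)" .
    have "(4 * real (L + 1) * real p) ^ (q + 2) < 2 ^ p"
      using elim(1) by (simp only: power_mult_distrib power_one_over) (simp add: field_simps)
    then have "real ((4 * (L + 1) * p) ^ (q + 2)) < real (2 ^ p)" by (simp only: of_nat_power of_nat_mult of_nat_numeral)
    then have "(4 * (L + 1) * p) ^ (q + 2) < 2 ^ p" by (simp only: of_nat_less_iff)
    then show ?case using 1 by linarith
  qed
qed

text \<open>Only the size \<open>m\<close> is dictated by \<open>n\<close> and \<open>w\<close>; the
  coordinate set \<open>D\<close> is arbitrary, so that the blocks can later be placed on disjoint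
  coordinates. The clause on \<open>B\<close> is the mesh bound inside one block.\<close>

lemma block_exists:
  fixes w :: "real \<Rightarrow> real" and n :: nat
  assumes w: "\<And>x. x \<ge> 1 \<Longrightarrow> w x \<ge> 1" "filterlim w at_top at_top"
  obtains m where "n \<le> m" "\<And>D J. finite D \<Longrightarrow> card D = m \<Longrightarrow> J \<subseteq> D \<Longrightarrow> card J = n \<Longrightarrow>
    \<exists>S \<subseteq> walsh ` Pow D. n \<le> card S \<and>
      (\<forall>x. cmod (\<Sum>\<gamma>\<in>S. osc J \<gamma> * \<gamma> x) \<le> 6 * sin 1 ^ n * card S) \<and>
      (\<forall>B\<subseteq>S. real (card (S \<inter> char_span B)) \<le> card B * w (card B))"
proof -
  define \<epsilon> :: real where "\<epsilon> = sin 1 ^ n"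
  have \<epsilon>: "0 < \<epsilon>" "\<epsilon> \<le> 1" using sin_one_bounds by (auto simp: \<epsilon>_def power_le_one)
  \<comment> \<open>With \<open>N = 2 * p * L\<close> this gives
    \<open>\<epsilon>^2 * N \<ge> 8 * p\<close>, and exp (8p) outweighs the at most
    \<open>4 * card V\<close> functionals of the union bound.\<close>
  define L where "L = nat \<lceil>4 / \<epsilon>\<^sup>2\<rceil>"
  have L: "4 \<le> \<epsilon>\<^sup>2 * L"
  proof -
    have "4 / \<epsilon>\<^sup>2 \<le> L" unfolding L_def by (rule real_nat_ceiling_ge)
    then show ?thesis using \<epsilon> by (simp add: field_simps)
  qed
  then have L1: "1 \<le> L" using \<epsilon> by (cases L) auto
  have "eventually (\<lambda>x. 2 * real L \<le> w x) at_top" using w(2) unfolding filterlim_at_top by blast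
  then obtain X where X: "\<And>x. X \<le> x \<Longrightarrow> 2 * real L \<le> w x" unfolding eventually_at_top_linorder by blast
  define q where "q = nat \<lceil>X\<rceil> + 1"
  have q: "1 \<le> q" "\<And>b. q \<le> b \<Longrightarrow> 2 * real L \<le> w (real b)"
  proof -
    show "1 \<le> q" by (simp add: q_def)
    fix b assume "q \<le> b"
    then have "X \<le> real b" unfolding q_def by linarith
    then show "2 * real L \<le> w (real b)" by (rule X)
  qed
  have "eventually (\<lambda>p. 2 * (p + 1) * (2 * p * L) ^ (q + 1) < 2 ^ p \<and> n + q \<le> p) sequentially"
    by (intro eventually_conj pow_dominates_polynomial eventually_ge_at_top)
  then obtain p where p: "2 * (p + 1) * (2 * p * L) ^ (q + 1) < 2 ^ p" "n + q \<le> p"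
    unfolding eventually_sequentially by blast
  define N where "N = 2 * p * L"
  have pN: "p \<le> N" using L1 by (simp add: N_def)
  show ?thesis
  proof
    show "n \<le> 2 * p" using p(2) by simp
    fix D J :: "nat set" assume D: "finite D" "card D = 2 * p" and J: "J \<subseteq> D" "card J = n"
    define V where "V = walsh ` Pow D"
    have inj: "inj_on walsh (Pow D)" using D(1) by (intro inj_onI walsh_inj) (auto intro: finite_subset)
    have finV: "finite V" unfolding V_def using D(1) by simp
    have cardV: "card V = 2 ^ (2 * p)" unfolding V_def using inj D by (simp add: card_image card_Pow)
    have Vsum: "(\<Sum>\<gamma>\<in>V. h \<gamma>) = (\<Sum>A\<in>Pow D. h (walsh A))" for h :: "_ \<Rightarrow> complex"
      unfolding V_def by (simp add: sum.reindex[OF inj])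
    \<comment> \<open>The four values of \<open>t\<close> reduce the modulus of a complex sum to
      one-sided real bounds. Real and imaginary part are each at most
      \<open>3 * \<epsilon> * N\<close> in modulus, which is where the factor 6 comes from.\<close>
    define u where "u = (\<lambda>(X, t). \<lambda>\<gamma> :: cantor_group \<Rightarrow> complex. Re (t * (osc J \<gamma> * \<gamma> (ind X))))"
    define U where "U = u ` (Pow D \<times> {1, - 1, \<i>, - \<i>})"
    have cu: "cmod t = 1" if "t \<in> {1, - 1, \<i>, - \<i>}" for t using that by auto
    obtain S where S: "S \<subseteq> V" "card S = N" "\<And>u. u \<in> U \<Longrightarrow> sum u S < 3 * \<epsilon> * N"
      "\<And>B. B \<subseteq> S \<Longrightarrow> card B \<le> p \<Longrightarrow> card (S \<inter> char_span B) < card B + (if card B \<le> q then 1 else card B)"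
    proof (rule random_subset[OF finV cardV, of char_span U \<epsilon> N q])
      show "finite (char_span B) \<and> card (char_span B) \<le> 2 ^ card B" if "finite B" for B :: "(cantor_group \<Rightarrow> complex) set"
        using that finite_char_span card_char_span_le by blast
      show "B \<subseteq> char_span B" for B :: "(cantor_group \<Rightarrow> complex) set" by (rule char_span_base)
      show "finite U" unfolding U_def using D(1) by simp
      have "card U \<le> card (Pow D \<times> {1, - 1, \<i>, - \<i>})" unfolding U_def using D(1) by (intro card_image_le) simp
      also have "\<dots> \<le> card (Pow D) * 4"
        unfolding card_cartesian_product by (intro mult_left_mono) (auto simp: card_insert_if)
      also have "\<dots> = 4 * card V" using cardV D by (simp add: card_Pow)
      finally show "card U \<le> 4 * card V" .
      show "\<bar>v \<gamma>\<bar> \<le> 1" if vU: "v \<in> U" "\<gamma> \<in> V" for v \<gamma>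
      proof -
        obtain X t where v: "v = u (X, t)" "t \<in> {1, - 1, \<i>, - \<i>}" using vU(1) unfolding U_def by blast
        have "\<bar>v \<gamma>\<bar> \<le> cmod (t * (osc J \<gamma> * \<gamma> (ind X)))" unfolding v u_def prod.case by (rule abs_Re_le_cmod)
        also have "\<dots> = 1" using cu[OF v(2)] vU(2) by (auto simp: norm_mult osc_def V_def)
        finally show ?thesis .
      qed
      show "sum v V \<le> \<epsilon> * card V" if vU: "v \<in> U" for v
      proof -
        obtain X t where v: "v = u (X, t)" "t \<in> {1, - 1, \<i>, - \<i>}" using vU(1) unfolding U_def by blast
        have "sum v V = Re (t * (\<Sum>\<gamma>\<in>V. osc J \<gamma> * \<gamma> (ind X)))"
          unfolding v u_def prod.case by (simp only: Re_sum sum_distrib_left)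
        also have "\<dots> \<le> cmod (t * (\<Sum>\<gamma>\<in>V. osc J \<gamma> * \<gamma> (ind X)))" by (rule complex_Re_le_cmod)
        also have "\<dots> = cmod (\<Sum>A\<in>Pow D. osc J (walsh A) * walsh A (ind X))"
          using cu[OF v(2)] by (simp add: norm_mult Vsum)
        also have "\<dots> \<le> 2 ^ card D * sin 1 ^ card J" by (rule osc_sum_bound[OF D(1) J(1)])
        finally show ?thesis by (simp add: \<epsilon>_def cardV D J mult.commute)
      qed
      show "0 \<le> \<epsilon>" "\<epsilon> \<le> 1" using \<epsilon> by auto
      have "8 * real (card V) \<le> 2 ^ (8 * p)"
      proof -
        have "8 * real (card V) = 2 ^ (3 + 2 * p)" by (simp add: cardV power_add)
        also have "\<dots> \<le> 2 ^ (8 * p)" using p(2) q(1) by (intro power_increasing) auto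
        finally show ?thesis .
      qed
      also have "\<dots> \<le> exp 1 ^ (8 * p)"
        using exp_ge_add_one_self[of 1] by (intro power_mono) auto
      also have "\<dots> = exp (8 * real p)" by (simp add: exp_of_nat_mult[symmetric])
      also have "\<dots> \<le> exp (\<epsilon>\<^sup>2 * N)"
      proof -
        have "2 * real p * 4 \<le> 2 * real p * (\<epsilon>\<^sup>2 * L)" using L by (intro mult_left_mono) auto
        then show ?thesis by (simp add: N_def mult_ac)
      qed
      finally show "8 * real (card V) \<le> exp (\<epsilon>\<^sup>2 * N)" .
      show "p \<le> N" "2 * (p + 1) * N ^ (q + 1) < 2 ^ p" "1 \<le> p" "1 \<le> q"
        using p pN q(1) unfolding N_def by auto
    qed (rule that; blast)
    show "\<exists>S \<subseteq> walsh ` Pow D. n \<le> card S \<and>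
      (\<forall>x. cmod (\<Sum>\<gamma>\<in>S. osc J \<gamma> * \<gamma> x) \<le> 6 * sin 1 ^ n * card S) \<and>
      (\<forall>B\<subseteq>S. real (card (S \<inter> char_span B)) \<le> card B * w (card B))"
    proof (intro exI conjI allI impI)
      show "S \<subseteq> walsh ` Pow D" using S(1) unfolding V_def .
      show "n \<le> card S" using S(2) pN p(2) by linarith
      fix x :: cantor_group
      let ?X = "{i \<in> D. x i = 1}"
      let ?z = "\<Sum>\<gamma>\<in>S. osc J \<gamma> * \<gamma> (ind ?X)"
      have ex: "(\<Sum>\<gamma>\<in>S. osc J \<gamma> * \<gamma> x) = ?z"
      proof (rule sum.cong[OF refl])
        fix \<gamma> assume "\<gamma> \<in> S"
        then obtain A where "A \<subseteq> D" "\<gamma> = walsh A" using S(1) unfolding V_def by blast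
        then show "osc J \<gamma> * \<gamma> x = osc J \<gamma> * \<gamma> (ind ?X)" using walsh_eq_ind_Int[OF D(1), of A x] by simp
      qed
      have "Re (t * ?z) < 3 * \<epsilon> * N" if t: "t \<in> {1, - 1, \<i>, - \<i>}" for t
      proof -
        have "u (?X, t) \<in> U" unfolding U_def using t by blast
        from S(3)[OF this] show ?thesis
          unfolding u_def prod.case by (simp only: Re_sum sum_distrib_left)
      qed
      from this[of 1] this[of "- 1"] this[of \<i>] this[of "- \<i>"]
      have "\<bar>Re ?z\<bar> \<le> 3 * \<epsilon> * N" "\<bar>Im ?z\<bar> \<le> 3 * \<epsilon> * N" by auto
      then have "cmod ?z \<le> 6 * \<epsilon> * N" using cmod_le[of ?z] by linarith
      then show "cmod (\<Sum>\<gamma>\<in>S. osc J \<gamma> * \<gamma> x) \<le> 6 * sin 1 ^ n * card S"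
        unfolding ex S(2) \<epsilon>_def .
    next
      fix B assume B: "B \<subseteq> S"
      have finS: "finite S" using S(1) finV finite_subset by blast
      consider "card B = 0" | "1 \<le> card B" "card B \<le> q" | "q < card B" "card B \<le> p" | "p < card B" by linarith
      then show "real (card (S \<inter> char_span B)) \<le> card B * w (card B)"
      proof cases
        \<comment> \<open>The strict bound by 0 + 1 says that the block avoids the span of the empty
          set, that is, the trivial character.\<close>
        case 1
        then show ?thesis using S(4)[OF B] by simp
      next
        case 2
        then have "card (S \<inter> char_span B) \<le> card B" using S(4)[OF B] p(2) by simp
        moreover have "real (card B) * 1 \<le> card B * w (card B)" using 2 w(1) by (intro mult_left_mono) auto
        ultimately show ?thesis by linarith
      next
        case 3
        then have "real (card (S \<inter> char_span B)) \<le> real (card B) * 2" using S(4)[OF B] by simp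
        also have "\<dots> \<le> card B * w (card B)"
          using L1 q(2)[of "card B"] 3 by (intro mult_left_mono) auto
        finally show ?thesis .
      next
        case 4
        have "card (S \<inter> char_span B) \<le> N" using card_mono[OF finS, of "S \<inter> char_span B"] S(2) by simp
        also have "\<dots> \<le> card B * (2 * L)" using 4 by (simp add: N_def)
        finally have "real (card (S \<inter> char_span B)) \<le> real (card B * (2 * L))" by (simp only: of_nat_le_iff)
        also have "\<dots> = card B * (2 * real L)" by simp
        also have "\<dots> \<le> card B * w (card B)"
          using q(2)[of "card B"] 4 p(2) by (intro mult_left_mono) auto
        finally show ?thesis .
      qed
    qed
  qed
qed

section \<open>Analyticity\<close>

lemma cmod_fourier_walsh_le:
  assumes "integrable \<mu> G"
  shows "cmod (fourier G (walsh A)) \<le> (\<integral>x. cmod (G x) \<partial>\<mu>)"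
proof -
  have "cmod (fourier G (walsh A)) \<le> (\<integral>x. cmod (G x * walsh A x) \<partial>\<mu>)"
    unfolding fourier_walsh by (rule Bochner_Integration.integral_norm_bound)
  then show ?thesis by (simp add: norm_mult)
qed

text \<open>Real and imaginary parts are treated separately, and each is split by its sign: twice a
  factor 2.\<close>

lemma sum_cmod_le_of_subset_sums:
  fixes z :: "'a \<Rightarrow> complex"
  assumes S: "finite S" and b: "\<And>E. E \<subseteq> S \<Longrightarrow> cmod (sum z E) \<le> b"
  shows "(\<Sum>i\<in>S. cmod (z i)) \<le> 4 * b"
proof -
  have main: "(\<Sum>i\<in>S. \<bar>r i\<bar>) \<le> 2 * b" if r: "\<And>E. E \<subseteq> S \<Longrightarrow> \<bar>sum r E\<bar> \<le> b" for r :: "'a \<Rightarrow> real"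
  proof -
    let ?P = "{i \<in> S. 0 \<le> r i}"
    have "(\<Sum>i\<in>S. \<bar>r i\<bar>) = (\<Sum>i\<in>?P. \<bar>r i\<bar>) + (\<Sum>i\<in>S - ?P. \<bar>r i\<bar>)"
      using sum.subset_diff[of ?P S "\<lambda>i. \<bar>r i\<bar>"] S by simp
    also have "\<dots> = sum r ?P + (\<Sum>i\<in>S - ?P. - r i)"
      by (intro arg_cong2[of _ _ _ _ "(+)"] sum.cong) auto
    also have "\<dots> = sum r ?P - sum r (S - ?P)" by (simp add: sum_negf)
    also have "\<dots> \<le> b + b"
      using r[of ?P] r[of "S - ?P"] by auto
    finally show ?thesis by simp
  qed
  have "(\<Sum>i\<in>S. cmod (z i)) \<le> (\<Sum>i\<in>S. \<bar>Re (z i)\<bar> + \<bar>Im (z i)\<bar>)"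
    by (intro sum_mono cmod_le)
  also have "\<dots> = (\<Sum>i\<in>S. \<bar>Re (z i)\<bar>) + (\<Sum>i\<in>S. \<bar>Im (z i)\<bar>)" by (rule sum.distrib)
  also have "\<dots> \<le> 2 * b + 2 * b"
  proof (intro add_mono main)
    show "\<bar>\<Sum>i\<in>E. Re (z i)\<bar> \<le> b" "\<bar>\<Sum>i\<in>E. Im (z i)\<bar> \<le> b" if "E \<subseteq> S" for E
      using b[OF that] abs_Re_le_cmod[of "sum z E"] abs_Im_le_cmod[of "sum z E"] by auto
  qed
  finally show ?thesis by simp
qed

text \<open>The analytic data of the blocks. Excluding the trivial character by \<open>one\<close>
  makes every index set in \<open>Lam n\<close> nonempty, so it lies in no other \<open>D m\<close>:
  blocks share no characters, and a polynomial over \<open>D n\<close> has coefficient 0 at the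
  characters of the other blocks.\<close>

locale walsh_blocks =
  fixes D J :: "nat \<Rightarrow> nat set" and Lam :: "nat \<Rightarrow> (cantor_group \<Rightarrow> complex) set"
  assumes finD: "finite (D n)" and disj: "disjoint_family D"
    and J: "J n \<subseteq> D n" "card (J n) = n"
    and Lam: "Lam n \<subseteq> walsh ` Pow (D n)" and one: "walsh {} \<notin> Lam n" and cardLam: "n \<le> card (Lam n)"
    and osc: "cmod (\<Sum>\<gamma>\<in>Lam n. osc (J n) \<gamma> * \<gamma> x) \<le> 6 * sin 1 ^ n * card (Lam n)"
begin

lemma finJ: "finite (J n)"
  using finite_subset[OF J(1) finD] .

lemma finLam: "finite (Lam n)"
  using finite_subset[OF Lam] finD by simp

lemma LamE:
  assumes "\<gamma> \<in> Lam n"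
  obtains A where "A \<subseteq> D n" "finite A" "\<gamma> = walsh A" "\<And>m. m \<noteq> n \<Longrightarrow> \<not> A \<subseteq> D m"
proof -
  obtain A where A: "A \<subseteq> D n" "\<gamma> = walsh A" using assms Lam by blast
  have "A \<noteq> {}" using assms A(2) one by metis
  moreover have "D m \<inter> D n = {}" if "m \<noteq> n" for m
    using disj that by (simp add: disjoint_family_on_def)
  ultimately have "\<And>m. m \<noteq> n \<Longrightarrow> \<not> A \<subseteq> D m" using A(1) by blast
  then show ?thesis using that[of A] A finite_subset[OF A(1) finD] by blast
qed

lemma Lam_walsh: "\<gamma> \<in> Lam n \<Longrightarrow> \<exists>A. \<gamma> = walsh A"
  using Lam by blast

text \<open>\<open>c\<close> bounds the norm of an extension that vanishes on every other block. The
  vanishing is what allows functions on different blocks to be added without interference.\<close>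

definition realizes :: "nat \<Rightarrow> real \<Rightarrow> ((cantor_group \<Rightarrow> complex) \<Rightarrow> real) \<Rightarrow> bool" where
  "realizes n c h \<longleftrightarrow> (\<exists>G. integrable \<mu> G \<and> (\<integral>x. cmod (G x) \<partial>\<mu>) \<le> c \<and>
     (\<forall>\<gamma>\<in>Lam n. fourier G \<gamma> = of_real (h \<gamma>)) \<and> (\<forall>m \<gamma>. m \<noteq> n \<longrightarrow> \<gamma> \<in> Lam m \<longrightarrow> fourier G \<gamma> = 0))"

lemma realizesE:
  assumes "realizes n c h"
  obtains G where "integrable \<mu> G" "(\<integral>x. cmod (G x) \<partial>\<mu>) \<le> c"
    "\<forall>\<gamma>\<in>Lam n. fourier G \<gamma> = of_real (h \<gamma>)" "\<forall>m \<gamma>. m \<noteq> n \<longrightarrow> \<gamma> \<in> Lam m \<longrightarrow> fourier G \<gamma> = 0"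
  using assms unfolding realizes_def by blast

lemma realizes_mono: "realizes n c h \<Longrightarrow> c \<le> c' \<Longrightarrow> realizes n c' h"
  unfolding realizes_def by (meson order_trans)

lemma realizes_abs_le:
  assumes "realizes n c h" "\<gamma> \<in> Lam n"
  shows "\<bar>h \<gamma>\<bar> \<le> c"
proof -
  obtain G where G: "integrable \<mu> G" "(\<integral>x. cmod (G x) \<partial>\<mu>) \<le> c" "fourier G \<gamma> = of_real (h \<gamma>)"
    using assms unfolding realizes_def by blast
  obtain A where "\<gamma> = walsh A" using Lam_walsh[OF assms(2)] by blast
  then have "cmod (fourier G \<gamma>) \<le> c" using cmod_fourier_walsh_le[OF G(1), of A] G(2) by simp
  then show ?thesis unfolding G(3) by simp
qed

text \<open>\<open>Re (\<gamma> (ind X))\<close> is the transform of a point mass at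
  \<open>ind X\<close>. \<open>fourier_interpolation\<close> replaces point masses by densities of
  no larger total norm whose transforms vanish at characters not supported in
  \<open>D n\<close>.\<close>

lemma realizes_combination:
  assumes h: "\<And>\<gamma>. \<gamma> \<in> Lam n \<Longrightarrow> h \<gamma> = (\<Sum>X\<in>Pow (D n). a X * Re (\<gamma> (ind X)))"
    and c: "(\<Sum>X\<in>Pow (D n). \<bar>a X\<bar>) \<le> c"
  shows "realizes n c h"
proof -
  obtain G where G: "integrable \<mu> G" "(\<integral>x. cmod (G x) \<partial>\<mu>) \<le> (\<Sum>X\<in>Pow (D n). cmod (of_real (a X)))"
    "\<And>A. finite A \<Longrightarrow> fourier G (walsh A) =
       (if A \<subseteq> D n then \<Sum>X\<in>Pow (D n). of_real (a X) * walsh A (ind X) else 0)"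
    using fourier_interpolation[OF finD[of n], of "\<lambda>X. of_real (a X)"] by blast
  show ?thesis
    unfolding realizes_def
  proof (intro exI[of _ G] conjI ballI allI impI)
    show "integrable \<mu> G" by (rule G(1))
    show "(\<integral>x. cmod (G x) \<partial>\<mu>) \<le> c" using G(2) c by simp
    fix \<gamma> assume \<gamma>: "\<gamma> \<in> Lam n"
    obtain A where A: "A \<subseteq> D n" "finite A" "\<gamma> = walsh A" using LamE[OF \<gamma>] by metis
    show "fourier G \<gamma> = of_real (h \<gamma>)"
      unfolding h[OF \<gamma>] unfolding A(3) G(3)[OF A(2)] using A(1) by simp
  next
    fix m \<gamma> assume m: "m \<noteq> n" "\<gamma> \<in> Lam m"
    obtain A where A: "finite A" "\<gamma> = walsh A" "\<not> A \<subseteq> D n" using LamE[OF m(2)] m(1) by metis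
    show "fourier G \<gamma> = 0" unfolding A(2) G(3)[OF A(1)] using A(3) by simp
  qed
qed

lemma realizes_const: "realizes n \<bar>t\<bar> (\<lambda>_. t)"
proof (rule realizes_combination)
  have fin: "finite (Pow (D n))" using finD by simp
  have e: "(\<Sum>X\<in>Pow (D n). if X = {} then y else 0) = y" for y :: real
    using sum.delta[OF fin, of "{}" "\<lambda>_. y"] by simp
  have "(\<Sum>X\<in>Pow (D n). \<bar>if X = {} then t else 0\<bar>) = (\<Sum>X\<in>Pow (D n). if X = {} then \<bar>t\<bar> else 0)"
    by (rule sum.cong) auto
  then show "(\<Sum>X\<in>Pow (D n). \<bar>if X = {} then t else 0\<bar>) \<le> \<bar>t\<bar>" unfolding e by simp
  fix \<gamma> assume \<gamma>: "\<gamma> \<in> Lam n"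
  have "\<gamma> (ind {}) = 1" using Lam_walsh[OF \<gamma>] by (auto simp: walsh_def ind_def)
  then have "(\<Sum>X\<in>Pow (D n). (if X = {} then t else 0) * Re (\<gamma> (ind X))) = (\<Sum>X\<in>Pow (D n). if X = {} then t else 0)"
    by (intro sum.cong) auto
  then show "t = (\<Sum>X\<in>Pow (D n). (if X = {} then t else 0) * Re (\<gamma> (ind X)))" unfolding e by simp
qed

text \<open>The constant costs |t|, and the indicator of \<open>E\<close>, as transform of the sum
  of its characters, at most \<open>card E\<close>. This crude bound suffices because the jump
  \<open>d\<close> can be made small after the block has been fixed.\<close>

lemma realizes_affine_indicator:
  fixes t d :: real
  assumes E: "E \<subseteq> Lam n"
  shows "realizes n (\<bar>t\<bar> + \<bar>d\<bar> * card E) (\<lambda>\<gamma>. if \<gamma> \<in> E then t + d else t)"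
proof -
  obtain G where G: "integrable \<mu> G" "(\<integral>x. cmod (G x) \<partial>\<mu>) \<le> \<bar>t\<bar>"
     "\<forall>\<gamma>\<in>Lam n. fourier G \<gamma> = of_real t" "\<forall>m \<gamma>. m \<noteq> n \<longrightarrow> \<gamma> \<in> Lam m \<longrightarrow> fourier G \<gamma> = 0"
    by (rule realizesE[OF realizes_const])
  have finE: "finite E" using finite_subset[OF E finLam] .
  define P where "P x = (\<Sum>\<gamma>\<in>E. \<gamma> x)" for x
  have Ei: "integrable \<mu> \<gamma>" if "\<gamma> \<in> E" for \<gamma>
    using that E Lam_walsh integrable_walsh by (metis subsetD)
  have Pi: "integrable \<mu> P" unfolding P_def by (intro Bochner_Integration.integrable_sum Ei)
  have Pb: "cmod (P x) \<le> card E" for x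
    unfolding P_def
  proof (intro order_trans[OF norm_sum] order_trans[OF sum_bounded_above[where K = 1]])
    fix \<gamma> assume "\<gamma> \<in> E"
    then obtain A where "\<gamma> = walsh A" using E Lam_walsh by blast
    then show "cmod (\<gamma> x) \<le> 1" by simp
  qed simp
  let ?H = "\<lambda>x. G x + of_real d * P x"
  have fH: "fourier ?H (walsh A) = fourier G (walsh A) + of_real d * (if walsh A \<in> E then 1 else 0)"
    if A: "finite A" for A
  proof -
    have "fourier ?H (walsh A) = (\<integral>x. G x * walsh A x + of_real d * (P x * walsh A x) \<partial>\<mu>)"
      unfolding fourier_walsh by (simp add: distrib_right mult.assoc)
    also have "\<dots> = (\<integral>x. G x * walsh A x \<partial>\<mu>) + (\<integral>x. of_real d * (P x * walsh A x) \<partial>\<mu>)"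
      by (intro Bochner_Integration.integral_add integrable_mult_right integrable_mult_walsh G(1) Pi)
    also have "(\<integral>x. of_real d * (P x * walsh A x) \<partial>\<mu>) = of_real d * (\<integral>x. (\<Sum>\<gamma>\<in>E. \<gamma> x * walsh A x) \<partial>\<mu>)"
      by (simp add: P_def sum_distrib_right)
    also have "(\<integral>x. (\<Sum>\<gamma>\<in>E. \<gamma> x * walsh A x) \<partial>\<mu>) = (\<Sum>\<gamma>\<in>E. \<integral>x. \<gamma> x * walsh A x \<partial>\<mu>)"
      by (intro Bochner_Integration.integral_sum integrable_mult_walsh Ei)
    also have "\<dots> = (\<Sum>\<gamma>\<in>E. if walsh A = \<gamma> then 1 else 0)"
    proof (rule sum.cong[OF refl])
      fix \<gamma> assume "\<gamma> \<in> E"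
      then have "\<gamma> \<in> Lam n" using E by blast
      then obtain B where B: "finite B" "\<gamma> = walsh B" using LamE by metis
      show "(\<integral>x. \<gamma> x * walsh A x \<partial>\<mu>) = (if walsh A = \<gamma> then 1 else 0)"
        unfolding B(2) walsh_orthogonal[OF B(1) A] using walsh_inj[OF A B(1)] by auto
    qed
    also have "\<dots> = (if walsh A \<in> E then 1 else 0)" using finE by simp
    finally show ?thesis unfolding fourier_walsh .
  qed
  show ?thesis
    unfolding realizes_def
  proof (intro exI[of _ ?H] conjI ballI allI impI)
    show "integrable \<mu> ?H" using G(1) Pi by auto
    have "(\<integral>x. cmod (?H x) \<partial>\<mu>) \<le> (\<integral>x. cmod (G x) + \<bar>d\<bar> * card E \<partial>\<mu>)"
    proof (rule integral_mono)
      show "integrable \<mu> (\<lambda>x. cmod (?H x))" using G(1) Pi by auto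
      show "integrable \<mu> (\<lambda>x. cmod (G x) + \<bar>d\<bar> * card E)" using G(1) by auto
      show "cmod (?H x) \<le> cmod (G x) + \<bar>d\<bar> * card E" for x
        using norm_triangle_ineq[of "G x" "of_real d * P x"] mult_left_mono[OF Pb[of x] abs_ge_zero[of d]]
        by (simp add: norm_mult)
    qed
    also have "\<dots> = (\<integral>x. cmod (G x) \<partial>\<mu>) + \<bar>d\<bar> * card E" using G(1) \<mu>.prob_space by simp
    finally show "(\<integral>x. cmod (?H x) \<partial>\<mu>) \<le> \<bar>t\<bar> + \<bar>d\<bar> * card E" using G(2) by linarith
  next
    fix \<gamma> assume \<gamma>: "\<gamma> \<in> Lam n"
    obtain A where A: "finite A" "\<gamma> = walsh A" using LamE[OF \<gamma>] by metis
    show "fourier ?H \<gamma> = of_real (if \<gamma> \<in> E then t + d else t)"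
      using fH[OF A(1)] bspec[OF G(3) \<gamma>] unfolding A(2) by simp
  next
    fix m \<gamma> assume m: "m \<noteq> n" "\<gamma> \<in> Lam m"
    obtain A where A: "finite A" "\<gamma> = walsh A" "\<not> A \<subseteq> D n" using LamE[OF m(2)] m(1) by metis
    have "\<gamma> \<notin> E"
    proof
      assume "\<gamma> \<in> E"
      then have "\<gamma> \<in> Lam n" using E by blast
      then obtain B where "B \<subseteq> D n" "finite B" "\<gamma> = walsh B" using LamE by metis
      then show False using A walsh_inj by metis
    qed
    then show "fourier ?H \<gamma> = 0" using fH[OF A(1)] G(4)[rule_format, OF m] unfolding A(2) by simp
  qed
qed

text \<open>This is f_n; for \<open>n \<ge> 1\<close>, \<open>osc (J n) \<gamma>\<close> is
  \<open>cis (- (n * phase n \<gamma>))\<close>.\<close>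

definition phase :: "nat \<Rightarrow> (cantor_group \<Rightarrow> complex) \<Rightarrow> real" where
  "phase n \<gamma> = (\<Sum>j\<in>J n. Re (\<gamma> (ind {j}))) / n"

text \<open>Expanding the product of the factors cis (e_j / n) over the subsets \<open>X\<close> of
  \<open>J n\<close> gives a combination of values at \<open>ind X\<close> whose total weight is at
  most (cos (1/n) + sin (1/n))^n \<le> e < 3 times \<open>\<sigma>\<close>, uniformly in
  \<open>n\<close> and \<open>s\<close>.\<close>

lemma realizes_cos:
  assumes n: "n \<ge> 1" and \<sigma>: "0 \<le> \<sigma>"
  shows "realizes n (3 * \<sigma>) (\<lambda>\<gamma>. \<sigma> * cos (s + phase n \<gamma>))"
proof (rule realizes_combination)
  define z where "z X = complex_of_real (cos (1 / n)) ^ card (J n - X) * (\<i> * of_real (sin (1 / n))) ^ card X" for X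
  define a where "a X = (if X \<subseteq> J n then \<sigma> * Re (cis s * z X) else 0)" for X
  have res: "(\<Sum>X\<in>Pow (D n). if X \<subseteq> J n then f X else 0) = (\<Sum>X\<in>Pow (J n). f X)" for f :: "nat set \<Rightarrow> real"
  proof -
    have "(\<Sum>X\<in>Pow (D n). if X \<subseteq> J n then f X else 0) = sum f {X \<in> Pow (D n). X \<subseteq> J n}"
      using finD by (intro sum.inter_filter[symmetric]) simp
    also have "{X \<in> Pow (D n). X \<subseteq> J n} = Pow (J n)" using J(1)[of n] by blast
    finally show ?thesis .
  qed
  have n0: "0 < 1 / real n" "1 / real n \<le> 1" using n by auto
  have pi: "3 < pi" using pi_approx by auto
  have cs: "0 \<le> cos (1 / real n)" "0 \<le> sin (1 / real n)" "sin (1 / real n) \<le> 1 / n"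
    by (rule cos_ge_zero sin_ge_zero sin_x_le_x; use n0 pi in linarith)+
  have "(\<Sum>X\<in>Pow (D n). \<bar>a X\<bar>) = (\<Sum>X\<in>Pow (D n). if X \<subseteq> J n then \<bar>\<sigma> * Re (cis s * z X)\<bar> else 0)"
    by (rule sum.cong) (auto simp: a_def)
  also have "\<dots> = (\<Sum>X\<in>Pow (J n). \<bar>\<sigma> * Re (cis s * z X)\<bar>)" by (rule res)
  also have "\<dots> \<le> (\<Sum>X\<in>Pow (J n). \<sigma> * (sin (1 / n) ^ card X * cos (1 / n) ^ card (J n - X)))"
  proof (rule sum_mono)
    fix X
    have "\<bar>Re (cis s * z X)\<bar> \<le> cmod (cis s * z X)" by (rule abs_Re_le_cmod)
    also have "\<dots> = sin (1 / n) ^ card X * cos (1 / n) ^ card (J n - X)"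
      using cs by (simp add: z_def norm_mult norm_power mult.commute)
    finally show "\<bar>\<sigma> * Re (cis s * z X)\<bar> \<le> \<sigma> * (sin (1 / n) ^ card X * cos (1 / n) ^ card (J n - X))"
      using \<sigma> by (simp add: abs_mult mult_left_mono)
  qed
  also have "\<dots> = \<sigma> * (sin (1 / n) + cos (1 / n)) ^ n"
    using prod_add[OF finJ[of n], of "\<lambda>_. sin (1 / real n)" "\<lambda>_. cos (1 / real n)"]
    by (simp add: J(2) sum_distrib_left)
  also have "\<dots> \<le> \<sigma> * exp 1"
  proof (rule mult_left_mono[OF _ \<sigma>])
    have "(sin (1 / n) + cos (1 / n)) ^ n \<le> (1 / n + 1) ^ n"
      using cs by (intro power_mono add_mono) auto
    also have "\<dots> \<le> exp (1 / n) ^ n" using exp_ge_add_one_self[of "1 / n"] by (intro power_mono) (auto simp: add.commute)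
    also have "\<dots> = exp 1" using n by (simp add: exp_of_nat_mult[symmetric])
    finally show "(sin (1 / real n) + cos (1 / real n)) ^ n \<le> exp 1" .
  qed
  also have "\<dots> \<le> 3 * \<sigma>" using exp_le mult_right_mono[of "exp 1" 3 \<sigma>] \<sigma> by (simp add: mult.commute)
  finally show "(\<Sum>X\<in>Pow (D n). \<bar>a X\<bar>) \<le> 3 * \<sigma>" .
  fix \<gamma> assume \<gamma>: "\<gamma> \<in> Lam n"
  obtain A where A: "A \<subseteq> D n" "finite A" "\<gamma> = walsh A" using LamE[OF \<gamma>] by metis
  define e where "e j = Re (\<gamma> (ind {j}))" for j
  have e: "e j = 1 \<or> e j = - 1" for j
    using walsh_cases[of A "ind {j}"] unfolding e_def A(3) by auto
  have "cis (phase n \<gamma>) = (\<Prod>j\<in>J n. cis (e j / n))"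
  proof -
    have "phase n \<gamma> = (\<Sum>j\<in>J n. e j / n)" by (simp add: phase_def e_def sum_divide_distrib)
    then show ?thesis using cis_sum[OF finJ] by simp
  qed
  \<comment> \<open>Because \<open>e j\<close> is 1 or -1, the exponential is an affine function of
    \<open>e j\<close>.\<close>
  also have "\<dots> = (\<Prod>j\<in>J n. \<i> * of_real (sin (1 / n)) * of_real (e j) + of_real (cos (1 / n)))"
  proof (rule prod.cong[OF refl])
    show "cis (e j / n) = \<i> * of_real (sin (1 / n)) * of_real (e j) + of_real (cos (1 / n))" for j
      using e[of j] by (auto simp: complex_eq_iff)
  qed
  also have "\<dots> = (\<Sum>X\<in>Pow (J n). (\<Prod>j\<in>X. \<i> * of_real (sin (1 / n)) * of_real (e j)) * (\<Prod>j\<in>J n - X. of_real (cos (1 / n))))"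
    by (rule prod_add[OF finJ])
  also have "\<dots> = (\<Sum>X\<in>Pow (J n). z X * of_real (Re (\<gamma> (ind X))))"
  proof (rule sum.cong[OF refl])
    fix X assume "X \<in> Pow (J n)"
    then have X: "X \<subseteq> D n" "finite X" using J(1)[of n] finite_subset[OF _ finJ[of n]] by auto
    have "of_real (Re (\<gamma> (ind X))) = \<gamma> (ind X)" unfolding A(3) by simp
    also have "\<dots> = (\<Prod>j\<in>X. \<gamma> (ind {j}))" unfolding A(3) by (rule walsh_ind[OF A(2) X(2)])
    also have "\<dots> = (\<Prod>j\<in>X. of_real (e j))" unfolding e_def A(3) by simp
    finally have 1: "of_real (Re (\<gamma> (ind X))) = (\<Prod>j\<in>X. complex_of_real (e j))" .
    show "(\<Prod>j\<in>X. \<i> * of_real (sin (1 / n)) * of_real (e j)) * (\<Prod>j\<in>J n - X. of_real (cos (1 / n))) = z X * of_real (Re (\<gamma> (ind X)))"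
      unfolding 1 by (simp add: z_def prod.distrib power_mult_distrib del: of_real_prod)
  qed
  finally have c: "cis (phase n \<gamma>) = (\<Sum>X\<in>Pow (J n). z X * of_real (Re (\<gamma> (ind X))))" .
  have "\<sigma> * cos (s + phase n \<gamma>) = \<sigma> * Re (cis s * cis (phase n \<gamma>))" by (simp add: cis_mult)
  also have "\<dots> = (\<Sum>X\<in>Pow (J n). \<sigma> * Re (cis s * z X) * Re (\<gamma> (ind X)))"
  proof -
    have "cis s * cis (phase n \<gamma>) = (\<Sum>X\<in>Pow (J n). (cis s * z X) * of_real (Re (\<gamma> (ind X))))"
      unfolding c sum_distrib_left by (simp add: mult.assoc)
    then show ?thesis by (simp add: sum_distrib_left left_diff_distrib mult.assoc)
  qed
  also have "\<dots> = (\<Sum>X\<in>Pow (D n). if X \<subseteq> J n then \<sigma> * Re (cis s * z X) * Re (\<gamma> (ind X)) else 0)"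
    by (rule res[symmetric])
  also have "\<dots> = (\<Sum>X\<in>Pow (D n). a X * Re (\<gamma> (ind X)))"
    by (rule sum.cong) (auto simp: a_def)
  finally show "\<sigma> * cos (s + phase n \<gamma>) = (\<Sum>X\<in>Pow (D n). a X * Re (\<gamma> (ind X)))" .
qed

lemma cmod_sum_osc_fourier_le:
  assumes "integrable \<mu> G" "(\<integral>x. cmod (G x) \<partial>\<mu>) \<le> K"
  shows "cmod (\<Sum>\<gamma>\<in>Lam n. osc (J n) \<gamma> * fourier G \<gamma>) \<le> 6 * sin 1 ^ n * card (Lam n) * K"
proof -
  have "Lam n \<subseteq> range walsh" using Lam by blast
  then have "cmod (\<Sum>\<gamma>\<in>Lam n. osc (J n) \<gamma> * fourier G \<gamma>) \<le> 6 * sin 1 ^ n * card (Lam n) * (\<integral>x. cmod (G x) \<partial>\<mu>)"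
    by (rule fourier_sum_bound[OF assms(1) finLam _ osc])
  also have "\<dots> \<le> 6 * sin 1 ^ n * card (Lam n) * K"
    using assms(2) sin_one_bounds by (intro mult_left_mono) auto
  finally show ?thesis .
qed

text \<open>Gluing: if no block admitted a uniform bound, counterexamples living on different blocks with
  summable norms would add up to a single function in \<open>A(\<Lambda>)\<close> on which \<open>F\<close> fails to operate.\<close>

lemma operates_uniform_bound:
  assumes F: "operates F I (\<Union>n. Lam n)" and I: "open I" "0 \<in> I"
  obtains \<delta> K n0 where "0 < \<delta>" "{- \<delta>..\<delta>} \<subseteq> I"
    "\<forall>n h. n0 \<le> n \<longrightarrow> realizes n \<delta> h \<longrightarrow>
       (\<exists>G. integrable \<mu> G \<and> (\<integral>x. cmod (G x) \<partial>\<mu>) \<le> real K \<and> (\<forall>\<gamma>\<in>Lam n. fourier G \<gamma> = F (h \<gamma>)))"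
proof -
  obtain \<delta>0 where \<delta>0: "0 < \<delta>0" "cball 0 \<delta>0 \<subseteq> I" using I open_contains_cball by blast
  then have sub: "{- \<delta>0..\<delta>0} \<subseteq> I" by (simp add: cball_eq_atLeastAtMost)
  let ?ok = "\<lambda>n K h. \<exists>G. integrable \<mu> G \<and> (\<integral>x. cmod (G x) \<partial>\<mu>) \<le> real K \<and> (\<forall>\<gamma>\<in>Lam n. fourier G \<gamma> = F (h \<gamma>))"
  \<comment> \<open>The single parameter \<open>N\<close> is the starting index of the blocks, the
    exponent of the radius and the norm bound, so that failure for all \<open>N\<close> yields one
    sequence of ever worse counterexamples.\<close>
  have "\<exists>N. \<forall>n h. N \<le> n \<longrightarrow> realizes n (\<delta>0 * (1 / 2) ^ N) h \<longrightarrow> ?ok n N h"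
  proof (rule ccontr)
    assume "\<not> ?thesis"
    then have "\<forall>N. \<exists>n h. N \<le> n \<and> realizes n (\<delta>0 * (1 / 2) ^ N) h \<and> \<not> ?ok n N h" by blast
    then obtain \<nu> h where \<nu>: "\<And>N. N \<le> \<nu> N" and h: "\<And>N. realizes (\<nu> N) (\<delta>0 * (1 / 2) ^ N) (h N)"
      and bad: "\<And>N. \<not> ?ok (\<nu> N) N (h N)" by metis
    \<comment> \<open>The recursion makes the blocks \<open>\<nu> (M j)\<close> strictly increasing,
      hence distinct, while \<open>M j \<ge> j\<close> keeps the norms summable and the violated
      bounds unbounded.\<close>
    define M where "M = rec_nat 0 (\<lambda>_ N. Suc (\<nu> N))"
    have M: "M 0 = 0" "M (Suc j) = Suc (\<nu> (M j))" for j by (simp_all add: M_def)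
    have "strict_mono (\<lambda>j. \<nu> (M j))"
      unfolding strict_mono_Suc_iff using \<nu> M(2) by (metis Suc_le_eq)
    then have inj: "\<nu> (M i) = \<nu> (M j) \<longleftrightarrow> i = j" for i j by (rule strict_mono_eq)
    have Mj: "j \<le> M j" for j
    proof (induction j)
      case (Suc j)
      then show ?case using \<nu>[of "M j"] M(2)[of j] by simp
    qed simp
    have "\<forall>j. \<exists>G. integrable \<mu> G \<and> (\<integral>x. cmod (G x) \<partial>\<mu>) \<le> \<delta>0 * (1 / 2) ^ M j \<and>
       (\<forall>\<gamma>\<in>Lam (\<nu> (M j)). fourier G \<gamma> = of_real (h (M j) \<gamma>)) \<and>
       (\<forall>m \<gamma>. m \<noteq> \<nu> (M j) \<longrightarrow> \<gamma> \<in> Lam m \<longrightarrow> fourier G \<gamma> = 0)"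
      using h unfolding realizes_def by blast
    then obtain G where G: "\<And>j. integrable \<mu> (G j)" "\<And>j. (\<integral>x. cmod (G j x) \<partial>\<mu>) \<le> \<delta>0 * (1 / 2) ^ M j"
      "\<And>j. \<forall>\<gamma>\<in>Lam (\<nu> (M j)). fourier (G j) \<gamma> = of_real (h (M j) \<gamma>)"
      "\<And>j. \<forall>m \<gamma>. m \<noteq> \<nu> (M j) \<longrightarrow> \<gamma> \<in> Lam m \<longrightarrow> fourier (G j) \<gamma> = 0" by metis
    have le: "\<delta>0 * (1 / 2) ^ M j \<le> \<delta>0 * (1 / 2) ^ j" for j
      using \<delta>0 Mj by (intro mult_left_mono power_decreasing) auto
    have summ: "summable (\<lambda>j. \<integral>x. cmod (G j x) \<partial>\<mu>)"
    proof (rule summable_comparison_test')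
      show "summable (\<lambda>j. \<delta>0 * (1 / 2) ^ j)" by (intro summable_mult summable_geometric) simp
      show "norm (\<integral>x. cmod (G j x) \<partial>\<mu>) \<le> \<delta>0 * (1 / 2) ^ j" for j
        using G(2)[of j] le[of j] by simp
    qed
    have "\<exists>H. integrable \<mu> H \<and> (\<forall>A. (\<lambda>j. fourier (G j) (walsh A)) sums fourier H (walsh A))"
      by (rule fourier_suminf[OF G(1) summ]) blast
    then obtain H where H: "integrable \<mu> H" "\<And>A. (\<lambda>j. fourier (G j) (walsh A)) sums fourier H (walsh A)"
      by blast
    have Hj: "fourier H \<gamma> = of_real (h (M j) \<gamma>)" if \<gamma>: "\<gamma> \<in> Lam (\<nu> (M j))" for j \<gamma>
    proof -
      have "fourier (G i) \<gamma> = (if i = j then of_real (h (M j) \<gamma>) else 0)" for i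
        using G(3,4)[of i] \<gamma> inj[of i j] by (metis (no_types, lifting))
      then have "(\<lambda>i. fourier (G i) \<gamma>) sums of_real (h (M j) \<gamma>)"
        using sums_single[of j "\<lambda>_. complex_of_real (h (M j) \<gamma>)"] by simp
      moreover obtain A where "\<gamma> = walsh A" using Lam_walsh[OF \<gamma>] by blast
      ultimately show ?thesis using H(2)[of A] sums_unique2 by blast
    qed
    have H0: "fourier H \<gamma> = 0" if \<gamma>: "\<gamma> \<in> Lam m" and m: "\<And>j. m \<noteq> \<nu> (M j)" for m \<gamma>
    proof -
      have "fourier (G i) \<gamma> = 0" for i using G(4)[of i] \<gamma> m by blast
      then have "(\<lambda>i. fourier (G i) \<gamma>) sums 0" by simp
      moreover obtain A where "\<gamma> = walsh A" using Lam_walsh[OF \<gamma>] by blast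
      ultimately show ?thesis using H(2)[of A] sums_unique2 by blast
    qed
    let ?\<Lambda> = "\<Union>n. Lam n"
    have "restrict (fourier H) ?\<Lambda> \<in> A_on ?\<Lambda>"
      unfolding A_on_def A_dual_def using H(1) by blast
    moreover have "restrict (fourier H) ?\<Lambda> \<gamma> \<in> complex_of_real ` I" if \<gamma>: "\<gamma> \<in> ?\<Lambda>" for \<gamma>
    proof -
      obtain m where m: "\<gamma> \<in> Lam m" using \<gamma> by blast
      have "\<exists>t. fourier H \<gamma> = of_real t \<and> \<bar>t\<bar> \<le> \<delta>0"
      proof (cases "\<exists>j. m = \<nu> (M j)")
        case True
        then obtain j where j: "m = \<nu> (M j)" by blast
        have "\<bar>h (M j) \<gamma>\<bar> \<le> \<delta>0 * (1 / 2) ^ M j"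
          using realizes_abs_le[OF h[of "M j"]] m j by blast
        also have "\<dots> \<le> \<delta>0 * 1" using \<delta>0 by (intro mult_left_mono) (auto simp: power_le_one)
        finally show ?thesis using Hj[of \<gamma> j] m j by (intro exI[of _ "h (M j) \<gamma>"]) simp
      next
        case False
        then show ?thesis using H0[OF m] \<delta>0 by (intro exI[of _ 0]) auto
      qed
      then obtain t where "fourier H \<gamma> = of_real t" "\<bar>t\<bar> \<le> \<delta>0" by blast
      moreover from this(2) have "t \<in> {- \<delta>0..\<delta>0}" by auto
      then have "t \<in> I" using sub by blast
      ultimately show ?thesis using \<gamma> by auto
    qed
    ultimately have "(\<lambda>\<gamma>\<in>?\<Lambda>. F (Re (restrict (fourier H) ?\<Lambda> \<gamma>))) \<in> A_on ?\<Lambda>"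
      using F unfolding operates_def by blast
    then obtain G' where G': "integrable \<mu> G'"
      "(\<lambda>\<gamma>\<in>?\<Lambda>. F (Re (restrict (fourier H) ?\<Lambda> \<gamma>))) = restrict (fourier G') ?\<Lambda>"
      unfolding A_on_def A_dual_def by blast
    obtain j :: nat where j: "(\<integral>x. cmod (G' x) \<partial>\<mu>) \<le> real j" using real_arch_simple by blast
    have "fourier G' \<gamma> = F (h (M j) \<gamma>)" if "\<gamma> \<in> Lam (\<nu> (M j))" for \<gamma>
    proof -
      have "\<gamma> \<in> ?\<Lambda>" using that by blast
      then have "fourier G' \<gamma> = F (Re (fourier H \<gamma>))" using fun_cong[OF G'(2), of \<gamma>] by simp
      then show ?thesis using Hj[OF that] by simp
    qed
    moreover have "(\<integral>x. cmod (G' x) \<partial>\<mu>) \<le> real (M j)" using j Mj[of j] by linarith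
    ultimately show False using bad[of "M j"] G'(1) by blast
  qed
  then obtain N where N: "\<forall>n h. N \<le> n \<longrightarrow> realizes n (\<delta>0 * (1 / 2) ^ N) h \<longrightarrow> ?ok n N h" by blast
  show ?thesis
  proof (rule that[OF _ _ N])
    show "0 < \<delta>0 * (1 / 2) ^ N" using \<delta>0 by simp
    have "\<delta>0 * (1 / 2) ^ N \<le> \<delta>0 * 1" using \<delta>0 by (intro mult_left_mono) (auto simp: power_le_one)
    then show "{- (\<delta>0 * (1 / 2) ^ N)..\<delta>0 * (1 / 2) ^ N} \<subseteq> I" using sub by auto
  qed
qed

text \<open>At a discontinuity all indicators of subsets of a block would be bounded in \<open>A(\<Lambda>)\<close>, whereas the
  oscillating functional separates them.\<close>

lemma uniform_bound_imp_continuous: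
  fixes F :: "real \<Rightarrow> complex"
  assumes bound: "\<forall>n h. n0 \<le> n \<longrightarrow> realizes n \<delta> h \<longrightarrow>
       (\<exists>G. integrable \<mu> G \<and> (\<integral>x. cmod (G x) \<partial>\<mu>) \<le> real K \<and> (\<forall>\<gamma>\<in>Lam n. fourier G \<gamma> = F (h \<gamma>)))"
    and t0: "\<bar>t0\<bar> < \<delta>"
  shows "isCont F t0"
proof (rule ccontr)
  assume "\<not> isCont F t0"
  then obtain \<eta> where \<eta>: "0 < \<eta>" "\<And>d. 0 < d \<Longrightarrow> \<exists>t. \<bar>t - t0\<bar> < d \<and> \<eta> \<le> cmod (F t - F t0)"
    unfolding continuous_at_eps_delta by (metis dist_norm real_norm_def not_less)
  \<comment> \<open>48 = 4 * 12: the 12 comes from two pairings with constant 6, the 4 from passing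
    from subset sums to the sum of moduli.\<close>
  have "(\<lambda>n. 48 * real K / \<eta> * sin 1 ^ n) \<longlonglongrightarrow> 48 * real K / \<eta> * 0"
    using sin_one_bounds by (intro tendsto_mult_left LIMSEQ_power_zero) auto
  then have "eventually (\<lambda>n. 48 * real K / \<eta> * sin 1 ^ n < 1) sequentially"
    by (rule order_tendstoD(2)) simp
  then have "eventually (\<lambda>n. 48 * real K / \<eta> * sin 1 ^ n < 1 \<and> n0 + 1 \<le> n) sequentially"
    by (intro eventually_conj eventually_ge_at_top)
  then obtain n where n: "48 * real K / \<eta> * sin 1 ^ n < 1" "n0 + 1 \<le> n"
    unfolding eventually_sequentially by blast
  define N where "N = card (Lam n)"
  have N: "1 \<le> N" using cardLam[of n] n(2) unfolding N_def by linarith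
  have "0 < (\<delta> - \<bar>t0\<bar>) / N" using t0 N by simp
  \<comment> \<open>The point \<open>t\<close> depends on the block: the jump is so short that even
    the indicator of the whole block stays within norm \<open>\<delta>\<close>.\<close>
  then obtain t where t: "\<bar>t - t0\<bar> < (\<delta> - \<bar>t0\<bar>) / N" "\<eta> \<le> cmod (F t - F t0)" using \<eta>(2) by blast
  define b where "b = 12 * sin 1 ^ n * N * K / \<eta>"
  have sb: "cmod (\<Sum>\<gamma>\<in>E. osc (J n) \<gamma>) \<le> b" if E: "E \<subseteq> Lam n" for E
  proof -
    have r: "\<exists>G. integrable \<mu> G \<and> (\<integral>x. cmod (G x) \<partial>\<mu>) \<le> real K \<and>
        (\<forall>\<gamma>\<in>Lam n. fourier G \<gamma> = F (if \<gamma> \<in> E' then t0 + (t - t0) else t0))" if E': "E' \<subseteq> Lam n" for E'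
    proof -
      have "\<bar>t - t0\<bar> * card E' \<le> \<bar>t - t0\<bar> * N"
        unfolding N_def using card_mono[OF finLam E'] by (intro mult_left_mono) auto
      also have "\<dots> \<le> \<delta> - \<bar>t0\<bar>" using t(1) N by (simp add: pos_less_divide_eq)
      finally have "\<bar>t0\<bar> + \<bar>t - t0\<bar> * card E' \<le> \<delta>" by simp
      then have "realizes n \<delta> (\<lambda>\<gamma>. if \<gamma> \<in> E' then t0 + (t - t0) else t0)"
        by (rule realizes_mono[OF realizes_affine_indicator[OF E']])
      moreover have "n0 \<le> n" using n(2) by simp
      ultimately show ?thesis using bound by blast
    qed
    obtain G1 where G1: "integrable \<mu> G1" "(\<integral>x. cmod (G1 x) \<partial>\<mu>) \<le> real K"
      "\<forall>\<gamma>\<in>Lam n. fourier G1 \<gamma> = F (if \<gamma> \<in> E then t0 + (t - t0) else t0)" using r[OF E] by blast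
    obtain G2 where G2: "integrable \<mu> G2" "(\<integral>x. cmod (G2 x) \<partial>\<mu>) \<le> real K"
      "\<forall>\<gamma>\<in>Lam n. fourier G2 \<gamma> = F (if \<gamma> \<in> {} then t0 + (t - t0) else t0)" using r[of "{}"] by blast
    let ?T = "\<lambda>G. \<Sum>\<gamma>\<in>Lam n. osc (J n) \<gamma> * fourier G \<gamma>"
    have "?T G1 - ?T G2 = (\<Sum>\<gamma>\<in>Lam n. if \<gamma> \<in> E then osc (J n) \<gamma> * (F t - F t0) else 0)"
      unfolding sum_subtractf[symmetric] using G1(3) G2(3)
      by (intro sum.cong refl) (auto simp: algebra_simps)
    also have "\<dots> = (\<Sum>\<gamma>\<in>Lam n \<inter> E. osc (J n) \<gamma> * (F t - F t0))"
      by (rule sum.inter_restrict[OF finLam, symmetric])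
    also have "\<dots> = (\<Sum>\<gamma>\<in>E. osc (J n) \<gamma>) * (F t - F t0)"
      using E by (simp add: Int_absorb1 sum_distrib_right)
    finally have e: "(\<Sum>\<gamma>\<in>E. osc (J n) \<gamma>) * (F t - F t0) = ?T G1 - ?T G2" by simp
    have "cmod (\<Sum>\<gamma>\<in>E. osc (J n) \<gamma>) * \<eta> \<le> cmod (\<Sum>\<gamma>\<in>E. osc (J n) \<gamma>) * cmod (F t - F t0)"
      using t(2) by (intro mult_left_mono) auto
    also have "\<dots> = cmod (?T G1 - ?T G2)" unfolding norm_mult[symmetric] e by (rule refl)
    also have "\<dots> \<le> cmod (?T G1) + cmod (?T G2)" by (rule norm_triangle_ineq4)
    also have "\<dots> \<le> 6 * sin 1 ^ n * card (Lam n) * K + 6 * sin 1 ^ n * card (Lam n) * K"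
      by (intro add_mono cmod_sum_osc_fourier_le G1(1,2) G2(1,2))
    also have "\<dots> = 12 * sin 1 ^ n * N * K" by (simp add: N_def)
    finally show ?thesis using \<eta>(1) by (simp add: b_def pos_le_divide_eq)
  qed
  \<comment> \<open>All weights have modulus 1, so their moduli add up to \<open>N\<close>, which
    the small subset sums forbid.\<close>
  have "real N = (\<Sum>\<gamma>\<in>Lam n. cmod (osc (J n) \<gamma>))" by (simp add: N_def osc_def)
  also have "\<dots> \<le> 4 * b" by (rule sum_cmod_le_of_subset_sums[OF finLam sb])
  also have "\<dots> = N * (48 * real K / \<eta> * sin 1 ^ n)" by (simp add: b_def)
  also have "\<dots> < real N * 1" using n(1) N by (intro mult_strict_left_mono) auto
  finally show False by simp
qed

text \<open>Multiplying \<open>F(\<sigma> cos(s + phase))\<close> by \<open>cis (- n * s)\<close> and integrating over \<open>s\<close> turns the block function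
  into \<open>cis (n * phase)\<close> times a Fourier coefficient; \<open>osc\<close> cancels the phase.\<close>

lemma uniform_bound_imp_cos_coeff:
  fixes F :: "real \<Rightarrow> complex"
  assumes bound: "\<forall>n h. n0 \<le> n \<longrightarrow> realizes n (3 * \<sigma>) h \<longrightarrow>
       (\<exists>G. integrable \<mu> G \<and> (\<integral>x. cmod (G x) \<partial>\<mu>) \<le> real K \<and> (\<forall>\<gamma>\<in>Lam n. fourier G \<gamma> = F (h \<gamma>)))"
    and \<sigma>: "0 \<le> \<sigma>" and cont: "continuous_on {- \<sigma>..\<sigma>} F" and n: "n0 \<le> n" "1 \<le> n"
  shows "cmod (integral {0..2 * pi} (\<lambda>s. F (\<sigma> * cos s) * of_real (cos (real n * s)))) \<le> 12 * pi * K * sin 1 ^ n"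
proof -
  define N where "N = card (Lam n)"
  have N: "1 \<le> N" using cardLam[of n] n(2) unfolding N_def by linarith
  define g where "g s = F (\<sigma> * cos s)" for s
  have g: "continuous_on S g" for S
    unfolding g_def
  proof (rule continuous_on_compose2[OF cont])
    show "continuous_on S (\<lambda>s. \<sigma> * cos s)" by (intro continuous_intros)
    show "(\<lambda>s. \<sigma> * cos s) ` S \<subseteq> {- \<sigma>..\<sigma>}"
    proof (rule image_subsetI)
      fix s
      have "\<bar>\<sigma> * cos s\<bar> \<le> \<sigma> * 1" using \<sigma> by (simp add: abs_mult mult_left_le)
      then show "\<sigma> * cos s \<in> {- \<sigma>..\<sigma>}" by auto
    qed
  qed
  have gp: "g (s + 2 * pi) = g s" and gm: "g (- s) = g s" for s by (simp_all add: g_def)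
  define k where "k s = g s * cis (- (real n * s))" for s
  have kc: "continuous_on S k" for S unfolding k_def by (intro continuous_intros g)
  have kp: "k (s + 2 * pi) = k s" for s
  proof -
    have "cis (- (real n * (s + 2 * pi))) = cis (- (real n * s)) * cis (2 * pi * of_int (- int n))"
      unfolding cis_mult by (rule arg_cong[of _ _ cis]) (simp add: algebra_simps)
    also have "cis (2 * pi * of_int (- int n)) = 1" by (rule cis_multiple_2pi) simp
    finally show ?thesis unfolding k_def gp by simp
  qed
  define c where "c = integral {0..2 * pi} k"
  have ph: "\<bar>phase n \<gamma>\<bar> \<le> 2 * pi" if \<gamma>: "\<gamma> \<in> Lam n" for \<gamma>
  proof -
    obtain A where "\<gamma> = walsh A" using Lam_walsh[OF \<gamma>] by blast
    then have "\<bar>Re (\<gamma> x)\<bar> \<le> 1" for x using abs_Re_le_cmod[of "walsh A x"] by simp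
    then have "(\<Sum>j\<in>J n. \<bar>Re (\<gamma> (ind {j}))\<bar>) \<le> of_nat (card (J n)) * 1"
      by (intro sum_bounded_above) blast
    then have "\<bar>\<Sum>j\<in>J n. Re (\<gamma> (ind {j}))\<bar> \<le> real (card (J n))"
      using sum_abs[of "\<lambda>j. Re (\<gamma> (ind {j}))" "J n"] by linarith
    then have "\<bar>phase n \<gamma>\<bar> \<le> 1" using n(2) by (simp add: phase_def J(2))
    then show ?thesis using pi_ge_two by linarith
  qed
  \<comment> \<open>The integral of \<open>\<Phi>\<close> is evaluated in two ways: it is bounded
    pointwise through the dual norm, and it equals \<open>N * c\<close> because
    \<open>\<Phi>\<close> is a sum of \<open>N\<close> translates of the periodic
    \<open>k\<close>.\<close>
  define \<Phi> where "\<Phi> s = (\<Sum>\<gamma>\<in>Lam n. osc (J n) \<gamma> * g (s + phase n \<gamma>)) * cis (- (real n * s))" for s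
  have \<Phi>k: "\<Phi> s = (\<Sum>\<gamma>\<in>Lam n. k (s + phase n \<gamma>))" for s
    unfolding \<Phi>_def sum_distrib_right
  proof (rule sum.cong[OF refl])
    fix \<gamma>
    have "osc (J n) \<gamma> = cis (- (real n * phase n \<gamma>))" using n(2) by (simp add: osc_def phase_def)
    then have "osc (J n) \<gamma> * cis (- (real n * s)) = cis (- (real n * (s + phase n \<gamma>)))"
      by (simp add: cis_mult algebra_simps)
    then show "osc (J n) \<gamma> * g (s + phase n \<gamma>) * cis (- (real n * s)) = k (s + phase n \<gamma>)"
      unfolding k_def by (metis mult.assoc mult.commute)
  qed
  have ki: "(\<lambda>s. k (s + a)) integrable_on {0..2 * pi}" for a
    by (intro integrable_continuous_interval continuous_on_compose2[OF kc[of UNIV]] continuous_intros) simp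
  have "integral {0..2 * pi} \<Phi> = (\<Sum>\<gamma>\<in>Lam n. integral {0..2 * pi} (\<lambda>s. k (s + phase n \<gamma>)))"
    unfolding \<Phi>k by (rule Henstock_Kurzweil_Integration.integral_sum[OF finLam ki])
  also have "\<dots> = (\<Sum>\<gamma>\<in>Lam n. c)"
    unfolding c_def by (intro sum.cong refl integral_periodic_shift kc kp ph)
  finally have \<Phi>c: "integral {0..2 * pi} \<Phi> = of_nat N * c" by (simp add: N_def)
  have \<Phi>b: "cmod (\<Phi> s) \<le> 6 * sin 1 ^ n * N * K" for s
  proof -
    have "realizes n (3 * \<sigma>) (\<lambda>\<gamma>. \<sigma> * cos (s + phase n \<gamma>))" by (rule realizes_cos[OF n(2) \<sigma>])
    then obtain G where G: "integrable \<mu> G" "(\<integral>x. cmod (G x) \<partial>\<mu>) \<le> real K"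
      "\<forall>\<gamma>\<in>Lam n. fourier G \<gamma> = F (\<sigma> * cos (s + phase n \<gamma>))" using bound n(1) by blast
    have "(\<Sum>\<gamma>\<in>Lam n. osc (J n) \<gamma> * g (s + phase n \<gamma>)) = (\<Sum>\<gamma>\<in>Lam n. osc (J n) \<gamma> * fourier G \<gamma>)"
      using G(3) by (intro sum.cong) (auto simp: g_def)
    then have "cmod (\<Phi> s) = cmod (\<Sum>\<gamma>\<in>Lam n. osc (J n) \<gamma> * fourier G \<gamma>)"
      unfolding \<Phi>_def norm_mult by simp
    then show ?thesis using cmod_sum_osc_fourier_le[OF G(1,2), of n] by (simp add: N_def)
  qed
  have \<Phi>i: "\<Phi> integrable_on {0..2 * pi}"
    unfolding \<Phi>k[abs_def] by (intro integrable_sum finLam ki)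
  have "cmod (integral {0..2 * pi} \<Phi>) \<le> integral {0..2 * pi} (\<lambda>_. 6 * sin 1 ^ n * N * K)"
    using \<Phi>b by (intro Henstock_Kurzweil_Integration.integral_norm_bound_integral \<Phi>i) auto
  also have "\<dots> = N * (12 * pi * K * sin 1 ^ n)" using pi_ge_zero by (simp add: mult_ac)
  finally have "N * cmod c \<le> N * (12 * pi * K * sin 1 ^ n)" unfolding \<Phi>c by (simp add: norm_mult)
  then have cb: "cmod c \<le> 12 * pi * K * sin 1 ^ n" using N by simp
  \<comment> \<open>As \<open>g\<close> is even, the coefficients at the frequencies n and -n agree,
    so the cosine coefficient is again \<open>c\<close>.\<close>
  have refl_k: "integral {0..2 * pi} (\<lambda>s. k (- s)) = c"
  proof -
    have "integral {0..2 * pi} (\<lambda>s. k (- s)) = integral {- 2 * pi..0} k"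
      using Henstock_Kurzweil_Integration.integral_reflect_real[of 0 "- 2 * pi" k] by simp
    also have "\<dots> = integral {0..2 * pi} (\<lambda>s. k (s + - 2 * pi))"
      using integral_shift[of 0 "- 2 * pi" "2 * pi" k] kc by (simp add: o_def)
    also have "\<dots> = c" unfolding c_def
      using integral_periodic_shift[where h = k and a = "- 2 * pi", OF kc kp] by simp
    finally show ?thesis .
  qed
  have "F (\<sigma> * cos s) * of_real (cos (real n * s)) = (k s + k (- s)) / 2" for s
    unfolding k_def gm by (simp add: g_def cis.code complex_eq_iff)
  then have "integral {0..2 * pi} (\<lambda>s. F (\<sigma> * cos s) * of_real (cos (real n * s))) =
      integral {0..2 * pi} (\<lambda>s. (k s + k (- s)) / 2)" by (rule arg_cong[OF ext])
  also have "\<dots> = (c + c) / 2"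
  proof -
    have i1: "k integrable_on {0..2 * pi}" using ki[of 0] by simp
    have i2: "(\<lambda>s. k (- s)) integrable_on {0..2 * pi}"
      by (intro integrable_continuous_interval continuous_on_compose2[OF kc[of UNIV]] continuous_intros) simp
    have "((\<lambda>s. (k s + k (- s)) / 2) has_integral (c + c) / 2) {0..2 * pi}"
      using integrable_integral[OF i1] integrable_integral[OF i2] unfolding refl_k c_def[symmetric]
      by (intro has_integral_divide has_integral_add)
    then show ?thesis by (rule integral_unique)
  qed
  finally show ?thesis using cb by simp
qed

lemma set_of_analyticity_UN_Lam: "set_of_analyticity (\<Union>n. Lam n)"
  unfolding set_of_analyticity_def
proof (intro allI impI)
  let ?\<Lambda> = "\<Union>n. Lam n"
  fix I F assume "open I \<and> is_interval I \<and> 0 \<in> I \<and> operates F I ?\<Lambda>"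
  then have I: "open I" "0 \<in> I" and F: "operates F I ?\<Lambda>" by auto
  \<comment> \<open>\<open>F\<close> turns the zero function into the constant \<open>F 0\<close> on
    \<open>?\<Lambda>\<close>, and arbitrarily large blocks leave no room for a nonzero
    constant.\<close>
  have "F 0 = 0"
  proof -
    have "restrict (fourier (\<lambda>_. 0)) ?\<Lambda> \<in> A_on ?\<Lambda>"
      unfolding A_on_def A_dual_def using integrable_zero by blast
    moreover have z: "restrict (fourier (\<lambda>_. 0)) ?\<Lambda> \<gamma> = 0" if "\<gamma> \<in> ?\<Lambda>" for \<gamma>
    proof -
      obtain A where "\<gamma> = walsh A" using \<open>\<gamma> \<in> ?\<Lambda>\<close> Lam_walsh by blast
      then show ?thesis using that by (simp add: fourier_walsh)
    qed
    then have "\<forall>\<gamma>\<in>?\<Lambda>. restrict (fourier (\<lambda>_. 0)) ?\<Lambda> \<gamma> \<in> complex_of_real ` I" using I(2) by force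
    ultimately have "(\<lambda>\<gamma>\<in>?\<Lambda>. F (Re (restrict (fourier (\<lambda>_. 0)) ?\<Lambda> \<gamma>))) \<in> A_on ?\<Lambda>"
      using F unfolding operates_def by blast
    then obtain G where G: "integrable \<mu> G"
      "(\<lambda>\<gamma>\<in>?\<Lambda>. F (Re (restrict (fourier (\<lambda>_. 0)) ?\<Lambda> \<gamma>))) = restrict (fourier G) ?\<Lambda>"
      unfolding A_on_def A_dual_def by blast
    have FG: "fourier G \<gamma> = F 0" if "\<gamma> \<in> ?\<Lambda>" for \<gamma>
      using fun_cong[OF G(2), of \<gamma>] z[OF that] that by simp
    show ?thesis
    proof (rule fourier_const_eq_0[OF G(1)])
      fix n
      have "Lam n \<subseteq> walsh ` {A. finite A}"
        using Lam[of n] finD[of n] finite_subset by blast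
      then show "\<exists>S. finite S \<and> S \<subseteq> walsh ` {A. finite A} \<and> n \<le> card S \<and> (\<forall>\<gamma>\<in>S. fourier G \<gamma> = F 0)"
        using finLam[of n] cardLam[of n] FG by blast
    qed
  qed
  moreover have "\<exists>U. open U \<and> 0 \<in> U \<and> U \<subseteq> I \<and> (\<forall>x\<in>U. real_analytic_at F x)"
  proof -
    obtain \<delta> K n0 where \<delta>: "0 < \<delta>" "{- \<delta>..\<delta>} \<subseteq> I" and bound: "\<forall>n h. n0 \<le> n \<longrightarrow> realizes n \<delta> h \<longrightarrow>
       (\<exists>G. integrable \<mu> G \<and> (\<integral>x. cmod (G x) \<partial>\<mu>) \<le> real K \<and> (\<forall>\<gamma>\<in>Lam n. fourier G \<gamma> = F (h \<gamma>)))"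
      by (rule operates_uniform_bound[OF F I])
    \<comment> \<open>The factor 3 is the norm bound of \<open>realizes_cos\<close>: the functions
      \<open>\<sigma> * cos (s + phase n \<gamma>)\<close> then stay within radius
      \<open>\<delta>\<close>.\<close>
    define \<sigma> where "\<sigma> = \<delta> / 3"
    have \<sigma>: "0 < \<sigma>" "\<sigma> < \<delta>" "3 * \<sigma> = \<delta>" using \<delta>(1) by (auto simp: \<sigma>_def)
    have cont: "continuous_on {- \<sigma>..\<sigma>} F"
    proof (rule continuous_at_imp_continuous_on, rule ballI)
      fix t assume "t \<in> {- \<sigma>..\<sigma>}"
      then have "\<bar>t\<bar> < \<delta>" using \<sigma>(2) by auto
      then show "isCont F t" by (rule uniform_bound_imp_continuous[OF bound])
    qed
    have "real_analytic_at F x" if x: "x \<in> {- \<sigma><..<\<sigma>}" for x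
    proof (rule real_analytic_at_scale[OF _ \<sigma>(1)])
      show "real_analytic_at (\<lambda>x. F (\<sigma> * x)) (x / \<sigma>)"
      proof (rule real_analytic_at_if_cos_coeffs[where \<rho> = "sin 1" and C = "12 * pi * K"])
        show "continuous_on {- 1..1} (\<lambda>x. F (\<sigma> * x))"
        proof (rule continuous_on_compose2[OF cont])
          show "continuous_on {- 1..1} (\<lambda>x. \<sigma> * x)" by (intro continuous_intros)
          have "\<bar>\<sigma> * y\<bar> \<le> \<sigma>" if "y \<in> {- 1..1}" for y
            using that \<sigma>(1) by (simp add: abs_mult mult_left_le abs_le_iff)
          then show "(\<lambda>x. \<sigma> * x) ` {- 1..1} \<subseteq> {- \<sigma>..\<sigma>}" by force
        qed
        show "0 < sin (1 :: real)" "sin (1 :: real) < 1" using sin_one_bounds by auto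
        \<comment> \<open>The threshold is one more than \<open>n0\<close> because the phase is a
          mean over \<open>n\<close> coordinates and needs \<open>n \<ge> 1\<close>.\<close>
        show "cmod (integral {0..2 * pi} (\<lambda>s. F (\<sigma> * cos s) * of_real (cos (real n * s)))) \<le> 12 * pi * K * sin 1 ^ n"
          if "n0 + 1 \<le> n" for n
          using that \<sigma>(1) bound unfolding \<sigma>(3)[symmetric] by (intro uniform_bound_imp_cos_coeff cont) auto
        show "\<bar>x / \<sigma>\<bar> < 1" using x \<sigma>(1) by auto
      qed
    qed
    moreover have "{- \<sigma><..<\<sigma>} \<subseteq> I" using \<delta>(2) \<sigma>(2) by auto
    ultimately show ?thesis using \<sigma>(1) by (intro exI[of _ "{- \<sigma><..<\<sigma>}"]) auto
  qed
  ultimately show "F 0 = 0 \<and> (\<exists>U. open U \<and> 0 \<in> U \<and> U \<subseteq> I \<and> (\<forall>x\<in>U. real_analytic_at F x))" by blast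
qed

end

text \<open>Finiteness is asserted apart from the bound because \<open>card\<close> is 0 on infinite
  sets.\<close>

theorem mainTheorem4:
  fixes w :: "real \<Rightarrow> real"
  assumes "mono_on {1..} w"
    and "\<And>x. x \<ge> 1 \<Longrightarrow> w x \<ge> 1"
    and "filterlim w at_top at_top"
  shows "\<exists>\<Lambda> \<subseteq> (dual_group :: (cantor_group \<Rightarrow> complex) set).
    set_of_analyticity \<Lambda> \<and>
    (\<forall>k M. k \<ge> 1 \<and> is_mesh k M \<longrightarrow>
      finite (\<Lambda> \<inter> M) \<and> real (card (\<Lambda> \<inter> M)) \<le> real k * w (real k))"
proof -
  define good where "good n D J S \<longleftrightarrow> S \<subseteq> walsh ` Pow D \<and> n \<le> card S \<and>
      (\<forall>x. cmod (\<Sum>\<gamma>\<in>S. osc J \<gamma> * \<gamma> x) \<le> 6 * sin 1 ^ n * card S) \<and>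
      (\<forall>B\<subseteq>S. real (card (S \<inter> char_span B)) \<le> card B * w (card B))" for n D J S
  have "\<exists>m. n \<le> m \<and> (\<forall>D J. finite D \<longrightarrow> card D = m \<longrightarrow> J \<subseteq> D \<longrightarrow> card J = n \<longrightarrow> (\<exists>S. good n D J S))" for n
    by (rule block_exists[OF assms(2,3), of n]) (auto simp: good_def)
  then obtain m where m: "\<And>n. n \<le> m n"
    "\<And>n D J. finite D \<Longrightarrow> card D = m n \<Longrightarrow> J \<subseteq> D \<Longrightarrow> card J = n \<Longrightarrow> \<exists>S. good n D J S" by metis
  \<comment> \<open>The pairing function splits the natural numbers into disjoint columns; each
    column carries one block, and its initial entries carry the oscillation.\<close>
  define D where "D n = (\<lambda>i. prod_encode (n, i)) ` {..<m n}" for n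
  define J where "J n = (\<lambda>i. prod_encode (n, i)) ` {..<n}" for n
  have inj: "inj_on (\<lambda>i. prod_encode (n, i)) A" for n A by (auto simp: inj_on_def)
  have D: "finite (D n)" "card (D n) = m n" and J: "J n \<subseteq> D n" "card (J n) = n" for n
    using m(1)[of n] by (auto simp: D_def J_def card_image[OF inj])
  have disj: "disjoint_family D" by (auto simp: disjoint_family_on_def D_def)
  have "\<exists>S. good n (D n) (J n) S" for n by (rule m(2)[OF D J])
  then obtain Lam where "\<And>n. good n (D n) (J n) (Lam n)" by metis
  then have block: "Lam n \<subseteq> walsh ` Pow (D n)" "n \<le> card (Lam n)"
    "cmod (\<Sum>\<gamma>\<in>Lam n. osc (J n) \<gamma> * \<gamma> x) \<le> 6 * sin 1 ^ n * card (Lam n)"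
    "B \<subseteq> Lam n \<Longrightarrow> real (card (Lam n \<inter> char_span B)) \<le> card B * w (card B)" for n x B
    unfolding good_def by blast+
  \<comment> \<open>The trivial character lies in the span of the empty set, where the case
    \<open>B = {}\<close> of the span bound allows no element of the block.\<close>
  have "walsh {} \<notin> Lam n" for n
  proof
    assume "walsh {} \<in> Lam n"
    moreover have "walsh {} \<in> char_span {}" by (simp add: char_span_def char_prod_def)
    moreover have "finite (Lam n)" using finite_subset[OF block(1)] D(1) by simp
    ultimately have "0 < card (Lam n \<inter> char_span {})" by (auto simp: card_gt_0_iff)
    then show False using block(4)[of "{}" n] by simp
  qed
  then interpret walsh_blocks D J Lam
    by unfold_locales (use D(1) disj J block in auto)
  show ?thesis
  proof (intro exI[of _ "\<Union>n. Lam n"] conjI allI impI)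
    show "(\<Union>n. Lam n) \<subseteq> dual_group" using block(1) walsh_in_dual_group by blast
    show "set_of_analyticity (\<Union>n. Lam n)" by (rule set_of_analyticity_UN_Lam)
    fix k and M :: "(cantor_group \<Rightarrow> complex) set" assume "1 \<le> k \<and> is_mesh k M"
    then have "finite ((\<Union>n. Lam n) \<inter> M) \<and> card ((\<Union>n. Lam n) \<inter> M) \<le> k * w k"
      by (intro mesh_card_le[OF assms(1,2) disj D(1) block(1,4)]) auto
    then show "finite ((\<Union>n. Lam n) \<inter> M)" "card ((\<Union>n. Lam n) \<inter> M) \<le> k * w k" by auto
  qed
qed

end
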